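(* Let $X$ and $E$ be Banach spaces ($X$ real), let $(\Omega,\Sigma)$ be a measurable space, let $m:\Sigma\to X$ be a countably additive vector measure, let $1\le p\le\infty$, let $P$ be a subspace of $L^p(m)$, and let $T:P\to E$ be an isomorphism (a bounded linear bijection with bounded inverse). The following statements are equivalent. (i) There is an $m$-dual system $(P,P^m,P^{mm})$ such that $B_P$ is $\tau_m(P^m)$-sequentially compact, $B_{P^m}$ is $\tau_m(P^{mm})$-compact, and $T$ is $(q,P^m)$-summing for some $1\le q<\infty$ (and in that case $T$ is $(q,P^m)$-summing for all $1\le q<\infty$). (ii) $P$ has finite dimension.
   Context: Integration with respect to $m$: for $x^*\in X^*$, $\langle m,x^*\rangle$ is the scalar measure $A\mapsto\langle m(A),x^*\rangle$ and $|\langle m,x^*\rangle|$ is its variation. A measurable $h:\Omega\to\mathbb R$ is integrable with respect to $m$ if it is integrable with respect to every $|\langle m,x^*\rangle|$ and for each $A\in\Sigma$ there is an element $\int_A h\,dm\in X$ with $\langle\int_A h\,dm,x^*\rangle=\int_A h\,d\langle m,x^*\rangle$ for all $x^*\in X^*$; write $\int h\,dm=\int_\Omega h\,dm$. A Rybakov measure for $m$ is a measure $\eta=|\langle m,x_0^*\rangle|$, $x_0^*\in X^*$, with respect to which $m$ is absolutely continuous; it always exists. For $1\le p<\infty$, $L^p(m)$ is the Banach lattice of ($\eta$-a.e. classes of) measurable $f:\Omega\to\mathbb R$ such that $|f|^p$ is integrable with respect to $m$, with norm $\|f\|_{L^p(m)}=\big(\sup_{x^*\in B_{X^*}}\int|f|^p\,d|\langle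 m,x^*\rangle|\big)^{1/p}$; $L^\infty(m):=L^\infty(\eta)$. With $1/p+1/p'=1$, one has $fg\in L^1(m)$ for $f\in L^p(m)$, $g\in L^{p'}(m)$. $B_Y$ denotes the closed unit ball of a normed space $Y$; subspaces of $L^p(m)$ and $L^{p'}(m)$ carry the inherited norms. $m$-dual systems: a subspace $P^m\subseteq L^{p'}(m)$ is an $m$-dual of $P\subseteq L^p(m)$ if it is $m$-norming for $P$, i.e. $f\mapsto\sup_{g\in B_{P^m}}\|\int fg\,dm\|_X$ is a norm on $P$ equivalent to $\|\cdot\|_{L^p(m)}$. A subspace $P^{mm}\subseteq L^p(m)$ is an $m$-bidual of $P$ (with respect to $P^m$) if $P\subseteq P^{mm}$ and $P^{mm}$ is $m$-norming for $P^m$, i.e. $g\mapsto\sup_{f\in B_{P^{mm}}}\|\int fg\,dm\|_X$ is a norm on $P^m$ equivalent to $\|\cdot\|_{L^{p'}(m)}$. Then $(P,P^m,P^{mm})$ is called an $m$-dual system. Topologies: $\tau_m(P^m)$ is the locally convex topology on $P$ given by the seminorms $f\mapsto\|\int fg\,dm\|_X$, $g\in P^m$; $\tau_m(P^{mm})$ is the locally convex topology on $P^m$ given by the seminorms $g\mapsto\|\int fg\,dm\|_X$, $f\in P^{mm}$. Summing operators: for a Banach subspace $P$ of $L^p(m)$ and a subspace $R$ of $L^{p'}(m)$, a bounded linear operator $T:P\to E$ is $(q,R)$-summing if there is a constant $K$ such that for all finite sets $f_1,\dots,f_n\in P$, $\big(\sum_{i=1}^n\|T(f_i)\|^q\big)^{1/q}\le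 K\sup_{g\in B_R}\big(\sum_{i=1}^n\|\int f_ig\,dm\|_X^q\big)^{1/q}$. *)

theory Defs
  imports "HOL-Analysis.Analysis" "HOL-Probability.Essential_Supremum"
begin

section \<open>Vector measures and integration of scalar functions\<close>

text \<open>The measurable space \<open>(\<Omega>, \<Sigma>)\<close> is \<open>(space M, sets M)\<close>; the measure carried by \<open>M\<close> is
  never used. The dual of \<open>X\<close> is the Banach space \<open>'x \<Rightarrow>\<^sub>L real\<close> with its operator norm.
  Only the values of \<open>m\<close> on \<open>sets M\<close> matter.\<close>

definition vector_measure :: "'a measure \<Rightarrow> ('a set \<Rightarrow> 'x::banach) \<Rightarrow> bool" where
  "vector_measure M m \<longleftrightarrow>
     (\<forall>A :: nat \<Rightarrow> 'a set. range A \<subseteq> sets M \<longrightarrow> disjoint_family A \<longrightarrow>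
        (\<lambda>i. m (A i)) sums m (\<Union>i. A i))"

definition scalar_measure :: "('a set \<Rightarrow> 'x::banach) \<Rightarrow> ('x \<Rightarrow>\<^sub>L real) \<Rightarrow> 'a set \<Rightarrow> real" where
  "scalar_measure m x' A = blinfun_apply x' (m A)"

definition variation :: "'a measure \<Rightarrow> ('a set \<Rightarrow> real) \<Rightarrow> 'a measure" where
  "variation M \<mu> = measure_of (space M) (sets M)
     (\<lambda>A. SUP \<D> \<in> {\<D>. finite \<D> \<and> \<D> \<subseteq> sets M \<and> disjoint \<D> \<and> \<Union>\<D> = A}.
            \<Sum>D\<in>\<D>. ennreal \<bar>\<mu> D\<bar>)"

text \<open>The integral against a signed measure is taken through its Jordan decomposition
  \<open>\<mu> = \<mu>\<^sup>+ - \<mu>\<^sup>-\<close>, where \<open>\<mu>\<^sup>- = (-\<mu>)\<^sup>+\<close>. Negative values of \<open>\<mu> B\<close> are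
  truncated to 0 by \<open>ennreal\<close>, which does not affect the supremum because \<open>\<mu> {} = 0\<close>.\<close>

definition positive_variation :: "'a measure \<Rightarrow> ('a set \<Rightarrow> real) \<Rightarrow> 'a measure" where
  "positive_variation M \<mu> = measure_of (space M) (sets M)
     (\<lambda>A. SUP B \<in> {B \<in> sets M. B \<subseteq> A}. ennreal (\<mu> B))"

definition signed_integral ::
  "'a measure \<Rightarrow> ('a set \<Rightarrow> real) \<Rightarrow> 'a set \<Rightarrow> ('a \<Rightarrow> real) \<Rightarrow> real" where
  "signed_integral M \<mu> A h =
     set_lebesgue_integral (positive_variation M \<mu>) A h
     - set_lebesgue_integral (positive_variation M (\<lambda>B. - \<mu> B)) A h"

definition is_vm_integral ::
  "'a measure \<Rightarrow> ('a set \<Rightarrow> 'x::banach) \<Rightarrow> 'a set \<Rightarrow> ('a \<Rightarrow> real) \<Rightarrow> 'x \<Rightarrow> bool" where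
  "is_vm_integral M m A h v \<longleftrightarrow>
     (\<forall>x'. blinfun_apply x' v = signed_integral M (scalar_measure m x') A h)"

definition vm_integrable :: "'a measure \<Rightarrow> ('a set \<Rightarrow> 'x::banach) \<Rightarrow> ('a \<Rightarrow> real) \<Rightarrow> bool" where
  "vm_integrable M m h \<longleftrightarrow>
     h \<in> borel_measurable M \<and>
     (\<forall>x'. integrable (variation M (scalar_measure m x')) h) \<and>
     (\<forall>A\<in>sets M. \<exists>v. is_vm_integral M m A h v)"

definition vm_integral :: "'a measure \<Rightarrow> ('a set \<Rightarrow> 'x::banach) \<Rightarrow> ('a \<Rightarrow> real) \<Rightarrow> 'x" where
  "vm_integral M m h = (THE v. is_vm_integral M m (space M) h v)"

text \<open>Absolute continuity is taken in the sense of null sets, as in the library's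
  \<open>absolutely_continuous\<close>.\<close>

definition rybakov_measure :: "'a measure \<Rightarrow> ('a set \<Rightarrow> 'x::banach) \<Rightarrow> 'a measure \<Rightarrow> bool" where
  "rybakov_measure M m \<eta> \<longleftrightarrow>
     (\<exists>x0'. \<eta> = variation M (scalar_measure m x0')) \<and>
     (\<forall>A\<in>sets M. emeasure \<eta> A = 0 \<longrightarrow> m A = 0)"


section \<open>Almost-everywhere classes\<close>

text \<open>Elements of the function spaces are genuine \<open>\<eta>\<close>-a.e. equivalence classes, i.e. sets of
  functions. The linear operations are defined through representatives.\<close>

definition ae_class :: "'a measure \<Rightarrow> ('a \<Rightarrow> real) \<Rightarrow> ('a \<Rightarrow> real) set" where
  "ae_class \<eta> f = {g \<in> borel_measurable \<eta>. AE x in \<eta>. g x = f x}"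

definition ae_rep :: "('a \<Rightarrow> real) set \<Rightarrow> 'a \<Rightarrow> real" where
  "ae_rep F = (SOME f. f \<in> F)"

definition ae_zero :: "'a measure \<Rightarrow> ('a \<Rightarrow> real) set" where
  "ae_zero \<eta> = ae_class \<eta> (\<lambda>x. 0)"

definition ae_add ::
  "'a measure \<Rightarrow> ('a \<Rightarrow> real) set \<Rightarrow> ('a \<Rightarrow> real) set \<Rightarrow> ('a \<Rightarrow> real) set" where
  "ae_add \<eta> F G = ae_class \<eta> (\<lambda>x. ae_rep F x + ae_rep G x)"

definition ae_diff ::
  "'a measure \<Rightarrow> ('a \<Rightarrow> real) set \<Rightarrow> ('a \<Rightarrow> real) set \<Rightarrow> ('a \<Rightarrow> real) set" where
  "ae_diff \<eta> F G = ae_class \<eta> (\<lambda>x. ae_rep F x - ae_rep G x)"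

definition ae_scale :: "'a measure \<Rightarrow> real \<Rightarrow> ('a \<Rightarrow> real) set \<Rightarrow> ('a \<Rightarrow> real) set" where
  "ae_scale \<eta> c F = ae_class \<eta> (\<lambda>x. c * ae_rep F x)"

definition ae_subspace :: "'a measure \<Rightarrow> ('a \<Rightarrow> real) set set \<Rightarrow> bool" where
  "ae_subspace \<eta> P \<longleftrightarrow>
     ae_zero \<eta> \<in> P \<and> (\<forall>F\<in>P. \<forall>G\<in>P. ae_add \<eta> F G \<in> P) \<and> (\<forall>c. \<forall>F\<in>P. ae_scale \<eta> c F \<in> P)"

definition ae_finite_dimensional :: "'a measure \<Rightarrow> ('a \<Rightarrow> real) set set \<Rightarrow> bool" where
  "ae_finite_dimensional \<eta> P \<longleftrightarrow>
     (\<exists>B. finite B \<and> B \<subseteq> P \<and>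
        (\<forall>F\<in>P. \<exists>c. F = ae_class \<eta> (\<lambda>x. \<Sum>G\<in>B. c G * ae_rep G x)))"


section \<open>The spaces \<open>L\<^sup>p(m)\<close>\<close>

text \<open>The exponent ranges over \<open>ennreal\<close>, with \<open>p = top\<close> standing for \<open>p = \<infinity>\<close>.\<close>

definition Lp_vm ::
  "'a measure \<Rightarrow> ('a set \<Rightarrow> 'x::banach) \<Rightarrow> 'a measure \<Rightarrow> ennreal \<Rightarrow> ('a \<Rightarrow> real) set set" where
  "Lp_vm M m \<eta> p = ae_class \<eta> `
     {f \<in> borel_measurable M.
        if p = top then esssup \<eta> (\<lambda>x. ennreal \<bar>f x\<bar>) < top
        else vm_integrable M m (\<lambda>x. \<bar>f x\<bar> powr enn2real p)}"

definition Lp_norm ::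
  "'a measure \<Rightarrow> ('a set \<Rightarrow> 'x::banach) \<Rightarrow> 'a measure \<Rightarrow> ennreal \<Rightarrow> ('a \<Rightarrow> real) set \<Rightarrow> real" where
  "Lp_norm M m \<eta> p F =
     (if p = top then enn2real (esssup \<eta> (\<lambda>x. ennreal \<bar>ae_rep F x\<bar>))
      else (SUP x' \<in> cball 0 1.
              LINT x|variation M (scalar_measure m x'). \<bar>ae_rep F x\<bar> powr enn2real p)
           powr (1 / enn2real p))"

definition Lp_subspace ::
  "'a measure \<Rightarrow> ('a set \<Rightarrow> 'x::banach) \<Rightarrow> 'a measure \<Rightarrow> ennreal \<Rightarrow> ('a \<Rightarrow> real) set set \<Rightarrow> bool" where
  "Lp_subspace M m \<eta> p P \<longleftrightarrow> P \<subseteq> Lp_vm M m \<eta> p \<and> ae_subspace \<eta> P"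

definition Lp_unit_ball ::
  "'a measure \<Rightarrow> ('a set \<Rightarrow> 'x::banach) \<Rightarrow> 'a measure \<Rightarrow> ennreal \<Rightarrow>
     ('a \<Rightarrow> real) set set \<Rightarrow> ('a \<Rightarrow> real) set set" where
  "Lp_unit_ball M m \<eta> p P = {F \<in> P. Lp_norm M m \<eta> p F \<le> 1}"

definition vm_pairing ::
  "'a measure \<Rightarrow> ('a set \<Rightarrow> 'x::banach) \<Rightarrow> ('a \<Rightarrow> real) set \<Rightarrow> ('a \<Rightarrow> real) set \<Rightarrow> 'x" where
  "vm_pairing M m F G = vm_integral M m (\<lambda>x. ae_rep F x * ae_rep G x)"


section \<open>\<open>m\<close>-dual systems\<close>

definition is_norm_on :: "'a measure \<Rightarrow> ('a \<Rightarrow> real) set set \<Rightarrow> (('a \<Rightarrow> real) set \<Rightarrow> real) \<Rightarrow> bool" where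
  "is_norm_on \<eta> P N \<longleftrightarrow>
     (\<forall>F\<in>P. 0 \<le> N F \<and> (N F = 0 \<longleftrightarrow> F = ae_zero \<eta>)) \<and>
     (\<forall>c. \<forall>F\<in>P. N (ae_scale \<eta> c F) = \<bar>c\<bar> * N F) \<and>
     (\<forall>F\<in>P. \<forall>G\<in>P. N (ae_add \<eta> F G) \<le> N F + N G)"

definition equivalent_on ::
  "'b set \<Rightarrow> ('b \<Rightarrow> real) \<Rightarrow> ('b \<Rightarrow> real) \<Rightarrow> bool" where
  "equivalent_on P N N' \<longleftrightarrow>
     (\<exists>c>0. \<exists>C>0. \<forall>F\<in>P. c * N' F \<le> N F \<and> N F \<le> C * N' F)"

text \<open>\<open>m_norming M m \<eta> p p' P R\<close>: the subspace \<open>R\<close> of \<open>L\<^sup>p\<^sup>'(m)\<close> is \<open>m\<close>-norming for the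
  subspace \<open>P\<close> of \<open>L\<^sup>p(m)\<close>.\<close>

definition m_norming ::
  "'a measure \<Rightarrow> ('a set \<Rightarrow> 'x::banach) \<Rightarrow> 'a measure \<Rightarrow> ennreal \<Rightarrow> ennreal \<Rightarrow>
     ('a \<Rightarrow> real) set set \<Rightarrow> ('a \<Rightarrow> real) set set \<Rightarrow> bool" where
  "m_norming M m \<eta> p p' P R \<longleftrightarrow>
     (let N = (\<lambda>F. SUP G \<in> Lp_unit_ball M m \<eta> p' R. norm (vm_pairing M m F G))
      in is_norm_on \<eta> P N \<and> equivalent_on P N (Lp_norm M m \<eta> p))"

definition m_dual_system ::
  "'a measure \<Rightarrow> ('a set \<Rightarrow> 'x::banach) \<Rightarrow> 'a measure \<Rightarrow> ennreal \<Rightarrow> ennreal \<Rightarrow>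
     ('a \<Rightarrow> real) set set \<Rightarrow> ('a \<Rightarrow> real) set set \<Rightarrow> ('a \<Rightarrow> real) set set \<Rightarrow> bool" where
  "m_dual_system M m \<eta> p p' P Pm Pmm \<longleftrightarrow>
     Lp_subspace M m \<eta> p P \<and>
     Lp_subspace M m \<eta> p' Pm \<and> m_norming M m \<eta> p p' P Pm \<and>
     Lp_subspace M m \<eta> p Pmm \<and> P \<subseteq> Pmm \<and> m_norming M m \<eta> p' p Pm Pmm"

definition seminorm_topology ::
  "'a measure \<Rightarrow> ('a \<Rightarrow> real) set set \<Rightarrow> (('a \<Rightarrow> real) set \<Rightarrow> real) set \<Rightarrow> ('a \<Rightarrow> real) set topology" where
  "seminorm_topology \<eta> P S = topology_generated_by
     (insert P {{F \<in> P. s (ae_diff \<eta> F F0) < \<epsilon>} | s F0 \<epsilon>. s \<in> S \<and> F0 \<in> P \<and> 0 < \<epsilon>})"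

text \<open>\<open>tau_m M m \<eta> P R\<close> is the topology \<open>\<tau>\<^sub>m(R)\<close> on \<open>P\<close>.\<close>

definition tau_m ::
  "'a measure \<Rightarrow> ('a set \<Rightarrow> 'x::banach) \<Rightarrow> 'a measure \<Rightarrow>
     ('a \<Rightarrow> real) set set \<Rightarrow> ('a \<Rightarrow> real) set set \<Rightarrow> ('a \<Rightarrow> real) set topology" where
  "tau_m M m \<eta> P R = seminorm_topology \<eta> P ((\<lambda>G F. norm (vm_pairing M m F G)) ` R)"

definition seq_compactin :: "'b topology \<Rightarrow> 'b set \<Rightarrow> bool" where
  "seq_compactin X S \<longleftrightarrow> S \<subseteq> topspace X \<and>
     (\<forall>\<sigma> :: nat \<Rightarrow> 'b. range \<sigma> \<subseteq> S \<longrightarrow>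
        (\<exists>l\<in>S. \<exists>r. strict_mono r \<and> limitin X (\<sigma> \<circ> r) l sequentially))"


section \<open>Operators\<close>

definition Lp_isomorphism ::
  "'a measure \<Rightarrow> ('a set \<Rightarrow> 'x::banach) \<Rightarrow> 'a measure \<Rightarrow> ennreal \<Rightarrow>
     ('a \<Rightarrow> real) set set \<Rightarrow> (('a \<Rightarrow> real) set \<Rightarrow> 'e::banach) \<Rightarrow> bool" where
  "Lp_isomorphism M m \<eta> p P T \<longleftrightarrow>
     (\<forall>F\<in>P. \<forall>G\<in>P. T (ae_add \<eta> F G) = T F + T G) \<and>
     (\<forall>c. \<forall>F\<in>P. T (ae_scale \<eta> c F) = c *\<^sub>R T F) \<and>
     (\<exists>C. \<forall>F\<in>P. norm (T F) \<le> C * Lp_norm M m \<eta> p F) \<and>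
     bij_betw T P UNIV \<and>
     (\<exists>C. \<forall>e. Lp_norm M m \<eta> p (the_inv_into P T e) \<le> C * norm e)"

definition qR_summing ::
  "'a measure \<Rightarrow> ('a set \<Rightarrow> 'x::banach) \<Rightarrow> 'a measure \<Rightarrow> ennreal \<Rightarrow> real \<Rightarrow>
     ('a \<Rightarrow> real) set set \<Rightarrow> ('a \<Rightarrow> real) set set \<Rightarrow> (('a \<Rightarrow> real) set \<Rightarrow> 'e::banach) \<Rightarrow> bool" where
  "qR_summing M m \<eta> p' q R P T \<longleftrightarrow>
     (\<exists>K. \<forall>n. \<forall>F :: nat \<Rightarrow> ('a \<Rightarrow> real) set. (\<forall>i<n. F i \<in> P) \<longrightarrow>
        (\<Sum>i<n. norm (T (F i)) powr q) powr (1 / q)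
        \<le> K * (SUP G \<in> Lp_unit_ball M m \<eta> p' R.
                 (\<Sum>i<n. norm (vm_pairing M m (F i) G) powr q) powr (1 / q)))"

end

theory Submission
  imports Defs
begin

text \<open>Why (i) forces finite dimension. Take a sequence in the unit ball of \<open>P\<close>. Sequential
  compactness gives a subsequence whose differences \<open>D\<^sub>n\<close> from its limit satisfy
  \<open>\<parallel>\<integral> D\<^sub>n G dm\<parallel> \<longlonglongrightarrow> 0\<close> for every \<open>G\<close>. As functions of \<open>G\<close>, the powers
  \<open>\<parallel>\<integral> D\<^sub>n G dm\<parallel> powr q\<close> are continuous on the compact ball of \<open>Pm\<close>, uniformly bounded and
  pointwise null. For such functions suitable convex combinations with weights \<open>w\<^sub>i\<close> are
  uniformly small (\<open>Simons_convex_combination\<close>). Putting the functions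
  \<open>(w\<^sub>i powr (1/q)) D\<^sub>i\<close> into the summing inequality makes \<open>\<Sum> w\<^sub>i \<parallel>T D\<^sub>i\<parallel> powr q\<close> small,
  so the norms \<open>\<parallel>T D\<^sub>n\<parallel>\<close> cannot stay away from 0 (\<open>summing_imp_norm_null\<close>). Applied to
  subsequences this gives \<open>T D\<^sub>n \<longlonglongrightarrow> 0\<close>. As \<open>T\<close> is an isomorphism, the unit ball of \<open>E\<close> is
  compact, and Riesz's theorem applies. The convex combinations do the work of a Pietsch measure
  and of dominated convergence, and no representing measure on the ball of \<open>Pm\<close> is constructed.

  Why every exponent is then allowed. The pairings with the ball of \<open>Pm\<close> separate the points of
  the finite-dimensional space \<open>E\<close>. Compactness of the unit sphere selects finitely many
  \<open>G\<close> in the ball whose pairings already dominate the norm of \<open>E\<close>, and such a finite family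
  makes the summing inequality true for every \<open>q\<close> (\<open>finite_dimensional_summing\<close>).

  Why finite dimension gives a dual system. Let \<open>f\<^sub>b\<close> represent a basis of \<open>P\<close>, let
  \<open>u = 1 + \<Sum> \<bar>f\<^sub>b\<bar>\<close>, and let \<open>\<sigma> = \<plusminus>1\<close> be the sign of the scalar measure
  \<open>\<langle>m,x1\<rangle>\<close> for a functional \<open>x1\<close> whose variation controls \<open>m\<close>. The map
  \<open>f \<mapsto> \<sigma> f / u\<close> is linear and injective and sends \<open>P\<close> to bounded functions. Its range
  serves as \<open>Pm\<close>, and \<open>P\<close> itself as \<open>Pmm\<close>. The pairing of \<open>f\<close> with \<open>\<sigma> g / u\<close> is a
  symmetric bilinear form on \<open>P\<close>, and its value at \<open>(f, f)\<close> is sent by \<open>x1\<close> to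
  \<open>\<integral> f\<^sup>2 / u d\<bar>\<langle>m,x1\<rangle>\<bar>\<close>, which is positive for \<open>f \<noteq> 0\<close>. Hence both norming
  conditions are equivalences of norms on a finite-dimensional space, and the two balls are
  images of compact sets under continuous maps.

  Both directions need a pairing that is defined and linear: the product of functions in
  \<open>L\<^sup>p(m)\<close> and \<open>L\<^sup>p\<^sup>'(m)\<close> must be integrable. The product is dominated by an
  integrable function, by Young's inequality if \<open>1 < p < \<infinity>\<close> and trivially otherwise, so the
  point is that \<open>L\<^sup>1(m)\<close> is an ideal
  (\<open>vm_integrable_ideal\<close>). If \<open>\<bar>f\<bar> \<le> \<bar>g\<bar>\<close> with \<open>g\<close> integrable, then \<open>f / g\<close> is a uniform
  limit of simple functions, and the corresponding combinations of the vectors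
  \<open>\<integral>\<^sub>A g dm\<close> form a Cauchy sequence because \<open>\<integral> \<bar>g\<bar> d\<bar>\<langle>m,x'\<rangle>\<bar> \<le> C \<parallel>x'\<parallel>\<close>. That bound is an
  instance of the Banach--Steinhaus theorem, and norms in \<open>X\<close> are recovered from functionals by
  the Hahn--Banach theorem. Scalar integrals are handled through the Hahn decomposition, which
  turns the variation and the two parts of a signed measure into densities of one finite
  measure.\<close>

section \<open>Sublinear functionals and uniform boundedness\<close>

definition sublinear :: "('a::real_normed_vector \<Rightarrow> real) \<Rightarrow> bool" where
  "sublinear p \<longleftrightarrow> (\<forall>x y. p (x + y) \<le> p x + p y) \<and> (\<forall>t\<ge>0. \<forall>x. p (t *\<^sub>R x) \<le> t * p x)"

lemma sublinearD:
  assumes "sublinear p"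
  shows sublinear_add: "p (x + y) \<le> p x + p y"
    and sublinear_scale: "0 \<le> t \<Longrightarrow> p (t *\<^sub>R x) = t * p x"
    and sublinear_zero: "p 0 = 0"
    and sublinear_minus: "- p (- x) \<le> p x"
proof -
  have sub: "p (x + y) \<le> p x + p y" for x y using assms by (simp add: sublinear_def)
  have sc: "p (t *\<^sub>R x) \<le> t * p x" if "t \<ge> 0" for t x using assms that by (simp add: sublinear_def)
  show "p (x + y) \<le> p x + p y" by (rule sub)
  show z: "p 0 = 0" using sub[of 0 0] sc[of 0 0] by simp
  show "- p (- x) \<le> p x" using sub[of x "- x"] z by simp
  show "p (t *\<^sub>R x) = t * p x" if "0 \<le> t"
  proof (cases "t = 0")
    case False
    then have "t > 0" using that by simp
    have "p x \<le> inverse t * p (t *\<^sub>R x)" using sc[of "inverse t" "t *\<^sub>R x"] \<open>t > 0\<close> by simp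
    then have "t * p x \<le> p (t *\<^sub>R x)" using \<open>t > 0\<close> by (simp add: field_simps)
    then show ?thesis using sc[OF that, of x] by simp
  qed (simp add: z)
qed

text \<open>The largest sublinear functional below \<open>p\<close> whose value at \<open>- a\<close> is at most
  \<open>- p a\<close>. A sublinear functional that cannot be lowered in this way in any direction is odd.\<close>

definition sublinear_push :: "('a::real_normed_vector \<Rightarrow> real) \<Rightarrow> 'a \<Rightarrow> 'a \<Rightarrow> real" where
  "sublinear_push p a x = (INF t\<in>{0..}. p (x + t *\<^sub>R a) - t * p a)"

lemma sublinear_push:
  assumes p: "sublinear p"
  shows "sublinear (sublinear_push p a)"
    and "sublinear_push p a x \<le> p x"
    and "sublinear_push p a (- a) \<le> - p a"
proof -
  have lb: "- p (- x) \<le> p (x + t *\<^sub>R a) - t * p a" if "t \<ge> 0" for x t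
    using sublinear_add[OF p, of "x + t *\<^sub>R a" "- x"] sublinear_scale[OF p that, of a] by simp
  have bdd: "bdd_below ((\<lambda>t. p (x + t *\<^sub>R a) - t * p a) ` {0..})" for x
    by (rule bdd_belowI2[of _ "- p (- x)"]) (use lb in auto)
  have le: "sublinear_push p a x \<le> p (x + t *\<^sub>R a) - t * p a" if "t \<ge> 0" for x t
    unfolding sublinear_push_def using that by (intro cINF_lower[OF bdd]) auto
  show "sublinear_push p a x \<le> p x" using le[of 0 x] by simp
  show "sublinear_push p a (- a) \<le> - p a" using le[of 1 "- a"] sublinear_zero[OF p] by simp
  have add: "sublinear_push p a (x + y) \<le> sublinear_push p a x + sublinear_push p a y" for x y
  proof -
    have 1: "sublinear_push p a (x + y) \<le> (p (x + s *\<^sub>R a) - s * p a) + (p (y + t *\<^sub>R a) - t * p a)"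
      if "s \<ge> 0" "t \<ge> 0" for s t
    proof -
      have "p (x + y + (s + t) *\<^sub>R a) \<le> p (x + s *\<^sub>R a) + p (y + t *\<^sub>R a)"
        using sublinear_add[OF p, of "x + s *\<^sub>R a" "y + t *\<^sub>R a"] by (simp add: algebra_simps)
      then show ?thesis using le[of "s + t" "x + y"] that by (simp add: algebra_simps)
    qed
    have 2: "sublinear_push p a (x + y) - (p (x + s *\<^sub>R a) - s * p a) \<le> sublinear_push p a y"
      if "s \<ge> 0" for s
      unfolding sublinear_push_def[of p a y]
      by (rule cINF_greatest) (use 1[OF that] in \<open>force simp: algebra_simps\<close>)+
    have "sublinear_push p a (x + y) - sublinear_push p a y \<le> sublinear_push p a x"
      unfolding sublinear_push_def[of p a x]
      by (rule cINF_greatest) (use 2 in \<open>force simp: algebra_simps\<close>)+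
    then show ?thesis by simp
  qed
  have scale: "sublinear_push p a (t *\<^sub>R x) \<le> t * sublinear_push p a x" if "t \<ge> 0" for t x
  proof (cases "t = 0")
    case True
    then show ?thesis using le[of 0 0] sublinear_zero[OF p] by simp
  next
    case False
    then have t: "t > 0" using that by simp
    have "sublinear_push p a (t *\<^sub>R x) / t \<le> sublinear_push p a x"
      unfolding sublinear_push_def[of p a x]
    proof (rule cINF_greatest)
      fix s :: real assume "s \<in> {0..}"
      then have s: "s \<ge> 0" by simp
      have "p (t *\<^sub>R x + (t * s) *\<^sub>R a) = t * p (x + s *\<^sub>R a)"
        using sublinear_scale[OF p that, of "x + s *\<^sub>R a"] by (simp add: algebra_simps)
      then have "sublinear_push p a (t *\<^sub>R x) \<le> t * (p (x + s *\<^sub>R a) - s * p a)"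
        using le[of "t * s" "t *\<^sub>R x"] s that by (simp add: algebra_simps)
      then show "sublinear_push p a (t *\<^sub>R x) / t \<le> p (x + s *\<^sub>R a) - s * p a"
        using t by (simp add: field_simps)
    qed auto
    then show ?thesis using t by (simp add: field_simps)
  qed
  show "sublinear (sublinear_push p a)" using add scale by (simp add: sublinear_def)
qed

text \<open>Zorn's lemma is applied to the sublinear functionals below \<open>q\<close> themselves, so that no
  partially defined functionals occur. A minimal one is unchanged by \<open>sublinear_push\<close> in every
  direction, hence odd, and an odd sublinear functional is linear.\<close>

lemma Hahn_Banach_dominated:
  fixes q :: "'a::real_normed_vector \<Rightarrow> real"
  assumes q: "sublinear q"
  shows "\<exists>f. linear f \<and> (\<forall>x. f x \<le> q x)"
proof -
  define A where "A = {p. sublinear p \<and> p \<le> q}"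
  have "\<exists>m\<in>A. \<forall>a\<in>A. m \<ge> a \<longrightarrow> a = m"
  proof (rule predicate_Zorn)
    show "partial_order_on A (relation_of (\<ge>) A)"
      by (auto simp: partial_order_on_def preorder_on_def refl_on_def trans_def antisym_def
          relation_of_def)
  next
    fix C assume C: "C \<in> Chains (relation_of (\<ge>) A)"
    then have CA: "C \<subseteq> A" and comp: "\<And>p r. p \<in> C \<Longrightarrow> r \<in> C \<Longrightarrow> p \<le> r \<or> r \<le> p"
      by (auto simp: Chains_def relation_of_def)
    show "\<exists>u\<in>A. \<forall>a\<in>C. a \<ge> u"
    proof (cases "C = {}")
      case True
      then show ?thesis using q by (auto simp: A_def)
    next
      case False
      define u where "u x = (INF p\<in>C. p x)" for x
      have lb: "- q (- x) \<le> p x" if "p \<in> C" for p x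
      proof -
        have p: "sublinear p" "p \<le> q" using CA that by (auto simp: A_def)
        show ?thesis using sublinear_minus[OF p(1), of x] le_funD[OF p(2), of "- x"] by simp
      qed
      have bdd: "bdd_below ((\<lambda>p. p x) ` C)" for x
        by (rule bdd_belowI2[of _ "- q (- x)"]) (rule lb)
      have le: "u x \<le> p x" if "p \<in> C" for p x
        unfolding u_def using that by (intro cINF_lower[OF bdd])
      have add: "u (x + y) \<le> u x + u y" for x y
      proof -
        have 1: "u (x + y) \<le> p x + r y" if pr: "p \<in> C" "r \<in> C" for p r
        proof -
          from comp[OF pr] obtain w where w: "w \<in> C" "w \<le> p" "w \<le> r" using pr by blast
          then have "sublinear w" using CA by (auto simp: A_def)
          then have "u (x + y) \<le> w x + w y"
            using le[OF w(1), of "x + y"] sublinear_add[of w x y] by linarith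
          then show ?thesis using le_funD[OF w(2), of x] le_funD[OF w(3), of y] by linarith
        qed
        have 2: "u (x + y) - p x \<le> u y" if "p \<in> C" for p
          unfolding u_def[of y]
          by (rule cINF_greatest[OF False]) (use 1[OF that] in \<open>force simp: algebra_simps\<close>)
        have "u (x + y) - u y \<le> u x"
          unfolding u_def[of x]
          by (rule cINF_greatest[OF False]) (use 2 in \<open>force simp: algebra_simps\<close>)
        then show ?thesis by simp
      qed
      have scale: "u (t *\<^sub>R x) \<le> t * u x" if t: "t \<ge> 0" for t x
      proof -
        obtain p0 where p0: "p0 \<in> C" using False by blast
        have eq: "p (t *\<^sub>R x) = t * p x" if "p \<in> C" for p
          using CA that t by (auto simp: A_def sublinear_scale)
        show ?thesis
        proof (cases "t = 0")
          case True
          then show ?thesis using le[OF p0, of 0] eq[OF p0] by simp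
        next
          case False
          then have "t > 0" using t by simp
          have "u (t *\<^sub>R x) / t \<le> u x"
            unfolding u_def[of x]
          proof (rule cINF_greatest[OF \<open>C \<noteq> {}\<close>])
            fix p assume "p \<in> C"
            then show "u (t *\<^sub>R x) / t \<le> p x"
              using le[of p "t *\<^sub>R x"] eq[of p] \<open>t > 0\<close> by (simp add: field_simps)
          qed
          then show ?thesis using \<open>t > 0\<close> by (simp add: field_simps)
        qed
      qed
      obtain p0 where p0: "p0 \<in> C" using False by blast
      have "u \<le> q"
        using le[OF p0] CA p0 by (force simp: A_def le_fun_def intro: order_trans)
      then have "u \<in> A" using add scale by (simp add: A_def sublinear_def)
      then show ?thesis using le by (auto simp: le_fun_def)
    qed
  qed
  then obtain f where f: "f \<in> A" and min: "\<And>a. a \<in> A \<Longrightarrow> a \<le> f \<Longrightarrow> a = f" by blast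
  then have fs: "sublinear f" and fq: "f \<le> q" by (auto simp: A_def)
  have neg: "f (- a) = - f a" for a
  proof -
    have "sublinear_push f a \<le> f" using sublinear_push(2)[OF fs] by (simp add: le_fun_def)
    moreover from this have "sublinear_push f a \<in> A"
      using sublinear_push(1)[OF fs] fq by (auto simp: A_def)
    ultimately have "sublinear_push f a = f" by (rule min[rotated])
    then have "f (- a) \<le> - f a" using sublinear_push(3)[OF fs, of a] by simp
    then show ?thesis using sublinear_minus[OF fs, of a] by simp
  qed
  have "linear f"
  proof (rule linearI)
    fix x y show "f (x + y) = f x + f y"
      using sublinear_add[OF fs, of x y] sublinear_add[OF fs, of "- x" "- y"] neg[of "x + y"]
        neg[of x] neg[of y] by simp
  next
    fix t x show "f (t *\<^sub>R x) = t *\<^sub>R f x"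
    proof (cases "t \<ge> 0")
      case False
      then show ?thesis
        using sublinear_scale[OF fs, of "- t" x] neg[of "t *\<^sub>R x"] by simp
    qed (simp add: sublinear_scale[OF fs])
  qed
  then show ?thesis using fq by (auto simp: le_fun_def)
qed

text \<open>A linear functional dominated by \<open>sublinear_push norm v\<close> is dominated by the norm and has
  value at most \<open>- norm v\<close> at \<open>- v\<close>.\<close>

lemma norming_functional:
  fixes v :: "'a::real_normed_vector"
  shows "\<exists>x' :: 'a \<Rightarrow>\<^sub>L real. norm x' \<le> 1 \<and> blinfun_apply x' v = norm v"
proof -
  have n: "sublinear (norm :: 'a \<Rightarrow> real)" by (simp add: sublinear_def norm_triangle_ineq)
  obtain f where f: "linear f" "\<And>x. f x \<le> sublinear_push norm v x"
    using Hahn_Banach_dominated[OF sublinear_push(1)[OF n]] by blast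
  have le: "f x \<le> norm x" for x using f(2)[of x] sublinear_push(2)[OF n, of v x] by linarith
  have abs: "\<bar>f x\<bar> \<le> norm x" for x using le[of x] le[of "- x"] linear_neg[OF f(1), of x] by simp
  have bl: "bounded_linear f"
    using f(1) abs by (intro bounded_linear_intro[of _ 1])
      (auto simp: linear_add linear_scale)
  have "f v = norm v"
    using f(2)[of "- v"] sublinear_push(3)[OF n, of v] linear_neg[OF f(1), of v] le[of v] by simp
  moreover have "norm (Blinfun f) \<le> 1"
    by (rule norm_blinfun_bound) (use abs in \<open>auto simp: bounded_linear_Blinfun_apply[OF bl]\<close>)
  ultimately show ?thesis
    by (intro exI[of _ "Blinfun f"]) (simp add: bounded_linear_Blinfun_apply[OF bl])
qed

lemma functionals_separate:
  fixes v w :: "'a::real_normed_vector"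
  assumes "\<And>x' :: 'a \<Rightarrow>\<^sub>L real. blinfun_apply x' v = blinfun_apply x' w"
  shows "v = w"
  using norming_functional[of "v - w"] assms by (auto simp: blinfun.diff_right)

lemma norm_le_by_functionals:
  fixes v :: "'a::real_normed_vector"
  assumes "\<And>x' :: 'a \<Rightarrow>\<^sub>L real. norm x' \<le> 1 \<Longrightarrow> blinfun_apply x' v \<le> C"
  shows "norm v \<le> C"
  using norming_functional[of v] assms by metis

text \<open>Baire's theorem: the closed sets on which the family is bounded by \<open>n\<close> cover the space, so
  one of them contains a ball.\<close>

lemma Banach_Steinhaus:
  fixes F :: "('a::banach \<Rightarrow> 'b::real_normed_vector) set"
  assumes lin: "\<And>f. f \<in> F \<Longrightarrow> bounded_linear f"
    and bdd: "\<And>x. \<exists>B. \<forall>f\<in>F. norm (f x) \<le> B"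
  shows "\<exists>C\<ge>0. \<forall>f\<in>F. \<forall>x. norm (f x) \<le> C * norm x"
proof -
  define E where "E n = {x. \<forall>f\<in>F. norm (f x) \<le> real n}" for n :: nat
  have E_alt: "E n = (\<Inter>f\<in>F. {x. norm (f x) \<le> real n})" for n by (auto simp: E_def)
  have clE: "closed (E n)" for n
    unfolding E_alt
    by (intro closed_INT ballI closed_Collect_le continuous_intros)
      (auto intro: linear_continuous_on lin)
  have "\<Union>(range E) = UNIV"
  proof -
    have "x \<in> \<Union>(range E)" for x
    proof -
      obtain B where "\<forall>f\<in>F. norm (f x) \<le> B" using bdd by blast
      then have "x \<in> E (nat \<lceil>B\<rceil>)" unfolding E_def by (force intro: order_trans real_nat_ceiling_ge)
      then show ?thesis by blast
    qed
    then show ?thesis by blast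
  qed
  have "\<exists>n. interior (E n) \<noteq> {}"
  proof (rule ccontr)
    assume "\<not> ?thesis"
    then have "(euclidean :: 'a topology) interior_of \<Union>(range E) = {}"
      by (intro Baire_category_alt)
         (auto simp: clE interior_of_def interior_def completely_metrizable_space_euclidean)
    then show False using \<open>\<Union>(range E) = UNIV\<close> by simp
  qed
  then obtain n z where "z \<in> interior (E n)" by blast
  then obtain r where r: "r > 0" "ball z r \<subseteq> E n" by (auto simp: mem_interior)
  show ?thesis
  proof (intro exI conjI ballI allI)
    show "(4 * real n / r :: real) \<ge> 0" using r by simp
    fix f x assume f: "f \<in> F"
    interpret f: bounded_linear f by (rule lin[OF f])
    show "norm (f x) \<le> 4 * real n / r * norm x"
    proof (cases "x = 0")
      case False
      define y where "y = (r / 2 / norm x) *\<^sub>R x"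
      have "norm y < r" using r False by (simp add: y_def)
      then have "z + y \<in> E n" "z \<in> E n" using r by (auto simp: subset_iff dist_norm)
      then have "norm (f (z + y)) \<le> n" "norm (f z) \<le> n" using f by (auto simp: E_def)
      then have "norm (f y) \<le> 2 * n"
        using norm_triangle_ineq4[of "f (z + y)" "f z"] by (simp add: f.add)
      moreover have "norm (f y) = r / 2 / norm x * norm (f x)"
        using r by (simp add: y_def f.scaleR)
      ultimately show ?thesis using r False by (simp add: field_simps)
    qed (simp add: f.zero)
  qed
qed

section \<open>Finite-dimensional normed spaces\<close>

text \<open>Induction on the spanning set. A vector outside the span of the previous ones has positive
  distance to it, because the induction hypothesis makes that span closed. The distance bounds
  the coefficient of the new vector, so that coefficients and remainders converge along a
  subsequence.\<close>

lemma finite_span_seq_compact: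
  fixes B :: "'a::real_normed_vector set" and X :: "nat \<Rightarrow> 'a"
  assumes "finite B" "\<And>n. X n \<in> span B" "bounded (range X)"
  shows "\<exists>l\<in>span B. \<exists>r. strict_mono r \<and> (X \<circ> r) \<longlonglongrightarrow> l"
  using assms
proof (induction B arbitrary: X rule: finite_induct)
  case empty
  then have "X = (\<lambda>n. 0)" by auto
  then have "(X \<circ> id) \<longlonglongrightarrow> 0" by simp
  then show ?case using strict_mono_id span_zero by blast
next
  case (insert a B)
  have closed: "closed (span B)"
    unfolding closed_sequential_limits
  proof (intro allI impI, elim conjE)
    fix Y l assume Y: "\<forall>n. Y n \<in> span B" "Y \<longlonglongrightarrow> l"
    then obtain l' r where "l' \<in> span B" "strict_mono r" "(Y \<circ> r) \<longlonglongrightarrow> l'"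
      using insert.IH[of Y] convergent_imp_bounded by blast
    then show "l \<in> span B"
      using LIMSEQ_subseq_LIMSEQ[OF Y(2), of r] LIMSEQ_unique by metis
  qed
  show ?case
  proof (cases "a \<in> span B")
    case True
    then have "span (insert a B) = span B" by (simp add: span_redundant)
    then show ?thesis using insert.IH[of X] insert.prems by simp
  next
    case False
    define d where "d = infdist a (span B)"
    have d: "d > 0" using False closed span_zero[of B] infdist_pos_not_in_closed unfolding d_def by blast
    obtain t where t: "\<And>n. X n - t n *\<^sub>R a \<in> span B"
      using insert.prems(1) by (auto simp: span_insert) metis
    obtain M where M: "\<And>n. norm (X n) \<le> M" using insert.prems(2) by (auto simp: bounded_iff)
    have tb: "\<bar>t n\<bar> \<le> M / d" for n
    proof (cases "t n = 0")
      case False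
      have "(- 1 / t n) *\<^sub>R (X n - t n *\<^sub>R a) \<in> span B" using t by (rule span_scale)
      then have "d \<le> dist a ((- 1 / t n) *\<^sub>R (X n - t n *\<^sub>R a))"
        unfolding d_def by (rule infdist_le)
      also have "\<dots> = norm (X n) / \<bar>t n\<bar>"
        using False by (simp add: dist_norm algebra_simps)
      finally show ?thesis using M[of n] d False by (simp add: field_simps)
    qed (use d M[of n] in \<open>simp add: order_trans[OF norm_ge_zero]\<close>)
    have "bounded (range t)" using tb by (auto simp: bounded_iff intro!: exI[of _ "M / d"])
    then obtain t0 r where r: "strict_mono (r :: nat \<Rightarrow> nat)" "(t \<circ> r) \<longlonglongrightarrow> t0"
      using bounded_imp_convergent_subsequence by blast
    define Y where "Y n = X (r n) - t (r n) *\<^sub>R a" for n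
    have "norm (Y n) \<le> M + M / d * norm a" for n
      unfolding Y_def using norm_triangle_ineq4[of "X (r n)" "t (r n) *\<^sub>R a"] M[of "r n"]
        mult_right_mono[OF tb[of "r n"] norm_ge_zero[of a]] by simp
    then have "bounded (range Y)" by (auto simp: bounded_iff)
    then obtain l r' where l: "l \<in> span B" "strict_mono r'" "(Y \<circ> r') \<longlonglongrightarrow> l"
      using insert.IH[of Y] t unfolding Y_def by blast
    have "(\<lambda>n. (Y \<circ> r') n + ((t \<circ> r) \<circ> r') n *\<^sub>R a) \<longlonglongrightarrow> l + t0 *\<^sub>R a"
      by (intro tendsto_intros l(3) LIMSEQ_subseq_LIMSEQ[OF r(2) l(2)])
    then have "(X \<circ> (r \<circ> r')) \<longlonglongrightarrow> l + t0 *\<^sub>R a" by (simp add: Y_def o_def)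
    moreover have "l + t0 *\<^sub>R a \<in> span (insert a B)"
      using l(1) unfolding span_insert by (auto intro!: exI[of _ t0])
    ultimately show ?thesis using strict_mono_o[OF r(1) l(2)] by blast
  qed
qed

lemma closed_finite_span:
  fixes B :: "'a::real_normed_vector set"
  assumes "finite B"
  shows "closed (span B)"
  unfolding closed_sequential_limits
proof (intro allI impI, elim conjE)
  fix Y l assume Y: "\<forall>n. Y n \<in> span B" "Y \<longlonglongrightarrow> l"
  then obtain l' r where "l' \<in> span B" "strict_mono r" "(Y \<circ> r) \<longlonglongrightarrow> l'"
    using finite_span_seq_compact[OF assms, of Y] convergent_imp_bounded by blast
  then show "l \<in> span B"
    using LIMSEQ_subseq_LIMSEQ[OF Y(2), of r] LIMSEQ_unique by metis
qed

lemma finite_span_compact: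
  fixes B :: "'a::real_normed_vector set"
  assumes "finite B" "span B = UNIV" "closed (S :: 'a set)" "bounded S"
  shows "compact S"
  unfolding compact_eq_seq_compact_metric seq_compact_def
proof (intro allI impI)
  fix f :: "nat \<Rightarrow> 'a" assume f: "\<forall>n. f n \<in> S"
  then have "bounded (range f)" using assms(4) by (auto intro: bounded_subset)
  then obtain l r where "strict_mono r" "(f \<circ> r) \<longlonglongrightarrow> l"
    using finite_span_seq_compact[OF assms(1), of f] assms(2) by auto
  moreover from this have "l \<in> S"
    using closed_sequentially[OF assms(3), of "f \<circ> r" l] f by simp
  ultimately show "\<exists>l\<in>S. \<exists>r. strict_mono r \<and> (f \<circ> r) \<longlonglongrightarrow> l" by blast
qed

text \<open>The coordinate of \<open>e\<close> at \<open>b\<close> is at most \<open>norm e\<close> divided by the distance of \<open>b\<close> from the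
  closed span of the other basis vectors.\<close>

lemma finite_basis_coordinates_bounded:
  fixes B :: "'a::real_normed_vector set"
  assumes "finite B" "independent B" "span B = UNIV"
  shows "\<exists>C\<ge>0. \<forall>e b. \<bar>representation B e b\<bar> \<le> C * norm e"
proof -
  have "\<exists>C. \<forall>e. \<bar>representation B e b\<bar> \<le> C * norm e" if b: "b \<in> B" for b
  proof -
    define V where "V = span (B - {b})"
    have cl: "closed V" unfolding V_def using assms(1) by (intro closed_finite_span) auto
    have "b \<notin> V" using assms(2) b by (auto simp: V_def dependent_def)
    define d where "d = infdist b V"
    have d: "d > 0" using \<open>b \<notin> V\<close> cl span_zero infdist_pos_not_in_closed unfolding d_def V_def by blast
    have "\<bar>representation B e b\<bar> \<le> 1 / d * norm e" for e
    proof (cases "representation B e b = 0")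
      case False
      let ?c = "representation B e"
      have "e = (\<Sum>x\<in>B. ?c x *\<^sub>R x)"
        using sum_representation_eq[OF assms(2) _ assms(1) subset_refl, of e] assms(3) by simp
      also have "\<dots> = ?c b *\<^sub>R b + (\<Sum>x\<in>B - {b}. ?c x *\<^sub>R x)"
        using assms(1) b by (simp add: sum.remove)
      finally have e: "e = ?c b *\<^sub>R b + (\<Sum>x\<in>B - {b}. ?c x *\<^sub>R x)" .
      define v where "v = (\<Sum>x\<in>B - {b}. ?c x *\<^sub>R x)"
      have v: "v \<in> V" unfolding v_def V_def by (intro span_sum span_scale span_base)
      then have "(- 1 / ?c b) *\<^sub>R v \<in> V" unfolding V_def by (rule span_scale)
      then have "d \<le> dist b ((- 1 / ?c b) *\<^sub>R v)" unfolding d_def by (rule infdist_le)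
      also have "b - (- 1 / ?c b) *\<^sub>R v = (1 / ?c b) *\<^sub>R (?c b *\<^sub>R b + v)"
        using False by (simp add: algebra_simps)
      then have "dist b ((- 1 / ?c b) *\<^sub>R v) = norm e / \<bar>?c b\<bar>"
        using e by (simp add: dist_norm v_def)
      finally show ?thesis using d False by (simp add: field_simps)
    qed (use d in simp)
    then show ?thesis by blast
  qed
  then obtain C where C: "\<And>b e. b \<in> B \<Longrightarrow> \<bar>representation B e b\<bar> \<le> C b * norm e" by metis
  have "\<bar>representation B e b\<bar> \<le> (\<Sum>b\<in>B. \<bar>C b\<bar>) * norm e" for e b
  proof (cases "b \<in> B")
    case True
    have "C b \<le> (\<Sum>b\<in>B. \<bar>C b\<bar>)"
      using member_le_sum[OF True, of "\<lambda>b. \<bar>C b\<bar>"] assms(1) by simp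
    then show ?thesis using C[OF True, of e] mult_right_mono[OF _ norm_ge_zero[of e]]
      by (meson order_trans)
  next
    case False
    then have "representation B e b = 0" using representation_ne_zero by blast
    then show ?thesis by (simp add: sum_nonneg)
  qed
  then show ?thesis by (intro exI[of _ "\<Sum>b\<in>B. \<bar>C b\<bar>"]) (auto simp: sum_nonneg)
qed

text \<open>Cover the ball by finitely many balls of radius 1/2 and let \<open>V\<close> be the span of their
  centres. Rescaling around a point of \<open>V\<close> that is almost nearest to a given vector produces a
  point of \<open>V\<close> at less than the distance to \<open>V\<close>, unless the vector lies in \<open>V\<close>.\<close>

lemma Riesz_finite_dimension:
  assumes "compact (cball (0 :: 'a::real_normed_vector) 1)"
  shows "\<exists>B :: 'a set. finite B \<and> span B = UNIV"
proof -
  obtain B :: "'a set" where B: "finite B" "cball 0 1 \<subseteq> (\<Union>b\<in>B. ball b (1/2))"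
  proof (rule compactE_image[OF assms, of "cball 0 1" "\<lambda>b. ball b (1/2)"])
    show "cball 0 1 \<subseteq> (\<Union>b\<in>cball (0::'a) 1. ball b (1/2))"
      by (rule subsetI, rule UN_I) auto
  qed auto
  have "x \<in> span B" for x
  proof (rule ccontr)
    assume x: "x \<notin> span B"
    define d where "d = infdist x (span B)"
    have ne: "span B \<noteq> {}" using span_zero by blast
    have d: "d > 0"
      using x closed_finite_span[OF B(1)] ne infdist_pos_not_in_closed unfolding d_def by blast
    have "\<exists>v\<in>span B. dist x v < 2 * d"
    proof (rule ccontr)
      assume "\<not> ?thesis"
      then have "2 * d \<le> infdist x (span B)"
        unfolding infdist_def using ne by (auto intro!: cINF_greatest simp: not_less)
      then show False using d d_def by simp
    qed
    then obtain v where v: "v \<in> span B" "dist x v < 2 * d" by blast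
    define n where "n = norm (x - v)"
    have n: "n > 0" using x v by (auto simp: n_def)
    have "(1 / n) *\<^sub>R (x - v) \<in> cball 0 1" using n by (simp add: n_def)
    then obtain b where b: "b \<in> B" "dist b ((1 / n) *\<^sub>R (x - v)) < 1/2"
      using B(2) unfolding subset_eq UN_iff mem_ball by blast
    have "v + n *\<^sub>R b \<in> span B" using span_add[OF v(1) span_scale[OF span_base[OF b(1)]]] .
    then have "d \<le> dist x (v + n *\<^sub>R b)" unfolding d_def by (rule infdist_le)
    also have "\<dots> = norm ((- n) *\<^sub>R (b - (1 / n) *\<^sub>R (x - v)))"
      unfolding dist_norm using n by (intro arg_cong[of _ _ norm]) (simp add: algebra_simps)
    also have "\<dots> = n * dist b ((1 / n) *\<^sub>R (x - v))"
      using n by (simp add: dist_norm)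
    also have "\<dots> < n * (1/2)" using b n by (intro mult_strict_left_mono)
    also have "\<dots> < d" using v by (simp add: n_def dist_norm)
    finally show False .
  qed
  then show ?thesis using B(1) by blast
qed

lemma finite_span_compact_sphere:
  fixes B :: "'a::real_normed_vector set"
  assumes "finite B" "span B = UNIV"
  shows "compact (sphere (0 :: 'a) 1)"
proof (rule finite_span_compact[OF assms])
  have "sphere (0 :: 'a) 1 = {x. norm x = 1}" by auto
  then show "closed (sphere (0 :: 'a) 1)" by (simp add: closed_Collect_eq continuous_on_norm)
  show "bounded (sphere (0 :: 'a) 1)" by (rule bounded_subset[OF bounded_cball[of 0 1]]) auto
qed

lemma finite_dimensional_linear_bounded:
  fixes f :: "'e::real_normed_vector \<Rightarrow> 'y::real_normed_vector"
  assumes B: "finite B" "independent B" "span B = UNIV" and f: "linear f"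
    and C: "\<And>e b. \<bar>representation B e b\<bar> \<le> C * norm e"
  shows "norm (f e) \<le> C * (\<Sum>b\<in>B. norm (f b)) * norm e"
proof -
  have "e = (\<Sum>b\<in>B. representation B e b *\<^sub>R b)"
    using sum_representation_eq[OF B(2) _ B(1) subset_refl, of e] B(3) by simp
  then have "f e = (\<Sum>b\<in>B. representation B e b *\<^sub>R f b)"
    by (metis (no_types, lifting) f linear_sum linear_scale sum.cong)
  also have "norm \<dots> \<le> (\<Sum>b\<in>B. \<bar>representation B e b\<bar> * norm (f b))"
    by (rule order_trans[OF norm_sum]) simp
  also have "\<dots> \<le> (\<Sum>b\<in>B. C * norm e * norm (f b))"
    by (intro sum_mono mult_right_mono C) simp
  also have "\<dots> = C * (\<Sum>b\<in>B. norm (f b)) * norm e"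
    by (simp add: sum_distrib_left sum_distrib_right mult_ac)
  finally show ?thesis .
qed

text \<open>By homogeneity it suffices to look at the unit sphere, which is compact. The lower norm
  bounds in the construction of a dual system come from here.\<close>

lemma homogeneous_lower_bound:
  fixes \<phi> :: "'e::real_normed_vector \<Rightarrow> real"
  assumes B: "finite B" "span B = (UNIV :: 'e set)" and cont: "continuous_on UNIV \<phi>"
    and pos: "\<And>e. e \<noteq> 0 \<Longrightarrow> \<phi> e > 0" and hom: "\<And>t e. \<phi> (t *\<^sub>R e) = \<bar>t\<bar> ^ k * \<phi> e" and k: "k > 0"
  shows "\<exists>c>0. \<forall>e. c * norm e ^ k \<le> \<phi> e"
proof -
  have "\<exists>c>0. \<forall>e\<in>sphere 0 1. c \<le> \<phi> e"
  proof (cases "sphere (0 :: 'e) 1 = {}")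
    case True
    then show ?thesis by (intro exI[of _ 1]) simp
  next
    case False
    have "compact (sphere (0 :: 'e) 1)" by (rule finite_span_compact_sphere[OF B])
    then obtain e0 where e0: "e0 \<in> sphere 0 1" "\<And>e. e \<in> sphere 0 1 \<Longrightarrow> \<phi> e0 \<le> \<phi> e"
      using continuous_attains_inf[OF _ False continuous_on_subset[OF cont subset_UNIV]] by blast
    then have "\<phi> e0 > 0" by (intro pos) auto
    then show ?thesis using e0 by blast
  qed
  then obtain c where c: "c > 0" "\<And>e. e \<in> sphere 0 1 \<Longrightarrow> c \<le> \<phi> e" by blast
  have "c * norm e ^ k \<le> \<phi> e" for e
  proof (cases "e = 0")
    case True
    then show ?thesis using hom[of 0 e] k by (simp add: zero_power)
  next
    case False
    have "c \<le> \<phi> ((1 / norm e) *\<^sub>R e)" using False by (intro c) simp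
    also have "\<dots> = \<phi> e / norm e ^ k" unfolding hom by (simp add: power_divide power_one_over)
    finally show ?thesis using False by (simp add: field_simps)
  qed
  then show ?thesis using c(1) by blast
qed

section \<open>Convex combinations of pointwise null sequences\<close>

lemma exists_approx_minimizer:
  fixes F :: "'b \<Rightarrow> real"
  assumes "S \<noteq> {}" "\<And>g. g \<in> S \<Longrightarrow> L \<le> F g" "\<delta> > 0"
  shows "\<exists>f\<in>S. \<forall>g\<in>S. F f \<le> F g + \<delta>"
proof -
  have bdd: "bdd_below (F ` S)" using assms(2) by (rule bdd_belowI2)
  obtain f where "f \<in> S" "F f < Inf (F ` S) + \<delta>"
    using cInf_lessD[of "F ` S" "Inf (F ` S) + \<delta>"] assms(1,3) by auto
  moreover have "Inf (F ` S) \<le> F g" if "g \<in> S" for g using that bdd by (rule cINF_lower[rotated])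
  ultimately show ?thesis by (intro bexI[of _ f]) force+
qed

text \<open>Dyadic convex combinations of the \<open>\<phi> k\<close> with \<open>k \<ge> n\<close>. Closure under midpoints is all
  that the argument for \<open>Simons_convex_combination\<close> uses, and it keeps every combination
  finite.\<close>

inductive_set tail_averages :: "(nat \<Rightarrow> 'k \<Rightarrow> real) \<Rightarrow> nat \<Rightarrow> ('k \<Rightarrow> real) set"
  for \<phi> n where
    member: "n \<le> k \<Longrightarrow> \<phi> k \<in> tail_averages \<phi> n"
  | midpoint: "f \<in> tail_averages \<phi> n \<Longrightarrow> g \<in> tail_averages \<phi> n \<Longrightarrow>
      (\<lambda>x. (f x + g x) / 2) \<in> tail_averages \<phi> n"

lemma tail_averages_mono:
  assumes "f \<in> tail_averages \<phi> n" "m \<le> n"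
  shows "f \<in> tail_averages \<phi> m"
  using assms by induction (auto intro: tail_averages.intros)

lemma tail_averages_bounds:
  assumes "f \<in> tail_averages \<phi> n" "\<And>k. n \<le> k \<Longrightarrow> a \<le> \<phi> k x \<and> \<phi> k x \<le> b"
  shows "a \<le> f x \<and> f x \<le> b"
  using assms by induction auto

lemma tail_averages_continuous:
  assumes "f \<in> tail_averages \<phi> n" "\<And>k. continuous_on K (\<phi> k)"
  shows "continuous_on K f"
  using assms(1)
proof induction
  case (member k) then show ?case using assms(2) by simp
qed (intro continuous_intros; simp)

lemma tail_averages_weights:
  assumes "f \<in> tail_averages \<phi> n"
  shows "\<exists>N w. (\<forall>i. 0 \<le> w i) \<and> (\<Sum>i<N. w i) = 1 \<and> f = (\<lambda>x. \<Sum>i<(N::nat). w i * \<phi> i x)"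
proof -
  have "\<exists>N w. (\<forall>i. 0 \<le> w i) \<and> (\<forall>i\<ge>N. w i = 0) \<and> (\<Sum>i<N. w i) = 1 \<and>
      f = (\<lambda>x. \<Sum>i<(N::nat). w i * \<phi> i x)"
    using assms
  proof induction
    case (member k)
    define w :: "nat \<Rightarrow> real" where "w i = (if i = k then 1 else 0)" for i
    have sum: "(\<Sum>i<Suc k. w i * c i) = c k" for c
    proof -
      have "(\<Sum>i<k. w i * c i) = 0" by (rule sum.neutral) (simp add: w_def)
      then show ?thesis by (simp add: w_def)
    qed
    have "(\<Sum>i<Suc k. w i) = 1" using sum[of "\<lambda>_. 1"] by (simp only: mult_1_right)
    moreover have "\<phi> k = (\<lambda>x. \<Sum>i<Suc k. w i * \<phi> i x)" by (simp only: sum)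
    moreover have "\<forall>i. 0 \<le> w i" "\<forall>i\<ge>Suc k. w i = 0" by (auto simp: w_def)
    ultimately show ?case by blast
  next
    case (midpoint f g)
    from midpoint.IH(1) obtain N w where f: "\<forall>i. 0 \<le> w i" "\<forall>i\<ge>N. w i = 0" "(\<Sum>i<N. w i) = 1"
        "f = (\<lambda>x. \<Sum>i<(N::nat). w i * \<phi> i x)"
      by blast
    from midpoint.IH(2) obtain M \<mu> where g: "\<forall>i. 0 \<le> \<mu> i" "\<forall>i\<ge>M. \<mu> i = 0" "(\<Sum>i<M. \<mu> i) = 1"
        "g = (\<lambda>x. \<Sum>i<(M::nat). \<mu> i * \<phi> i x)"
      by blast
    define R where "R = max N M"
    have ext: "(\<Sum>i<N. w i * c i) = (\<Sum>i<R. w i * c i)"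
      "(\<Sum>i<M. \<mu> i * c i) = (\<Sum>i<R. \<mu> i * c i)" for c :: "nat \<Rightarrow> real"
      by (intro sum.mono_neutral_left; use f(2) g(2) in \<open>auto simp: R_def\<close>)+
    show ?case
    proof (intro exI[of _ R] exI[of _ "\<lambda>i. (w i + \<mu> i) / 2"] conjI)
      show "(\<Sum>i<R. (w i + \<mu> i) / 2) = 1"
        using ext[of "\<lambda>_. 1"] f(3) g(3) by (simp add: sum.distrib flip: sum_divide_distrib)
      show "(\<lambda>x. (f x + g x) / 2) = (\<lambda>x. \<Sum>i<R. (w i + \<mu> i) / 2 * \<phi> i x)"
        by (simp add: f(4) g(4) ext sum.distrib[symmetric] sum_divide_distrib fun_eq_iff
            algebra_simps add_divide_distrib)
    qed (use f g in \<open>auto simp: R_def\<close>)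
  qed
  then show ?thesis by blast
qed

text \<open>Simons' argument. Choose tail averages \<open>f\<^sub>n\<close> one after the other so that, with
  \<open>h\<^sub>n = \<Sum>k<n. f\<^sub>k / 2^(k+1)\<close>, the maximum of \<open>h\<^sub>n + f\<^sub>n / 2^n\<close> over \<open>K\<close> is almost
  minimal. Let \<open>x\<close> be a point where the limit \<open>H\<close> of the \<open>h\<^sub>n\<close> attains its maximum \<open>P\<close>.
  Near-minimality forces \<open>h\<^sub>n\<close> to stay below \<open>(1 - 1/2^n) P\<close> at \<open>x\<close> up to a small error,
  so the remaining mass \<open>1/2^n\<close> must contribute almost \<open>P / 2^n\<close> there. Its contribution
  tends to 0 relative to \<open>1/2^n\<close>, since the functions are null at \<open>x\<close>. Hence \<open>P\<close> is small, and
  so is the finite combination \<open>h\<^sub>m + f\<^sub>m / 2^m\<close>. Pointwise convergence alone would not be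
  enough without the maximum point supplied by compactness.\<close>

lemma Simons_convex_combination:
  fixes \<phi> :: "nat \<Rightarrow> 'k::topological_space \<Rightarrow> real"
  assumes K: "compact K" "K \<noteq> {}"
    and cont: "\<And>n. continuous_on K (\<phi> n)"
    and range: "\<And>n x. x \<in> K \<Longrightarrow> 0 \<le> \<phi> n x \<and> \<phi> n x \<le> 1"
    and null: "\<And>x. x \<in> K \<Longrightarrow> (\<lambda>n. \<phi> n x) \<longlonglongrightarrow> 0"
    and \<epsilon>: "\<epsilon> > 0"
  shows "\<exists>N w. (\<forall>i. 0 \<le> w i) \<and> (\<Sum>i<N. w i) = 1 \<and> (\<forall>x\<in>K. (\<Sum>i<(N::nat). w i * \<phi> i x) \<le> \<epsilon>)"
proof -
  define \<delta> where "\<delta> = \<epsilon> / 4"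
  have \<delta>: "\<delta> > 0" using \<epsilon> by (simp add: \<delta>_def)
  define p where "p u = (SUP x\<in>K. u x)" for u :: "'k \<Rightarrow> real"
  have p_upper: "u x \<le> p u" if "x \<in> K" "\<And>x. x \<in> K \<Longrightarrow> u x \<le> B" for u x and B :: real
    unfolding p_def using that by (intro cSUP_upper bdd_aboveI2[of _ _ B])
  have p_least: "p u \<le> B" if "\<And>x. x \<in> K \<Longrightarrow> u x \<le> B" for u and B :: real
    unfolding p_def using that K by (intro cSUP_least) auto
  let ?T = "tail_averages \<phi>"
  have T01: "0 \<le> f x \<and> f x \<le> 1" if "f \<in> ?T n" "x \<in> K" for f n x
    using that range by (intro tail_averages_bounds[OF that(1)]) auto
  \<comment> \<open>The error \<open>\<delta> / 4^n\<close> must be small compared with the remaining mass \<open>1 / 2^n\<close>.\<close>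
  define sel where "sel n h = (SOME f. f \<in> ?T n \<and>
      (\<forall>g\<in>?T n. p (\<lambda>x. h x + (1/2)^n * f x) \<le> p (\<lambda>x. h x + (1/2)^n * g x) + \<delta> * (1/4)^n))"
    for n h
  have sel: "sel n h \<in> ?T n \<and>
      (\<forall>g\<in>?T n. p (\<lambda>x. h x + (1/2)^n * sel n h x) \<le> p (\<lambda>x. h x + (1/2)^n * g x) + \<delta> * (1/4)^n)"
    if h: "\<And>x. x \<in> K \<Longrightarrow> 0 \<le> h x \<and> h x \<le> 1" for n h
  proof -
    have "\<exists>f\<in>?T n. \<forall>g\<in>?T n.
        p (\<lambda>x. h x + (1/2)^n * f x) \<le> p (\<lambda>x. h x + (1/2)^n * g x) + \<delta> * (1/4)^n"
    proof (rule exists_approx_minimizer[where L = 0 and F = "\<lambda>f. p (\<lambda>x. h x + (1/2)^n * f x)"])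
      show "?T n \<noteq> {}" using tail_averages.member[of n n \<phi>] by blast
      fix g assume g: "g \<in> ?T n"
      obtain x where x: "x \<in> K" using K by blast
      have "h y + (1/2)^n * g y \<le> 2" if "y \<in> K" for y
        using h[OF that] T01[OF g that] mult_mono[of "(1/2::real)^n" 1 "g y" 1]
        by (simp add: power_le_one)
      then have "h x + (1/2)^n * g x \<le> p (\<lambda>x. h x + (1/2)^n * g x)"
        by (rule p_upper[OF x])
      then show "0 \<le> p (\<lambda>x. h x + (1/2)^n * g x)"
      proof (rule order_trans[rotated])
        have "0 \<le> (1/2)^n * g x" using T01[OF g x] by simp
        then show "0 \<le> h x + (1/2)^n * g x" using h[OF x] by linarith
      qed
    next
      show "0 < \<delta> * (1/4)^n" using \<delta> by simp
    qed
    then have "\<exists>f. f \<in> ?T n \<and> (\<forall>g\<in>?T n.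
        p (\<lambda>x. h x + (1/2)^n * f x) \<le> p (\<lambda>x. h x + (1/2)^n * g x) + \<delta> * (1/4)^n)" by blast
    from someI_ex[OF this] show ?thesis unfolding sel_def .
  qed
  define hs where "hs = rec_nat (\<lambda>x. 0) (\<lambda>n h x. h x + (1/2)^Suc n * sel n h x)"
  define f where "f n = sel n (hs n)" for n
  have hs0: "hs 0 x = 0" for x by (simp add: hs_def)
  have hsSuc: "hs (Suc n) x = hs n x + (1/2)^Suc n * f n x" for n x by (simp add: hs_def f_def)
  have hs_range: "0 \<le> hs n x \<and> hs n x \<le> 1 - (1/2)^n" if "x \<in> K" for n x
    using that
  proof (induction n arbitrary: x)
    case (Suc n)
    have "0 \<le> hs n y \<and> hs n y \<le> 1" if "y \<in> K" for y
      using Suc.IH[OF that] zero_le_power[of "1/2::real" n] by linarith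
    then have "f n \<in> ?T n" using sel unfolding f_def by blast
    then have "0 \<le> f n x \<and> f n x \<le> 1" using T01 Suc.prems by blast
    moreover from this have "0 \<le> (1/2)^Suc n * f n x" "(1/2)^Suc n * f n x \<le> (1/2)^Suc n * (1::real)"
      by (auto intro!: mult_left_mono simp del: power_Suc)
    moreover have "(1/2::real)^n = 2 * (1/2)^Suc n" by simp
    ultimately show ?case using Suc.IH[OF Suc.prems] unfolding hsSuc by linarith
  qed (simp add: hs0)
  have hs01: "0 \<le> hs n x \<and> hs n x \<le> 1" if "x \<in> K" for n x
    using hs_range[OF that, of n] zero_le_power[of "1/2::real" n] by linarith
  have fT: "f n \<in> ?T n" for n using sel[of "hs n" n, OF hs01] unfolding f_def by blast
  have f01: "0 \<le> f n x \<and> f n x \<le> 1" if "x \<in> K" for n x using T01[OF fT that] .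
  define q where "q n = p (\<lambda>x. hs n x + (1/2)^n * f n x)" for n
  \<comment> \<open>Every later candidate was already available at stage \<open>n\<close>.\<close>
  have step: "\<exists>g\<in>?T n. \<forall>x. hs m x + (1/2)^m * u x = hs n x + (1/2)^n * g x"
    if "n \<le> m" "u \<in> ?T m" for n m u
    using that
  proof (induction m arbitrary: u rule: dec_induct)
    case (step m)
    have "(\<lambda>x. (f m x + u x) / 2) \<in> ?T m"
      by (intro tail_averages.midpoint fT tail_averages_mono[OF step.prems]) simp
    then obtain g where "g \<in> ?T n"
        "\<forall>x. hs m x + (1/2)^m * ((f m x + u x) / 2) = hs n x + (1/2)^n * g x"
      using step.IH by blast
    moreover have "hs (Suc m) x + (1/2)^Suc m * u x = hs m x + (1/2)^m * ((f m x + u x) / 2)" for x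
      by (simp add: hsSuc field_simps)
    ultimately show ?case by metis
  qed blast
  have q_step: "q n \<le> q m + \<delta> * (1/4)^n" if nm: "n \<le> m" for n m
  proof -
    obtain g where g: "g \<in> ?T n" "\<And>x. hs m x + (1/2)^m * f m x = hs n x + (1/2)^n * g x"
      using step[OF nm fT] by blast
    have "q n \<le> p (\<lambda>x. hs n x + (1/2)^n * g x) + \<delta> * (1/4)^n"
      unfolding q_def using sel[of "hs n" n, OF hs01] g(1) unfolding f_def by blast
    then show ?thesis unfolding q_def by (simp add: g(2))
  qed
  define a where "a k x = (1/2)^Suc k * f k x" for k x
  have hs_sum: "hs n x = (\<Sum>k<n. a k x)" for n x
    by (induction n) (simp_all add: hs0 hsSuc a_def)
  have a_bd: "norm (a k x) \<le> (1/2)^Suc k" if "x \<in> K" for k x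
    using f01[OF that, of k] by (auto simp: a_def abs_mult intro!: mult_left_le simp del: power_Suc)
  have geo: "summable (\<lambda>k. (1/2::real)^Suc k)" "(\<Sum>k. (1/2::real)^Suc k) = 1"
    using power_half_series by (auto simp: sums_iff)
  define H where "H x = (\<Sum>k. a k x)" for x
  have summ: "summable (\<lambda>k. a k x)" if "x \<in> K" for x
    by (rule summable_comparison_test'[OF geo(1), of 0]) (use a_bd[OF that] in simp)
  have unif: "uniform_limit K (\<lambda>n x. \<Sum>k<n. a k x) H sequentially"
    unfolding H_def by (rule Weierstrass_m_test[OF a_bd geo(1)])
  have "continuous_on K H"
  proof (rule uniform_limit_theorem[OF _ unif])
    show "\<forall>\<^sub>F n in sequentially. continuous_on K (\<lambda>x. \<Sum>k<n. a k x)"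
      unfolding a_def
      by (intro always_eventually allI continuous_intros tail_averages_continuous[OF fT cont])
  qed simp
  then obtain x where x: "x \<in> K" "\<And>y. y \<in> K \<Longrightarrow> H y \<le> H x"
    using continuous_attains_sup[OF K] by blast
  define P where "P = H x"
  have hs_le_H: "hs n y \<le> H y" if "y \<in> K" for n y
    unfolding hs_sum H_def using f01[OF that]
    by (intro sum_le_suminf summ that) (auto simp: a_def)
  have qP: "q n \<le> P + \<delta> * (1/4)^n" for n
  proof -
    have qm: "q m \<le> P + (1/2)^m" for m
      unfolding q_def
    proof (rule p_least)
      fix y assume y: "y \<in> K"
      have "(1/2)^m * f m y \<le> (1/2)^m" using f01[OF y, of m] by (auto intro!: mult_left_le)
      then show "hs m y + (1/2)^m * f m y \<le> P + (1/2)^m"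
        using hs_le_H[OF y, of m] x(2)[OF y] unfolding P_def by linarith
    qed
    have "\<exists>N. \<forall>m\<ge>N. q n \<le> P + (1/2)^m + \<delta> * (1/4)^n"
      using order_trans[OF q_step add_right_mono[OF qm]] by blast
    moreover have "(\<lambda>m. P + (1/2)^m + \<delta> * (1/4)^n) \<longlonglongrightarrow> P + 0 + \<delta> * (1/4)^n"
      by (intro tendsto_intros LIMSEQ_power_zero) simp
    ultimately show ?thesis using LIMSEQ_le_const[of _ "P + 0 + \<delta> * (1/4)^n" "q n"] by simp
  qed
  \<comment> \<open>\<open>h\<^sub>n\<^sub>+\<^sub>1\<close> is the mean of \<open>h\<^sub>n\<close> and \<open>h\<^sub>n + f\<^sub>n / 2^n\<close>, and the latter is at most
    \<open>P + \<delta> / 4^n\<close> everywhere. The last term absorbs the errors of all earlier steps.\<close>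
  have hs_x: "hs n x \<le> (1 - (1/2)^n) * P + 2 * \<delta> * (1/2)^n - 2 * \<delta> * (1/4)^n" for n
  proof (induction n)
    case (Suc n)
    have "hs n x + (1/2)^n * f n x \<le> q n"
      unfolding q_def
    proof (rule p_upper[OF x(1)])
      fix y assume y: "y \<in> K"
      show "hs n y + (1/2)^n * f n y \<le> 2"
        using hs01[OF y, of n] f01[OF y, of n] mult_mono[of "(1/2::real)^n" 1 "f n y" 1]
        by (simp add: power_le_one)
    qed
    then have "hs n x + (1/2)^n * f n x \<le> P + \<delta> * (1/4)^n" using qP[of n] by linarith
    then have "2 * hs (Suc n) x \<le> hs n x + (P + \<delta> * (1/4)^n)"
      by (simp add: hsSuc)
    also have "\<dots> \<le> 2 * ((1 - (1/2)^Suc n) * P + 2 * \<delta> * (1/2)^Suc n - 2 * \<delta> * (1/4)^Suc n)"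
      using Suc.IH by (simp add: algebra_simps)
    finally show ?case by simp
  qed (simp add: hs0)
  obtain N where N: "\<And>k. k \<ge> N \<Longrightarrow> \<phi> k x \<le> \<delta>"
    using order_tendstoD(2)[OF null[OF x(1)] \<delta>] unfolding eventually_sequentially
    by (meson less_imp_le)
  have "P - hs N x \<le> (1/2)^N * \<delta>"
  proof -
    have "P - hs N x = (\<Sum>k. a (k + N) x)"
      unfolding P_def H_def hs_sum using suminf_split_initial_segment[OF summ[OF x(1)], of N] by simp
    also have "\<dots> \<le> (\<Sum>k. (1/2)^N * \<delta> * (1/2)^Suc k)"
    proof (rule suminf_le)
      fix k
      have "f (k + N) x \<le> \<delta>"
        using tail_averages_bounds[OF fT[of "k + N"], of 0 x \<delta>] N range[OF x(1)] by auto
      then show "a (k + N) x \<le> (1/2)^N * \<delta> * (1/2)^Suc k"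
        by (auto simp: a_def power_add mult.commute intro: mult_left_mono)
    next
      show "summable (\<lambda>k. a (k + N) x)"
        using summ[OF x(1)] summable_iff_shift[of "\<lambda>k. a k x" N] by simp
      show "summable (\<lambda>k. (1/2)^N * \<delta> * (1/2)^Suc k)" by (rule summable_mult[OF geo(1)])
    qed
    also have "\<dots> = (1/2)^N * \<delta>"
      using suminf_mult[OF geo(1), of "(1/2)^N * \<delta>"] geo(2) by simp
    finally show ?thesis .
  qed
  then have "(1/2)^N * P \<le> (1/2)^N * (3 * \<delta>) - 2 * \<delta> * (1/4)^N" using hs_x[of N] by (simp add: algebra_simps)
  also have "\<dots> \<le> (1/2)^N * (3 * \<delta>)" using \<delta> by simp
  finally have P: "P \<le> 3 * \<delta>" by simp
  obtain m where m: "(1/2::real)^m < \<delta>" using real_arch_pow_inv[OF \<delta>, of "1/2"] by auto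
  obtain g where g: "g \<in> ?T 0" "\<And>y. hs m y + (1/2)^m * f m y = g y"
    using step[OF le0 fT[of m]] by (auto simp: hs0)
  have gle: "g y \<le> \<epsilon>" if y: "y \<in> K" for y
  proof -
    have "(1/2)^m * f m y \<le> (1/2)^m" using f01[OF y, of m] by (auto intro!: mult_left_le)
    then show ?thesis
      using g(2)[of y] hs_le_H[OF y, of m] x(2)[OF y] P m unfolding P_def \<delta>_def by linarith
  qed
  obtain R w where R: "\<forall>i. 0 \<le> w i" "(\<Sum>i<R. w i) = 1" "g = (\<lambda>x. \<Sum>i<(R::nat). w i * \<phi> i x)"
    using tail_averages_weights[OF g(1)] by blast
  show ?thesis using R gle by (intro exI[of _ R] exI[of _ w]) simp
qed

section \<open>Summing and norming families of operators\<close>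

lemma sum_powr_mono_bound:
  fixes N :: "nat \<Rightarrow> real"
  assumes "\<And>i. i < n \<Longrightarrow> 0 \<le> N i \<and> N i \<le> N' i" "q > 0"
  shows "(\<Sum>i<n. N i powr q) powr (1 / q) \<le> (\<Sum>i<n. N' i powr q) powr (1 / q)"
  using assms by (intro powr_mono2 sum_mono sum_nonneg) auto

text \<open>Finitely many \<open>k\<close> suffice to separate the points of the compact unit sphere, so a finite
  subfamily dominates the norm. Each summand on the left is then bounded by a finite sum over
  this subfamily, and the finite sum is exchanged with the sum over \<open>i\<close>.\<close>

lemma finite_dimensional_summing:
  fixes b :: "'e::real_normed_vector \<Rightarrow> 'k \<Rightarrow> 'y::real_normed_vector"
  assumes fin: "finite (B :: 'e set)" "span B = UNIV"
    and lin: "\<And>k. k \<in> K \<Longrightarrow> linear (\<lambda>e. b e k)"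
    and bdd: "\<And>e k. k \<in> K \<Longrightarrow> norm (b e k) \<le> C * norm e"
    and sep: "\<And>e. e \<noteq> 0 \<Longrightarrow> \<exists>k\<in>K. b e k \<noteq> 0"
    and q: "q > 0"
  shows "\<exists>D. \<forall>n e. (\<Sum>i<n. norm (e i :: 'e) powr q) powr (1 / q)
    \<le> D * (SUP k\<in>K. (\<Sum>i<(n::nat). norm (b (e i) k) powr q) powr (1 / q))"
proof (cases "sphere (0 :: 'e) 1 = {}")
  case True
  have "e = 0" for e :: 'e
  proof (rule ccontr)
    assume "e \<noteq> 0"
    then have "(1 / norm e) *\<^sub>R e \<in> sphere 0 1" by simp
    then show False using True by blast
  qed
  then have zero: "norm (e :: 'e) = 0" for e by (metis norm_zero)
  have "(\<Sum>i<n. norm (e i) powr q) = 0" for n and e :: "nat \<Rightarrow> 'e"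
    by (rule sum.neutral) (intro ballI, simp only: zero powr_0)
  then show ?thesis using q by (intro exI[of _ 0]) simp
next
  case False
  let ?S = "sphere (0 :: 'e) 1"
  have compact: "compact ?S" by (rule finite_span_compact_sphere[OF fin])
  have bl: "bounded_linear (\<lambda>e. b e k)" if "k \<in> K" for k
    using linear_add[OF lin[OF that]] linear_scale[OF lin[OF that]] bdd[OF that]
    by (intro bounded_linear_intro[of _ C]) (auto simp: mult.commute)
  have cont: "continuous_on A (\<lambda>e. b e k)" if "k \<in> K" for A k
    using bl[OF that] by (rule linear_continuous_on)
  define U where "U k = {e. b e k \<noteq> 0}" for k
  have "open (U k)" if "k \<in> K" for k
    unfolding U_def using cont[OF that] by (intro open_Collect_neq continuous_on_const)
  moreover have "?S \<subseteq> (\<Union>k\<in>K. U k)"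
  proof
    fix e assume "e \<in> ?S"
    then have "e \<noteq> 0" by auto
    then show "e \<in> (\<Union>k\<in>K. U k)" using sep by (auto simp: U_def)
  qed
  ultimately obtain K0 where K0: "K0 \<subseteq> K" "finite K0" "?S \<subseteq> (\<Union>k\<in>K0. U k)"
    using compactE_image[OF compact, of K U] by metis
  define g where "g e = (\<Sum>k\<in>K0. norm (b e k))" for e
  have "continuous_on ?S g"
    unfolding g_def using K0(1) by (intro continuous_intros cont) auto
  then obtain e0 where e0: "e0 \<in> ?S" "\<And>e. e \<in> ?S \<Longrightarrow> g e0 \<le> g e"
    using continuous_attains_inf[OF compact False] by blast
  define c where "c = g e0"
  have "\<exists>k\<in>K0. b e0 k \<noteq> 0" using K0(3) e0(1) by (auto simp: U_def)
  then have c: "c > 0" unfolding c_def g_def using K0(2) by (auto intro!: sum_pos2)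
  have g: "c * norm e \<le> g e" for e
  proof (cases "e = 0")
    case False
    have "c \<le> g ((1 / norm e) *\<^sub>R e)" unfolding c_def using False by (intro e0(2)) simp
    also have "g ((1 / norm e) *\<^sub>R e) = g e / norm e"
      unfolding g_def sum_divide_distrib
      using K0(1) linear_scale[OF lin] by (intro sum.cong) auto
    finally show ?thesis using False by (simp add: field_simps)
  qed (simp add: g_def sum_nonneg)
  have "K0 \<noteq> {}" using K0(3) e0(1) by auto
  then have card: "card K0 > 0" using K0(2) by (simp add: card_gt_0_iff)
  define r where "r = real (card K0) / c"
  have r: "r > 0" using card c by (simp add: r_def)
  have pick: "norm e powr q \<le> r powr q * (\<Sum>k\<in>K0. norm (b e k) powr q)" for e
  proof -
    have "\<exists>k\<in>K0. c * norm e \<le> real (card K0) * norm (b e k)"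
    proof (rule ccontr)
      assume "\<not> ?thesis"
      then have "(\<Sum>k\<in>K0. norm (b e k)) < (\<Sum>k\<in>K0. c * norm e / real (card K0))"
        using K0(2) \<open>K0 \<noteq> {}\<close> card by (intro sum_strict_mono) (auto simp: not_le field_simps)
      also have "\<dots> = c * norm e" using card by simp
      finally show False using g[of e] by (simp add: g_def)
    qed
    then obtain k where k: "k \<in> K0" "norm e \<le> r * norm (b e k)"
      using c by (auto simp: r_def field_simps)
    then have "norm e powr q \<le> (r * norm (b e k)) powr q" using q by (intro powr_mono2) auto
    also have "\<dots> = r powr q * norm (b e k) powr q" using r by (simp add: powr_mult)
    also have "\<dots> \<le> r powr q * (\<Sum>k\<in>K0. norm (b e k) powr q)"
      using k(1) K0(2) by (intro mult_left_mono member_le_sum) auto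
    finally show ?thesis .
  qed
  define D where "D = r * real (card K0) powr (1 / q)"
  have "(\<Sum>i<n. norm (e i) powr q) powr (1 / q)
      \<le> D * (SUP k\<in>K. (\<Sum>i<n. norm (b (e i) k) powr q) powr (1 / q))" for n and e :: "nat \<Rightarrow> 'e"
  proof -
    let ?f = "\<lambda>k. (\<Sum>i<n. norm (b (e i) k) powr q)"
    define s where "s = (SUP k\<in>K. ?f k powr (1 / q))"
    have "?f k powr (1 / q) \<le> (\<Sum>i<n. (C * norm (e i)) powr q) powr (1 / q)" if "k \<in> K" for k
      using bdd[OF that] q by (intro sum_powr_mono_bound) auto
    then have bddf: "bdd_above ((\<lambda>k. ?f k powr (1 / q)) ` K)" by (rule bdd_aboveI2)
    have fs: "?f k powr (1 / q) \<le> s" if "k \<in> K" for k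
      unfolding s_def using that by (intro cSUP_upper[OF _ bddf])
    obtain k0 where "k0 \<in> K" using \<open>K0 \<noteq> {}\<close> K0(1) by blast
    then have s: "0 \<le> s" using fs[of k0] by (meson order_trans powr_ge_zero)
    have fk: "?f k \<le> s powr q" if "k \<in> K" for k
    proof -
      have "(?f k powr (1 / q)) powr q \<le> s powr q" using fs[OF that] q by (intro powr_mono2) auto
      then show ?thesis using q by (simp add: powr_powr sum_nonneg)
    qed
    have "(\<Sum>i<n. norm (e i) powr q) \<le> (\<Sum>i<n. r powr q * (\<Sum>k\<in>K0. norm (b (e i) k) powr q))"
      by (intro sum_mono pick)
    also have "\<dots> = r powr q * (\<Sum>k\<in>K0. ?f k)"
      by (simp add: sum_distrib_left[symmetric] sum.swap[of _ "{..<n}"])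
    also have "\<dots> \<le> r powr q * (\<Sum>k\<in>K0. s powr q)"
      using K0(1) fk by (intro mult_left_mono sum_mono) auto
    also have "\<dots> = r powr q * (real (card K0) * s powr q)" by simp
    finally have "(\<Sum>i<n. norm (e i) powr q) powr (1 / q)
        \<le> (r powr q * (real (card K0) * s powr q)) powr (1 / q)"
      using q by (intro powr_mono2 sum_nonneg) auto
    also have "\<dots> = D * s" using q r s by (simp add: powr_mult powr_powr D_def)
    finally show ?thesis by (simp add: s_def)
  qed
  then show ?thesis by blast
qed

text \<open>The functions themselves map \<open>K\<close> onto a compact set of real sequences, on which they become
  the coordinates.\<close>

lemma Simons_compactin:
  fixes \<phi> :: "nat \<Rightarrow> 'k \<Rightarrow> real"
  assumes K: "compactin X K" "K \<noteq> {}"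
    and cont: "\<And>n. continuous_map (subtopology X K) euclideanreal (\<phi> n)"
    and range: "\<And>n x. x \<in> K \<Longrightarrow> 0 \<le> \<phi> n x \<and> \<phi> n x \<le> 1"
    and null: "\<And>x. x \<in> K \<Longrightarrow> (\<lambda>n. \<phi> n x) \<longlonglongrightarrow> 0"
    and \<epsilon>: "\<epsilon> > 0"
  shows "\<exists>N w. (\<forall>i. 0 \<le> w i) \<and> (\<Sum>i<N. w i) = 1 \<and> (\<forall>x\<in>K. (\<Sum>i<(N::nat). w i * \<phi> i x) \<le> \<epsilon>)"
proof -
  define \<Phi> where "\<Phi> x = (\<lambda>n. \<phi> n x)" for x
  have "continuous_map (subtopology X K) euclidean \<Phi>"
    unfolding euclidean_product_topology[symmetric] \<Phi>_def
    by (subst continuous_map_componentwise_UNIV) (use cont in simp)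
  moreover have "compactin (subtopology X K) K" using K(1) by (simp add: compactin_subtopology)
  ultimately have "compactin euclidean (\<Phi> ` K)" by (rule image_compactin[rotated])
  then have c: "compact (\<Phi> ` K)" by simp
  have "\<exists>N w. (\<forall>i. 0 \<le> w i) \<and> (\<Sum>i<N. w i) = 1 \<and>
      (\<forall>y\<in>\<Phi> ` K. (\<Sum>i<(N::nat). w i * y i) \<le> \<epsilon>)"
    by (rule Simons_convex_combination[OF c, of "\<lambda>i y. y i", OF _ _ _ _ \<epsilon>])
      (use K(2) range null in \<open>auto simp: \<Phi>_def
        intro: continuous_on_subset[OF continuous_on_product_coordinates subset_UNIV]\<close>)
  then show ?thesis by (auto simp: \<Phi>_def)
qed

text \<open>If all \<open>d n\<close> had norm at least \<open>\<delta>\<close>, then scaling them by \<open>w i powr (1 / q)\<close> with the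
  weights of a uniformly small convex combination would violate the summing inequality.\<close>

lemma summing_imp_norm_null:
  fixes b :: "'e::real_normed_vector \<Rightarrow> 'k \<Rightarrow> 'y::real_normed_vector"
  assumes K: "compactin X K" "K \<noteq> {}"
    and cont: "\<And>e. continuous_map (subtopology X K) euclideanreal (\<lambda>k. norm (b e k))"
    and scale: "\<And>t e k. k \<in> K \<Longrightarrow> b (t *\<^sub>R e) k = t *\<^sub>R b e k"
    and bdd: "\<And>e k. k \<in> K \<Longrightarrow> norm (b e k) \<le> C * norm e"
    and q: "q > 0"
    and summing: "\<And>n e. (\<Sum>i<n. norm (e i :: 'e) powr q) powr (1 / q)
      \<le> D * (SUP k\<in>K. (\<Sum>i<(n::nat). norm (b (e i) k) powr q) powr (1 / q))"
    and d: "\<And>n. norm (d n) \<le> R" and null: "\<And>k. k \<in> K \<Longrightarrow> (\<lambda>n. b (d n) k) \<longlonglongrightarrow> 0"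
    and \<delta>: "\<delta> > 0"
  shows "\<exists>n. norm (d n) < \<delta>"
proof (rule ccontr)
  assume "\<not> ?thesis"
  then have large: "\<delta> \<le> norm (d n)" for n by (simp add: not_less)
  obtain k0 where k0: "k0 \<in> K" using K(2) by blast
  define R0 where "R0 = \<bar>C\<bar> * \<bar>R\<bar> + 1"
  have R0: "R0 > 0" unfolding R0_def by (simp add: add_nonneg_pos)
  have bR: "norm (b (d n) k) \<le> R0" if "k \<in> K" for n k
  proof -
    have "norm (b (d n) k) \<le> C * norm (d n)" by (rule bdd[OF that])
    also have "\<dots> \<le> \<bar>C\<bar> * \<bar>R\<bar>" using d[of n] by (intro mult_mono) auto
    finally show ?thesis by (simp add: R0_def)
  qed
  define \<phi> where "\<phi> n k = (norm (b (d n) k) / R0) powr q" for n k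
  define D0 where "D0 = \<bar>D\<bar> + 1"
  have D0: "D0 > 0" by (simp add: D0_def add_nonneg_pos)
  \<comment> \<open>Chosen so that the right-hand side of the summing inequality is at most \<open>\<delta> / 2\<close>.\<close>
  define \<epsilon> where "\<epsilon> = (\<delta> / (2 * D0 * R0)) powr q"
  have \<epsilon>: "\<epsilon> > 0" using \<delta> D0 R0 by (simp add: \<epsilon>_def)
  have "\<exists>N w. (\<forall>i. 0 \<le> w i) \<and> (\<Sum>i<N. w i) = 1 \<and> (\<forall>x\<in>K. (\<Sum>i<(N::nat). w i * \<phi> i x) \<le> \<epsilon>)"
  proof (rule Simons_compactin[OF K _ _ _ \<epsilon>])
    fix n
    have "continuous_map euclideanreal euclideanreal (\<lambda>t. (\<bar>t\<bar> / R0) powr q)"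
      unfolding continuous_map_iff_continuous2
      by (rule continuous_on_powr') (use q R0 in \<open>auto intro!: continuous_intros\<close>)
    from continuous_map_compose[OF cont this, of "d n"]
    show "continuous_map (subtopology X K) euclideanreal (\<phi> n)" by (simp add: \<phi>_def[abs_def] o_def)
  next
    fix n k assume k: "k \<in> K"
    have "(norm (b (d n) k) / R0) powr q \<le> 1 powr q"
      using bR[OF k, of n] R0 q by (intro powr_mono2) auto
    then show "0 \<le> \<phi> n k \<and> \<phi> n k \<le> 1" by (simp add: \<phi>_def)
  next
    fix k assume k: "k \<in> K"
    have "(\<lambda>n. (norm (b (d n) k) / R0) powr q) \<longlonglongrightarrow> (norm (0::'y) / R0) powr q"
      using q R0 by (intro tendsto_powr2 tendsto_intros null[OF k]) auto
    then show "(\<lambda>n. \<phi> n k) \<longlonglongrightarrow> 0" using q by (simp add: \<phi>_def)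
  qed
  then obtain N w where w: "\<And>i. 0 \<le> w i" "(\<Sum>i<N. w i) = 1"
      "\<And>k. k \<in> K \<Longrightarrow> (\<Sum>i<(N::nat). w i * \<phi> i k) \<le> \<epsilon>" by blast
  define e where "e i = (w i powr (1 / q)) *\<^sub>R d i" for i
  have pw: "(w i powr (1 / q) * y) powr q = w i * y powr q" if "y \<ge> 0" for i y
    using w(1)[of i] q that by (simp add: powr_mult powr_powr)
  have "\<delta> powr q = (\<Sum>i<N. w i) * \<delta> powr q" by (simp add: w(2))
  also have "\<dots> = (\<Sum>i<N. w i * \<delta> powr q)" by (rule sum_distrib_right)
  also have "\<dots> \<le> (\<Sum>i<N. w i * norm (d i) powr q)"
    using large \<delta> q w(1) by (intro sum_mono mult_left_mono powr_mono2) auto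
  also have "\<dots> = (\<Sum>i<N. norm (e i) powr q)" by (simp add: e_def pw)
  finally have "(\<delta> powr q) powr (1 / q) \<le> (\<Sum>i<N. norm (e i) powr q) powr (1 / q)"
    using q by (intro powr_mono2) auto
  then have "\<delta> \<le> (\<Sum>i<N. norm (e i) powr q) powr (1 / q)" using \<delta> q by (simp add: powr_powr)
  also have "\<dots> \<le> D * (SUP k\<in>K. (\<Sum>i<N. norm (b (e i) k) powr q) powr (1 / q))" by (rule summing)
  also have "\<dots> \<le> D0 * (\<delta> / (2 * D0))"
  proof -
    have up: "(\<Sum>i<N. norm (b (e i) k) powr q) powr (1 / q) \<le> \<delta> / (2 * D0)" if k: "k \<in> K" for k
    proof -
      have "(\<Sum>i<N. norm (b (e i) k) powr q) = (\<Sum>i<N. w i * norm (b (d i) k) powr q)"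
        by (simp add: e_def scale[OF k] pw)
      also have "\<dots> = (\<Sum>i<N. R0 powr q * (w i * \<phi> i k))"
        using R0 by (intro sum.cong) (simp_all add: \<phi>_def powr_divide)
      also have "\<dots> = R0 powr q * (\<Sum>i<N. w i * \<phi> i k)" by (rule sum_distrib_left[symmetric])
      also have "\<dots> \<le> R0 powr q * \<epsilon>" by (intro mult_left_mono w(3) k) simp
      also have "\<dots> = (R0 * (\<delta> / (2 * D0 * R0))) powr q"
        using R0 D0 \<delta> unfolding \<epsilon>_def by (subst powr_mult) auto
      also have "R0 * (\<delta> / (2 * D0 * R0)) = \<delta> / (2 * D0)" using R0 by simp
      finally have "(\<Sum>i<N. norm (b (e i) k) powr q) powr (1 / q) \<le> ((\<delta> / (2 * D0)) powr q) powr (1 / q)"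
        using q by (intro powr_mono2 sum_nonneg) auto
      then show ?thesis using q \<delta> D0 by (simp add: powr_powr)
    qed
    define s where "s = (SUP k\<in>K. (\<Sum>i<N. norm (b (e i) k) powr q) powr (1 / q))"
    have "s \<le> \<delta> / (2 * D0)" unfolding s_def using K(2) up by (rule cSUP_least)
    moreover have "0 \<le> s"
      unfolding s_def by (rule cSUP_upper2[OF bdd_aboveI2[OF up] k0]) auto
    ultimately have "D * s \<le> D0 * (\<delta> / (2 * D0))"
      using D0 by (intro mult_mono) (auto simp: D0_def)
    then show ?thesis by (simp add: s_def)
  qed
  also have "\<dots> < \<delta>" using D0 \<delta> by simp
  finally show False by simp
qed

text \<open>A coercive bounded form makes the supremum over a bounded neighbourhood of 0 in the second
  argument equivalent to the norm in the first argument. The unit set is that of a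
  function \<open>\<nu>\<close> merely comparable with the norm, so that the norm of \<open>L\<^sup>p(m)\<close> can be inserted
  without Minkowski's inequality.\<close>

lemma norming_form:
  fixes \<beta> :: "'e::real_normed_vector \<Rightarrow> 'e \<Rightarrow> 'y::real_normed_vector"
  assumes lin: "\<And>e'. linear (\<lambda>e. \<beta> e e')"
    and scale: "\<And>t e e'. \<beta> e (t *\<^sub>R e') = t *\<^sub>R \<beta> e e'"
    and bdd: "\<And>e e'. norm (\<beta> e e') \<le> C * norm e * norm e'" "C > 0"
    and coercive: "\<And>e. c * (norm e)\<^sup>2 \<le> norm (\<beta> e e)" "c > 0"
    and \<nu>: "\<And>e. c1 * norm e \<le> \<nu> e" "\<And>e. \<nu> e \<le> C1 * norm e" "c1 > 0" "C1 > 0"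
    and N: "\<And>e. N e = (SUP e'\<in>{e'. \<nu> e' \<le> 1}. norm (\<beta> e e'))"
  shows "0 \<le> N e" "N e = 0 \<longleftrightarrow> e = 0" "N (t *\<^sub>R e) = \<bar>t\<bar> * N e" "N (e + e') \<le> N e + N e'"
    "c / C1 * norm e \<le> N e" "N e \<le> C / c1 * norm e"
    "\<nu> e' \<le> 1 \<Longrightarrow> norm (\<beta> e e') \<le> N e"
proof -
  let ?U = "{e'. \<nu> e' \<le> 1}"
  have "\<nu> 0 \<le> 1" using \<nu>(2)[of 0] by simp
  then have ne: "?U \<noteq> {}" by blast
  have ub: "norm (\<beta> e e') \<le> C / c1 * norm e" if "e' \<in> ?U" for e e'
  proof -
    have "c1 * norm e' \<le> 1" using \<nu>(1)[of e'] that by simp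
    then have "norm e' \<le> 1 / c1" using \<nu>(3) by (simp add: field_simps)
    then have "C * norm e * norm e' \<le> C * norm e * (1 / c1)" using bdd(2) by (intro mult_left_mono) auto
    then show ?thesis using bdd(1)[of e e'] by simp
  qed
  have le: "norm (\<beta> e e') \<le> N e" if "e' \<in> ?U" for e e'
    unfolding N by (rule cSUP_upper[OF that bdd_aboveI2[OF ub]])
  show "norm (\<beta> e e') \<le> N e" if "\<nu> e' \<le> 1" using le that by simp
  have least: "N e \<le> B" if "\<And>e'. e' \<in> ?U \<Longrightarrow> norm (\<beta> e e') \<le> B" for e B
    unfolding N using ne that by (rule cSUP_least)
  show "N e \<le> C / c1 * norm e" by (rule least[OF ub])
  have lower: "c / C1 * norm e \<le> N e" for e
  proof (cases "e = 0")
    case True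
    then show ?thesis using ne le[of _ 0] by (auto intro: order_trans[OF norm_ge_zero])
  next
    case False
    let ?t = "1 / (C1 * norm e)"
    have t: "?t > 0" using False \<nu>(4) by simp
    have "\<nu> (?t *\<^sub>R e) \<le> C1 * norm (?t *\<^sub>R e)" by (rule \<nu>(2))
    also have "\<dots> = 1" using False \<nu>(4) by simp
    finally have "norm (\<beta> e (?t *\<^sub>R e)) \<le> N e" using le by simp
    moreover have "norm (\<beta> e (?t *\<^sub>R e)) = ?t * norm (\<beta> e e)"
      using t unfolding scale by (simp del: divide_divide_eq_left)
    moreover have "?t * (c * (norm e)\<^sup>2) \<le> ?t * norm (\<beta> e e)"
      using t by (intro mult_left_mono coercive) auto
    moreover have "?t * (c * (norm e)\<^sup>2) = c / C1 * norm e"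
      using False by (simp add: power2_eq_square)
    ultimately show ?thesis by linarith
  qed
  show "c / C1 * norm e \<le> N e" by (rule lower)
  have nonneg: "0 \<le> N e" for e
    using ne le[of _ e] by (auto intro: order_trans[OF norm_ge_zero])
  show "0 \<le> N e" by (rule nonneg)
  show "N (e + e') \<le> N e + N e'"
  proof (rule least)
    fix u assume u: "u \<in> ?U"
    have "norm (\<beta> (e + e') u) \<le> norm (\<beta> e u) + norm (\<beta> e' u)"
      unfolding linear_add[OF lin] by (rule norm_triangle_ineq)
    then show "norm (\<beta> (e + e') u) \<le> N e + N e'" using le[OF u, of e] le[OF u, of e'] by linarith
  qed
  have scale_le: "N (t *\<^sub>R e) \<le> \<bar>t\<bar> * N e" for t e
    by (rule least) (use le linear_scale[OF lin] in \<open>simp add: mult_left_mono\<close>)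
  show "N (t *\<^sub>R e) = \<bar>t\<bar> * N e"
  proof (cases "t = 0")
    case True
    then show ?thesis using scale_le[of 0 e] nonneg[of 0] by simp
  next
    case False
    have "N e \<le> \<bar>1 / t\<bar> * N (t *\<^sub>R e)" using scale_le[of "1 / t" "t *\<^sub>R e"] False by simp
    then have "\<bar>t\<bar> * N e \<le> N (t *\<^sub>R e)" using False by (simp add: field_simps abs_divide)
    then show ?thesis using scale_le[of t e] by simp
  qed
  show "N e = 0 \<longleftrightarrow> e = 0"
  proof
    assume "N e = 0"
    then have "c / C1 * norm e \<le> 0" using lower[of e] by simp
    moreover have "c / C1 > 0" using coercive(2) \<nu>(4) by simp
    ultimately have "norm e \<le> 0" by (meson mult_pos_pos not_le)
    then show "e = 0" by simp
  next
    assume "e = 0"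
    then show "N e = 0" using scale_le[of 0 0] nonneg[of 0] by simp
  qed
qed

section \<open>Hahn and Jordan decomposition of signed measures\<close>

lemma vector_measure_sums:
  assumes "vector_measure M m" "\<And>i::nat. A i \<in> sets M" "disjoint_family A"
  shows "(\<lambda>i. m (A i)) sums m (\<Union>i. A i)"
  using assms by (auto simp: vector_measure_def)

lemma vector_measure_empty:
  assumes "vector_measure M m"
  shows "m {} = 0"
proof -
  have "(\<lambda>i::nat. m {}) sums m (\<Union>i::nat. {})"
    by (intro vector_measure_sums[OF assms]) (auto simp: disjoint_family_on_def)
  then have "(\<lambda>i::nat. m {}) \<longlonglongrightarrow> 0" by (intro summable_LIMSEQ_zero) (rule sums_summable)
  then show ?thesis by (simp add: LIMSEQ_const_iff)
qed

lemma vector_measure_Un: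
  assumes m: "vector_measure M m" and AB: "A \<in> sets M" "B \<in> sets M" "A \<inter> B = {}"
  shows "m (A \<union> B) = m A + m B"
proof -
  let ?F = "binaryset A B"
  have "(\<lambda>i. m (?F i)) sums m (\<Union>i. ?F i)"
    using AB by (intro vector_measure_sums[OF m])
      (auto simp: binaryset_def disjoint_family_on_def)
  moreover have "(\<lambda>i. m (?F i)) sums (m A + m B)"
    using binaryset_sums[of m A B] vector_measure_empty[OF m] by simp
  ultimately show ?thesis using sums_unique2 by (metis UN_binaryset_eq)
qed

lemma vector_measure_split:
  assumes m: "vector_measure M m" and AB: "A \<in> sets M" "B \<in> sets M"
  shows "m A = m (A \<inter> B) + m (A - B)"
  using vector_measure_Un[OF m, of "A \<inter> B" "A - B"] AB
  by (metis Diff_disjoint Int_Diff Int_Diff_Un inf_commute inf_left_commute sets.Diff sets.Int inf_bot_right)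

lemma vector_measure_Union:
  assumes m: "vector_measure M m" and "finite \<D>" "\<D> \<subseteq> sets M" "disjoint \<D>"
  shows "m (\<Union>\<D>) = (\<Sum>D\<in>\<D>. m D)"
  using assms(2-)
proof (induction \<D> rule: finite_induct)
  case (insert D \<D>)
  have "D \<inter> \<Union>\<D> = {}" using insert.prems insert.hyps by (auto simp: disjoint_def)
  moreover have "\<Union>\<D> \<in> sets M" using insert by (intro sets.finite_Union) auto
  moreover have "disjoint \<D>" using insert.prems(2) by (auto simp: disjoint_def)
  ultimately show ?case using insert vector_measure_Un[OF m, of D "\<Union>\<D>"] by simp
qed (simp add: vector_measure_empty[OF m])

lemma vector_measure_scalar:
  assumes "vector_measure M m"
  shows "vector_measure M (scalar_measure m x')"
  using assms unfolding vector_measure_def scalar_measure_def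
  by (auto intro: bounded_linear.sums[OF blinfun.bounded_linear_right])

lemma vector_measure_uminus:
  assumes "vector_measure M m"
  shows "vector_measure M (\<lambda>A. - m A)"
  using assms unfolding vector_measure_def by (auto intro: sums_minus)

lemma vector_measure_restrict:
  assumes "vector_measure M m" "H \<in> sets M"
  shows "vector_measure M (\<lambda>A. m (A \<inter> H))"
  unfolding vector_measure_def
proof (intro allI impI)
  fix A :: "nat \<Rightarrow> 'a set" assume A: "range A \<subseteq> sets M" "disjoint_family A"
  have "(\<lambda>i. m (A i \<inter> H)) sums m (\<Union>i. A i \<inter> H)"
    by (intro vector_measure_sums[OF assms(1)])
      (use A assms(2) in \<open>auto simp: disjoint_family_on_def\<close>)
  then show "(\<lambda>i. m (A i \<inter> H)) sums m ((\<Union>i. A i) \<inter> H)" by (simp add: UN_simps)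
qed

lemma vector_measure_diff:
  assumes "vector_measure M m" "vector_measure M n"
  shows "vector_measure M (\<lambda>A. m A - n A)"
  using assms unfolding vector_measure_def by (auto intro: sums_diff)

definition positive_set :: "'a measure \<Rightarrow> ('a set \<Rightarrow> real) \<Rightarrow> 'a set \<Rightarrow> bool" where
  "positive_set M \<mu> P \<longleftrightarrow> P \<in> sets M \<and> (\<forall>A\<in>sets M. A \<subseteq> P \<longrightarrow> 0 \<le> \<mu> A)"

text \<open>Repeatedly remove from \<open>D\<close> a set whose measure is negative and at least half as negative as
  possible (capped at 1, as the infimum is not yet known to be finite). The removed sets are
  disjoint, so their measures tend to 0 and nothing negative is left.\<close>

lemma contains_positive_set:
  fixes \<mu> :: "'a set \<Rightarrow> real"
  assumes \<mu>: "vector_measure M \<mu>" and D: "D \<in> sets M"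
  shows "\<exists>P. positive_set M \<mu> P \<and> P \<subseteq> D \<and> \<mu> D \<le> \<mu> P"
proof -
  have "\<exists>B. B \<in> sets M \<and> B \<subseteq> D \<and> \<mu> B \<le> 0 \<and>
      (\<forall>B'\<in>sets M. B' \<subseteq> D \<longrightarrow> min 1 (- \<mu> B') / 2 \<le> - \<mu> B)" for D
  proof -
    define S where "S = (\<lambda>B. min 1 (- \<mu> B)) ` {B \<in> sets M. B \<subseteq> D}"
    have bdd: "bdd_above S" unfolding S_def by (rule bdd_aboveI2[of _ _ 1]) auto
    have up: "min 1 (- \<mu> B') \<le> Sup S" if "B' \<in> sets M" "B' \<subseteq> D" for B'
      using that unfolding S_def by (intro cSup_upper) (use bdd in \<open>auto simp: S_def\<close>)
    show ?thesis
    proof (cases "Sup S \<le> 0")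
      case True
      then show ?thesis
        using up vector_measure_empty[OF \<mu>] by (intro exI[of _ "{}"]) force
    next
      case False
      have "S \<noteq> {}" unfolding S_def by auto
      then obtain y where y: "y \<in> S" "Sup S / 2 < y"
        using less_cSupD[of S "Sup S / 2"] False by auto
      from y(1) obtain B where B: "B \<in> sets M" "B \<subseteq> D" "y = min 1 (- \<mu> B)"
        unfolding S_def by blast
      with y(2) have "Sup S / 2 < min 1 (- \<mu> B)" by simp
      with B(1,2) show ?thesis using up False by (intro exI[of _ B]) force
    qed
  qed
  then obtain c where c: "\<And>D. c D \<in> sets M" "\<And>D. c D \<subseteq> D" "\<And>D. \<mu> (c D) \<le> 0"
      "\<And>D B'. B' \<in> sets M \<Longrightarrow> B' \<subseteq> D \<Longrightarrow> min 1 (- \<mu> B') / 2 \<le> - \<mu> (c D)"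
    by metis
  define E where "E = rec_nat D (\<lambda>_ D. D - c D)"
  have E0: "E 0 = D" and ESuc: "E (Suc n) = E n - c (E n)" for n by (simp_all add: E_def)
  define B where "B n = c (E n)" for n
  have Es: "E n \<in> sets M" for n by (induction n) (auto simp: E0 ESuc D c)
  have dec: "E m \<subseteq> E n" if "n \<le> m" for n m
    using that by (induction m rule: dec_induct) (auto simp: ESuc)
  have BE: "B n \<inter> E m = {}" if "n < m" for n m
    using dec[of "Suc n" m] that by (auto simp: ESuc B_def)
  have "disjoint_family B"
    unfolding disjoint_family_on_def
  proof (intro ballI impI)
    fix i j :: nat assume "i \<noteq> j"
    then consider "i < j" | "j < i" by linarith
    then show "B i \<inter> B j = {}"
    proof cases
      case 1 then show ?thesis using BE[OF 1] c(2)[of "E j"] unfolding B_def by blast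
    next
      case 2 then show ?thesis using BE[OF 2] c(2)[of "E i"] unfolding B_def by blast
    qed
  qed
  moreover have "B i \<in> sets M" for i by (simp add: B_def c(1))
  ultimately have sums: "(\<lambda>i. \<mu> (B i)) sums \<mu> (\<Union>i. B i)"
    by (intro vector_measure_sums[OF \<mu>])
  then have null: "(\<lambda>i. \<mu> (B i)) \<longlonglongrightarrow> 0" by (intro summable_LIMSEQ_zero sums_summable)
  have UB: "(\<Union>i. B i) \<in> sets M" by (auto simp: B_def c)
  have Ueq: "D \<inter> (\<Union>i. B i) = (\<Union>i. B i)"
    using c(2) dec[of 0] E0 unfolding B_def by fastforce
  have "\<mu> (\<Union>i. B i) \<le> 0"
    using sums_le[OF _ sums sums_zero] c(3) unfolding B_def by blast
  then have "\<mu> D \<le> \<mu> (D - (\<Union>i. B i))"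
    using vector_measure_split[OF \<mu> D UB] by (simp add: Ueq)
  moreover have "positive_set M \<mu> (D - (\<Union>i. B i))"
    unfolding positive_set_def
  proof (intro conjI ballI impI)
    fix A assume A: "A \<in> sets M" "A \<subseteq> D - (\<Union>i. B i)"
    have "A \<subseteq> E n" for n
    proof (induction n)
      case (Suc n) then show ?case using A(2) by (auto simp: ESuc B_def)
    qed (use A in \<open>auto simp: E0\<close>)
    then have "min 1 (- \<mu> A) / 2 \<le> - \<mu> (B n)" for n using c(4)[OF A(1)] by (simp add: B_def)
    moreover have "(\<lambda>n. - \<mu> (B n)) \<longlonglongrightarrow> - 0" by (intro tendsto_minus null)
    ultimately have "min 1 (- \<mu> A) / 2 \<le> - 0" by (intro LIMSEQ_le_const) auto
    then show "0 \<le> \<mu> A" by (auto simp: min_def split: if_splits)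
  qed (use D UB in auto)
  ultimately show ?thesis by blast
qed

lemma positive_set_UN:
  assumes \<mu>: "vector_measure M \<mu>" and P: "\<And>n::nat. positive_set M \<mu> (P n)"
  shows "positive_set M \<mu> (\<Union>n. P n)"
  unfolding positive_set_def
proof (intro conjI ballI impI)
  show "(\<Union>n. P n) \<in> sets M" using P by (auto simp: positive_set_def)
  fix A assume A: "A \<in> sets M" "A \<subseteq> (\<Union>n. P n)"
  have meas: "disjointed P n \<in> sets M" for n
    using P by (intro sets.range_disjointed_sets[THEN subsetD, of P M] rangeI) (auto simp: positive_set_def)
  have "(\<lambda>n. \<mu> (A \<inter> disjointed P n)) sums \<mu> (\<Union>n. A \<inter> disjointed P n)"
  proof (rule vector_measure_sums[OF \<mu>])
    show "disjoint_family (\<lambda>n. A \<inter> disjointed P n)"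
      using disjoint_family_disjointed[of P] unfolding disjoint_family_on_def by blast
  qed (use A meas in auto)
  moreover have "(\<Union>n. A \<inter> disjointed P n) = A"
    using A(2) UN_disjointed_eq[of P] by blast
  moreover have "0 \<le> \<mu> (A \<inter> disjointed P n)" for n
    using P[of n] A(1) meas[of n] disjointed_subset[of P n] unfolding positive_set_def by blast
  ultimately show "0 \<le> \<mu> A" using sums_le[OF _ sums_zero] by metis
qed

text \<open>Countable unions of positive sets are positive, so the supremum of the measures of positive
  sets is finite and attained. A set of positive measure outside a maximal positive set would
  contain a positive set and enlarge it.\<close>

lemma Hahn_decomposition:
  fixes \<mu> :: "'a set \<Rightarrow> real"
  assumes \<mu>: "vector_measure M \<mu>"
  shows "\<exists>H\<in>sets M. (\<forall>A\<in>sets M. A \<subseteq> H \<longrightarrow> 0 \<le> \<mu> A) \<and> (\<forall>A\<in>sets M. A \<inter> H = {} \<longrightarrow> \<mu> A \<le> 0)"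
proof -
  let ?S = "{P. positive_set M \<mu> P}"
  have mono: "\<mu> P \<le> \<mu> Q" if "positive_set M \<mu> Q" "P \<in> sets M" "P \<subseteq> Q" for P Q
    using vector_measure_split[OF \<mu>, of Q P] that
    by (auto simp: positive_set_def Int_absorb1)
  have empty: "positive_set M \<mu> {}" using vector_measure_empty[OF \<mu>] by (auto simp: positive_set_def)
  have bdd: "bdd_above (\<mu> ` ?S)"
  proof (rule ccontr)
    assume "\<not> ?thesis"
    then have "\<exists>P. positive_set M \<mu> P \<and> real n < \<mu> P" for n
      by (auto simp: bdd_above_def not_le)
    then obtain P where P: "\<And>n. positive_set M \<mu> (P n)" "\<And>n. real n < \<mu> (P n)" by metis
    have "real n < \<mu> (\<Union>n. P n)" for n
      using mono[OF positive_set_UN[OF \<mu> P(1)], of "P n"] P(1)[of n] P(2)[of n]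
      by (force simp: positive_set_def)
    then show False using reals_Archimedean2 less_asym by blast
  qed
  define s where "s = Sup (\<mu> ` ?S)"
  have "\<exists>P. positive_set M \<mu> P \<and> s - 1 / real (Suc n) < \<mu> P" for n
    using less_cSupD[of "\<mu> ` ?S" "s - 1 / real (Suc n)"] empty by (auto simp: s_def)
  then obtain P where P: "\<And>n. positive_set M \<mu> (P n)" "\<And>n. s - 1 / real (Suc n) < \<mu> (P n)" by metis
  define H where "H = (\<Union>n. P n)"
  have H: "positive_set M \<mu> H" unfolding H_def by (rule positive_set_UN[OF \<mu> P(1)])
  then have Hs: "H \<in> sets M" by (simp add: positive_set_def)
  have "s - 1 / real (Suc n) \<le> \<mu> H" for n
    using mono[OF H, of "P n"] P(1)[of n] P(2)[of n] by (force simp: positive_set_def H_def)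
  moreover have "(\<lambda>n. s - 1 / real (Suc n)) \<longlonglongrightarrow> s - 0"
    by (intro tendsto_intros LIMSEQ_Suc[OF lim_1_over_n])
  ultimately have sH: "s \<le> \<mu> H" by (intro LIMSEQ_le_const2[of _ s]) auto
  have "\<mu> D \<le> 0" if D: "D \<in> sets M" "D \<inter> H = {}" for D
  proof -
    obtain Q where Q: "positive_set M \<mu> Q" "Q \<subseteq> D" "\<mu> D \<le> \<mu> Q"
      using contains_positive_set[OF \<mu> D(1)] by blast
    have "positive_set M \<mu> (\<Union>n::nat. if n = 0 then H else Q)"
      using H Q by (intro positive_set_UN[OF \<mu>]) auto
    moreover have "(\<Union>n::nat. if n = 0 then H else Q) = H \<union> Q"
      by (auto split: if_splits)
    ultimately have "\<mu> (H \<union> Q) \<le> s"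
      unfolding s_def by (intro cSup_upper bdd) auto
    moreover have "\<mu> (H \<union> Q) = \<mu> H + \<mu> Q"
      using Hs Q D by (intro vector_measure_Un[OF \<mu>]) (auto simp: positive_set_def)
    ultimately show ?thesis using sH Q(3) by linarith
  qed
  then show ?thesis using H by (auto simp: positive_set_def)
qed

text \<open>Turns the set functions in the definitions of the variations into actual measures:
  \<open>measure_of\<close> returns a measure with the given values only when they are countably additive.\<close>

lemma emeasure_measure_of_vector_measure:
  fixes \<nu> :: "'a set \<Rightarrow> real"
  assumes \<nu>: "vector_measure M \<nu>" and nonneg: "\<And>A. A \<in> sets M \<Longrightarrow> 0 \<le> \<nu> A"
    and f: "\<And>A. A \<in> sets M \<Longrightarrow> f A = ennreal (\<nu> A)" and A: "A \<in> sets M"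
  shows "emeasure (measure_of (space M) (sets M) f) A = ennreal (\<nu> A)"
proof -
  have "emeasure (measure_of (space M) (sets M) f) A = f A"
  proof (rule emeasure_measure_of_sigma)
    show "positive (sets M) f"
      using f[of "{}"] vector_measure_empty[OF \<nu>] by (simp add: positive_def)
    show "countably_additive (sets M) f"
      unfolding countably_additive_def
    proof (intro allI impI)
      fix A :: "nat \<Rightarrow> 'a set"
      assume A: "range A \<subseteq> sets M" "disjoint_family A" "\<Union> (range A) \<in> sets M"
      then have "(\<lambda>i. \<nu> (A i)) sums \<nu> (\<Union>i. A i)"
        by (intro vector_measure_sums[OF \<nu>]) auto
      then have "(\<Sum>i. ennreal (\<nu> (A i))) = ennreal (\<nu> (\<Union>i. A i))"
        using A nonneg by (intro suminf_ennreal_eq) auto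
      moreover have "f (A i) = ennreal (\<nu> (A i))" for i using A by (intro f) auto
      ultimately show "(\<Sum>i. f (A i)) = f (\<Union> (range A))" using A by (simp add: f)
    qed
  qed (auto intro: A sets.sigma_algebra_axioms)
  then show ?thesis by (simp add: f A)
qed

lemma sets_variation [simp]: "sets (variation M \<mu>) = sets M"
  and space_variation [simp]: "space (variation M \<mu>) = space M"
  by (simp_all add: variation_def)

lemma measurable_variation [simp]:
  "borel_measurable (variation M \<mu>) = borel_measurable M"
  by (rule measurable_cong_sets) auto

lemma positive_variation_eq:
  assumes \<mu>: "vector_measure M \<mu>" and H: "H \<in> sets M"
    and pos: "\<And>A. A \<in> sets M \<Longrightarrow> A \<subseteq> H \<Longrightarrow> 0 \<le> \<mu> A"
    and neg: "\<And>A. A \<in> sets M \<Longrightarrow> A \<inter> H = {} \<Longrightarrow> \<mu> A \<le> 0"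
    and A: "A \<in> sets M"
  shows "emeasure (positive_variation M \<mu>) A = ennreal (\<mu> (A \<inter> H))"
  unfolding positive_variation_def
proof (rule emeasure_measure_of_vector_measure[OF vector_measure_restrict[OF \<mu> H] _ _ A])
  fix A assume A: "A \<in> sets M"
  show "0 \<le> \<mu> (A \<inter> H)" using A H by (intro pos) auto
  show "(SUP B\<in>{B \<in> sets M. B \<subseteq> A}. ennreal (\<mu> B)) = ennreal (\<mu> (A \<inter> H))"
  proof (rule antisym)
    show "(SUP B\<in>{B \<in> sets M. B \<subseteq> A}. ennreal (\<mu> B)) \<le> ennreal (\<mu> (A \<inter> H))"
    proof (rule SUP_least, rule ennreal_leI)
      fix B assume B: "B \<in> {B \<in> sets M. B \<subseteq> A}"
      have "\<mu> B = \<mu> (B \<inter> H) + \<mu> (B - H)"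
        using B H by (intro vector_measure_split[OF \<mu>]) auto
      moreover have "\<mu> (B - H) \<le> 0" using B H by (intro neg) auto
      moreover have "\<mu> (A \<inter> H) = \<mu> (B \<inter> H) + \<mu> (A \<inter> H - B)"
      proof -
        have "A \<inter> H \<inter> B = B \<inter> H" using B by auto
        then show ?thesis using vector_measure_split[OF \<mu>, of "A \<inter> H" B] A B H by simp
      qed
      moreover have "0 \<le> \<mu> (A \<inter> H - B)" using A B H by (intro pos) auto
      ultimately show "\<mu> B \<le> \<mu> (A \<inter> H)" by linarith
    qed
    show "ennreal (\<mu> (A \<inter> H)) \<le> (SUP B\<in>{B \<in> sets M. B \<subseteq> A}. ennreal (\<mu> B))"
      using A H by (intro SUP_upper) auto
  qed
qed

lemma variation_eq:
  assumes \<mu>: "vector_measure M \<mu>" and H: "H \<in> sets M"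
    and pos: "\<And>A. A \<in> sets M \<Longrightarrow> A \<subseteq> H \<Longrightarrow> 0 \<le> \<mu> A"
    and neg: "\<And>A. A \<in> sets M \<Longrightarrow> A \<inter> H = {} \<Longrightarrow> \<mu> A \<le> 0"
    and A: "A \<in> sets M"
  shows "emeasure (variation M \<mu>) A = ennreal (\<mu> (A \<inter> H) - \<mu> (A - H))"
proof -
  define \<nu> where "\<nu> A = \<mu> (A \<inter> H) - (\<mu> A - \<mu> (A \<inter> H))" for A
  have \<nu>: "vector_measure M \<nu>"
    unfolding \<nu>_def using vector_measure_restrict[OF \<mu> H] \<mu> by (intro vector_measure_diff)
  have split: "\<mu> A = \<mu> (A \<inter> H) + \<mu> (A - H)" if "A \<in> sets M" for A
    by (rule vector_measure_split[OF \<mu> that H])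
  then have \<nu>_eq: "\<nu> A = \<mu> (A \<inter> H) - \<mu> (A - H)" if "A \<in> sets M" for A
    using that unfolding \<nu>_def by force
  have parts: "0 \<le> \<mu> (A \<inter> H)" "\<mu> (A - H) \<le> 0" if "A \<in> sets M" for A
    using that H by (auto intro: pos neg)
  have "emeasure (variation M \<mu>) A = ennreal (\<nu> A)"
    unfolding variation_def
  proof (rule emeasure_measure_of_vector_measure[OF \<nu> _ _ A])
    fix A assume A: "A \<in> sets M"
    show "0 \<le> \<nu> A" using \<nu>_eq[OF A] parts[OF A] by simp
    let ?C = "{\<D>. finite \<D> \<and> \<D> \<subseteq> sets M \<and> disjoint \<D> \<and> \<Union>\<D> = A}"
    show "(SUP \<D>\<in>?C. \<Sum>D\<in>\<D>. ennreal \<bar>\<mu> D\<bar>) = ennreal (\<nu> A)"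
    proof (rule antisym)
      show "(SUP \<D>\<in>?C. \<Sum>D\<in>\<D>. ennreal \<bar>\<mu> D\<bar>) \<le> ennreal (\<nu> A)"
      proof (rule SUP_least)
        fix \<D> assume D: "\<D> \<in> ?C"
        have le: "\<bar>\<mu> D\<bar> \<le> \<nu> D" if "D \<in> \<D>" for D
          using D that split[of D] parts[of D] \<nu>_eq[of D] by (auto simp: subset_eq)
        have "(\<Sum>D\<in>\<D>. ennreal \<bar>\<mu> D\<bar>) \<le> (\<Sum>D\<in>\<D>. ennreal (\<nu> D))"
          by (intro sum_mono ennreal_leI le)
        also have "\<dots> = ennreal (\<Sum>D\<in>\<D>. \<nu> D)"
          using le by (intro sum_ennreal) (meson abs_ge_zero order_trans)
        also have "\<dots> = ennreal (\<nu> A)"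
          using vector_measure_Union[OF \<nu>, of \<D>] D by simp
        finally show "(\<Sum>D\<in>\<D>. ennreal \<bar>\<mu> D\<bar>) \<le> ennreal (\<nu> A)" .
      qed
      \<comment> \<open>The two pieces coincide as sets only if both are empty; then the sum has one term, which is 0.\<close>
      have "ennreal (\<nu> A) = (\<Sum>D\<in>{A \<inter> H, A - H}. ennreal \<bar>\<mu> D\<bar>)"
      proof (cases "A \<inter> H = A - H")
        case True
        then have e: "A \<inter> H = {}" "A - H = {}" by auto
        show ?thesis unfolding \<nu>_eq[OF A] e using vector_measure_empty[OF \<mu>] by simp
      next
        case False
        then show ?thesis using \<nu>_eq[OF A] parts[OF A] by (simp flip: ennreal_plus)
      qed
      also have "\<dots> \<le> (SUP \<D>\<in>?C. \<Sum>D\<in>\<D>. ennreal \<bar>\<mu> D\<bar>)"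
        using A H by (intro SUP_upper) (auto simp: disjoint_def)
      finally show "ennreal (\<nu> A) \<le> (SUP \<D>\<in>?C. \<Sum>D\<in>\<D>. ennreal \<bar>\<mu> D\<bar>)" .
    qed
  qed
  then show ?thesis using \<nu>_eq[OF A] by simp
qed

lemma finite_measure_variation:
  assumes \<mu>: "vector_measure M \<mu>"
  shows "finite_measure (variation M \<mu>)"
proof -
  obtain H where H: "H \<in> sets M" "\<And>A. A \<in> sets M \<Longrightarrow> A \<subseteq> H \<Longrightarrow> 0 \<le> \<mu> A"
      "\<And>A. A \<in> sets M \<Longrightarrow> A \<inter> H = {} \<Longrightarrow> \<mu> A \<le> 0"
    using Hahn_decomposition[OF \<mu>] by auto
  show ?thesis
    by (rule finite_measureI) (simp add: variation_eq[OF \<mu> H])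
qed

lemma variation_null:
  assumes \<mu>: "vector_measure M \<mu>" and A: "A \<in> sets M"
  shows "emeasure (variation M \<mu>) A = 0 \<longleftrightarrow> (\<forall>B\<in>sets M. B \<subseteq> A \<longrightarrow> \<mu> B = 0)"
proof -
  obtain H where H: "H \<in> sets M" "\<And>A. A \<in> sets M \<Longrightarrow> A \<subseteq> H \<Longrightarrow> 0 \<le> \<mu> A"
      "\<And>A. A \<in> sets M \<Longrightarrow> A \<inter> H = {} \<Longrightarrow> \<mu> A \<le> 0"
    using Hahn_decomposition[OF \<mu>] by auto
  have eq: "emeasure (variation M \<mu>) A = ennreal (\<mu> (A \<inter> H) - \<mu> (A - H))" if "A \<in> sets M" for A
    by (rule variation_eq[OF \<mu> H that])
  show ?thesis
  proof
    assume 0: "emeasure (variation M \<mu>) A = 0"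
    show "\<forall>B\<in>sets M. B \<subseteq> A \<longrightarrow> \<mu> B = 0"
    proof (intro ballI impI)
      fix B assume B: "B \<in> sets M" "B \<subseteq> A"
      then have "emeasure (variation M \<mu>) B = 0"
        using emeasure_mono[of B A "variation M \<mu>"] A 0 by simp
      then have "\<mu> (B \<inter> H) - \<mu> (B - H) \<le> 0" using eq[OF B(1)] by (simp add: ennreal_eq_0_iff)
      moreover have "0 \<le> \<mu> (B \<inter> H)" using B H(1) by (intro H(2)) auto
      moreover have "\<mu> (B - H) \<le> 0" using B H(1) by (intro H(3)) auto
      ultimately show "\<mu> B = 0" using vector_measure_split[OF \<mu> B(1) H(1)] by simp
    qed
  next
    assume "\<forall>B\<in>sets M. B \<subseteq> A \<longrightarrow> \<mu> B = 0"
    then have "\<mu> (A \<inter> H) = 0" "\<mu> (A - H) = 0" using A H(1) by auto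
    then show "emeasure (variation M \<mu>) A = 0" using eq[OF A] by simp
  qed
qed

text \<open>With \<open>\<sigma>\<close> equal to 1 on a Hahn set and to -1 off it, the positive and negative variations are
  the restrictions of the variation to the two pieces, and both the measure and the integral
  against it become integrals of \<open>\<sigma>\<close> times a function against one finite measure.\<close>

lemma signed_measure_polar:
  assumes \<mu>: "vector_measure M \<mu>"
  shows "\<exists>\<sigma>\<in>borel_measurable M. (\<forall>x. \<bar>\<sigma> x\<bar> = 1) \<and>
    (\<forall>A\<in>sets M. \<mu> A = (LINT x|variation M \<mu>. indicator A x * \<sigma> x)) \<and>
    (\<forall>A\<in>sets M. \<forall>h. integrable (variation M \<mu>) h \<longrightarrow>
       signed_integral M \<mu> A h = (LINT x|variation M \<mu>. indicator A x * (\<sigma> x * h x)))"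
proof -
  obtain H where H: "H \<in> sets M" "\<And>A. A \<in> sets M \<Longrightarrow> A \<subseteq> H \<Longrightarrow> 0 \<le> \<mu> A"
      "\<And>A. A \<in> sets M \<Longrightarrow> A \<inter> H = {} \<Longrightarrow> \<mu> A \<le> 0"
    using Hahn_decomposition[OF \<mu>] by auto
  let ?V = "variation M \<mu>"
  interpret V: finite_measure ?V by (rule finite_measure_variation[OF \<mu>])
  have eq: "emeasure (variation M \<mu>) A = ennreal (\<mu> (A \<inter> H) - \<mu> (A - H))" if "A \<in> sets M" for A
    by (rule variation_eq[OF \<mu> H that])
  have meq: "measure ?V A = \<mu> (A \<inter> H) - \<mu> (A - H)" if "A \<in> sets M" for A
  proof -
    have "0 \<le> \<mu> (A \<inter> H)" using that H(1) by (intro H(2)) auto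
    moreover have "\<mu> (A - H) \<le> 0" using that H(1) by (intro H(3)) auto
    ultimately show ?thesis by (simp add: measure_def eq[OF that])
  qed
  define \<sigma> :: "'a \<Rightarrow> real" where "\<sigma> x = indicator H x - indicator (- H) x" for x
  have \<sigma>_alt: "\<sigma> x = (if x \<in> H then 1 else - 1)" for x by (simp add: \<sigma>_def indicator_def)
  have \<sigma>: "\<sigma> \<in> borel_measurable M" unfolding \<sigma>_alt using H(1) by measurable
  have \<mu>_eq: "\<mu> A = (LINT x|?V. indicator A x * \<sigma> x)" if A: "A \<in> sets M" for A
  proof -
    have "(LINT x|?V. indicator A x * \<sigma> x) =
        (LINT x|?V. indicator (A \<inter> H) x - indicator (A - H) x)"
      by (rule Bochner_Integration.integral_cong) (auto simp: \<sigma>_def indicator_def)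
    also have "\<dots> = measure ?V (A \<inter> H) - measure ?V (A - H)"
      using A H(1) by (subst Bochner_Integration.integral_diff)
        (auto simp: V.emeasure_finite less_top[symmetric])
    also have "\<dots> = \<mu> (A \<inter> H) + \<mu> (A - H)"
    proof -
      have e: "A \<inter> H \<inter> H = A \<inter> H" "A \<inter> H - H = {}" "(A - H) \<inter> H = {}" "A - H - H = A - H" by auto
      show ?thesis
        using meq[of "A \<inter> H", unfolded e] meq[of "A - H", unfolded e] A H(1)
          vector_measure_empty[OF \<mu>] by simp
    qed
    finally show ?thesis using vector_measure_split[OF \<mu> A H(1)] by simp
  qed
  have ei: "(\<lambda>x. ennreal (indicator S x)) = indicator S" for S :: "'a set"
    by (auto simp: fun_eq_iff indicator_def)
  have posd: "positive_variation M \<mu> = density ?V (\<lambda>x. ennreal (indicator H x))"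
  proof (rule measure_eqI)
    fix A assume "A \<in> sets (positive_variation M \<mu>)"
    then have A: "A \<in> sets M" by (simp add: positive_variation_def)
    have "emeasure (density ?V (indicator H)) A = emeasure ?V (H \<inter> A)"
      using A H(1) by (intro emeasure_restricted) auto
    also have "\<dots> = ennreal (\<mu> (A \<inter> H))"
    proof -
      have e: "H \<inter> A \<inter> H = A \<inter> H" "H \<inter> A - H = {}" by auto
      have "H \<inter> A \<in> sets M" using A H(1) by auto
      from eq[OF this, unfolded e] show ?thesis by (simp add: vector_measure_empty[OF \<mu>])
    qed
    finally have d: "emeasure (density ?V (indicator H)) A = ennreal (\<mu> (A \<inter> H))" .
    show "emeasure (positive_variation M \<mu>) A = emeasure (density ?V (\<lambda>x. ennreal (indicator H x))) A"
      unfolding ei d by (rule positive_variation_eq[OF \<mu> H A])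
  qed (simp add: positive_variation_def)
  have negd: "positive_variation M (\<lambda>B. - \<mu> B) = density ?V (\<lambda>x. ennreal (indicator (space M - H) x))"
  proof (rule measure_eqI)
    fix A assume "A \<in> sets (positive_variation M (\<lambda>B. - \<mu> B))"
    then have A: "A \<in> sets M" by (simp add: positive_variation_def)
    have "emeasure (density ?V (indicator (space M - H))) A = emeasure ?V ((space M - H) \<inter> A)"
      using A H(1) by (intro emeasure_restricted) auto
    also have "(space M - H) \<inter> A = A - H" using sets.sets_into_space[OF A] by auto
    also have "emeasure ?V (A - H) = ennreal (- \<mu> (A - H))"
    proof -
      have e: "(A - H) \<inter> H = {}" "A - H - H = A - H" by auto
      have "A - H \<in> sets M" using A H(1) by auto
      from eq[OF this, unfolded e] show ?thesis by (simp add: vector_measure_empty[OF \<mu>])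
    qed
    also have "A - H = A \<inter> (space M - H)" using sets.sets_into_space[OF A] by auto
    also have "ennreal (- \<mu> (A \<inter> (space M - H))) = emeasure (positive_variation M (\<lambda>B. - \<mu> B)) A"
    proof (rule positive_variation_eq[symmetric, OF vector_measure_uminus[OF \<mu>] _ _ _ A])
      fix B assume B: "B \<in> sets M" "B \<inter> (space M - H) = {}"
      then have "B \<subseteq> H" using sets.sets_into_space[OF B(1)] by auto
      then show "- \<mu> B \<le> 0" using H(2) B by simp
    next
      fix B assume "B \<in> sets M" "B \<subseteq> space M - H"
      then show "0 \<le> - \<mu> B" using H(3)[of B] by auto
    qed (use H(1) in auto)
    finally show "emeasure (positive_variation M (\<lambda>B. - \<mu> B)) A =
        emeasure (density ?V (\<lambda>x. ennreal (indicator (space M - H) x))) A"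
      unfolding ei by (rule sym)
  qed (simp add: positive_variation_def)
  have int_eq: "signed_integral M \<mu> A h = (LINT x|?V. indicator A x * (\<sigma> x * h x))"
    if A: "A \<in> sets M" and h: "integrable ?V h" for A h
  proof -
    have hm: "h \<in> borel_measurable M" using borel_measurable_integrable[OF h] by simp
    have i: "integrable ?V (\<lambda>x. indicator B x * (indicator A x * h x))" if "B \<in> sets M" for B
    proof (rule Bochner_Integration.integrable_bound[OF h])
      show "(\<lambda>x. indicator B x * (indicator A x * h x)) \<in> borel_measurable ?V"
        using A hm that by simp
    qed (auto simp: indicator_def)
    have "signed_integral M \<mu> A h =
        (LINT x|?V. indicator H x * (indicator A x * h x)) -
        (LINT x|?V. indicator (space M - H) x * (indicator A x * h x))"
      unfolding signed_integral_def posd negd set_lebesgue_integral_def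
      using A H(1) hm by (simp add: integral_density)
    also have "\<dots> = (LINT x|?V. indicator H x * (indicator A x * h x) -
        indicator (space M - H) x * (indicator A x * h x))"
      using H(1) by (intro Bochner_Integration.integral_diff[symmetric] i) auto
    also have "\<dots> = (LINT x|?V. indicator A x * (\<sigma> x * h x))"
      by (rule Bochner_Integration.integral_cong) (auto simp: \<sigma>_def indicator_def)
    finally show ?thesis .
  qed
  show ?thesis
    using \<sigma> \<mu>_eq int_eq by (intro bexI[of _ \<sigma>]) (auto simp: \<sigma>_alt)
qed

section \<open>Integration with respect to a vector measure\<close>

locale rybakov_space =
  fixes M :: "'a measure" and m :: "'a set \<Rightarrow> 'x::banach" and \<eta> :: "'a measure"
  assumes vm: "vector_measure M m" and ryb: "rybakov_measure M m \<eta>"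
begin

abbreviation V :: "('x \<Rightarrow>\<^sub>L real) \<Rightarrow> 'a measure" where
  "V x' \<equiv> variation M (scalar_measure m x')"

lemma vm_scalar: "vector_measure M (scalar_measure m x')"
  by (rule vector_measure_scalar[OF vm])

lemma finite_V: "finite_measure (V x')"
  by (rule finite_measure_variation[OF vm_scalar])

text \<open>The sign \<open>\<sigma>\<close> in the polar decomposition of \<open>\<langle>m,x'\<rangle>\<close>; it is the density of that scalar
  measure with respect to its variation.\<close>

definition polar :: "('x \<Rightarrow>\<^sub>L real) \<Rightarrow> 'a \<Rightarrow> real" where
  "polar x' = (SOME \<sigma>. \<sigma> \<in> borel_measurable M \<and> (\<forall>x. \<bar>\<sigma> x\<bar> = 1) \<and>
    (\<forall>A\<in>sets M. scalar_measure m x' A = (LINT x|V x'. indicator A x * \<sigma> x)) \<and>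
    (\<forall>A\<in>sets M. \<forall>h. integrable (V x') h \<longrightarrow>
       signed_integral M (scalar_measure m x') A h = (LINT x|V x'. indicator A x * (\<sigma> x * h x))))"

lemma polar_facts:
  shows polar_measurable [measurable]: "polar x' \<in> borel_measurable M"
    and abs_polar [simp]: "\<bar>polar x' x\<bar> = 1"
    and polar_measure: "A \<in> sets M \<Longrightarrow> blinfun_apply x' (m A) = (LINT x|V x'. indicator A x * polar x' x)"
    and polar_signed_integral: "A \<in> sets M \<Longrightarrow> integrable (V x') h \<Longrightarrow>
       signed_integral M (scalar_measure m x') A h = (LINT x|V x'. indicator A x * (polar x' x * h x))"
proof -
  have "\<exists>\<sigma>. \<sigma> \<in> borel_measurable M \<and> (\<forall>x. \<bar>\<sigma> x\<bar> = 1) \<and>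
    (\<forall>A\<in>sets M. scalar_measure m x' A = (LINT x|V x'. indicator A x * \<sigma> x)) \<and>
    (\<forall>A\<in>sets M. \<forall>h. integrable (V x') h \<longrightarrow>
       signed_integral M (scalar_measure m x') A h = (LINT x|V x'. indicator A x * (\<sigma> x * h x)))"
    using signed_measure_polar[OF vm_scalar, of x'] by blast
  from someI_ex[OF this, folded polar_def]
  show "polar x' \<in> borel_measurable M" "\<bar>polar x' x\<bar> = 1"
    "A \<in> sets M \<Longrightarrow> blinfun_apply x' (m A) = (LINT x|V x'. indicator A x * polar x' x)"
    "A \<in> sets M \<Longrightarrow> integrable (V x') h \<Longrightarrow>
       signed_integral M (scalar_measure m x') A h = (LINT x|V x'. indicator A x * (polar x' x * h x))"
    by (auto simp: scalar_measure_def)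
qed

lemma polar_sq [simp]: "polar x' x * polar x' x = 1"
  by (metis abs_mult_self_eq abs_polar mult_1)

lemma sets_\<eta>: "sets \<eta> = sets M" and space_\<eta>: "space \<eta> = space M"
  using ryb by (auto simp: rybakov_measure_def)

lemma measurable_\<eta>: "borel_measurable \<eta> = borel_measurable M"
  by (rule measurable_cong_sets) (auto simp: sets_\<eta>)

text \<open>All subsets of an \<open>\<eta>\<close>-null set are \<open>\<eta>\<close>-null, hence null for \<open>m\<close>. This is what makes
  classes modulo \<open>\<eta>\<close> meaningful for every scalar measure at once.\<close>

lemma null_transfer:
  assumes A: "A \<in> sets M" and 0: "emeasure \<eta> A = 0"
  shows "emeasure (V x') A = 0"
proof -
  have "scalar_measure m x' B = 0" if B: "B \<in> sets M" "B \<subseteq> A" for B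
  proof -
    have "emeasure \<eta> B = 0"
      using emeasure_mono[OF B(2), of \<eta>] A 0 by (simp add: sets_\<eta>)
    then have "m B = 0" using ryb B(1) by (simp add: rybakov_measure_def)
    then show ?thesis by (simp add: scalar_measure_def)
  qed
  then show ?thesis using variation_null[OF vm_scalar A] by blast
qed

lemma AE_transfer:
  assumes "AE x in \<eta>. Q x"
  shows "AE x in V x'. Q x"
proof -
  from assms obtain N where N: "{x \<in> space \<eta>. \<not> Q x} \<subseteq> N" "emeasure \<eta> N = 0" "N \<in> sets \<eta>"
    by (rule AE_E)
  then show ?thesis
    using null_transfer[of N x'] by (intro AE_I[of _ _ N]) (auto simp: sets_\<eta> space_\<eta>)
qed

lemma polar_integrable:
  assumes "integrable (V x') h"
  shows "integrable (V x') (\<lambda>x. polar x' x * h x)"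
proof (rule Bochner_Integration.integrable_bound[OF assms])
  show "(\<lambda>x. polar x' x * h x) \<in> borel_measurable (V x')"
    using borel_measurable_integrable[OF assms] by simp
qed (simp add: abs_mult)

lemma indicator_polar_integrable:
  assumes h: "integrable (V x') h" and A: "A \<in> sets M"
  shows "integrable (V x') (\<lambda>x. indicator A x * (polar x' x * h x))"
proof (rule Bochner_Integration.integrable_bound[OF h])
  show "(\<lambda>x. indicator A x * (polar x' x * h x)) \<in> borel_measurable (V x')"
    using borel_measurable_integrable[OF h] A by simp
qed (auto simp: abs_mult indicator_def)

definition scalarly_integrable :: "('a \<Rightarrow> real) \<Rightarrow> bool" where
  "scalarly_integrable h \<longleftrightarrow> h \<in> borel_measurable M \<and> (\<forall>x'. integrable (V x') h)"

lemma scalarly_integrable_bound: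
  assumes "scalarly_integrable g" "f \<in> borel_measurable M" "\<And>x. x \<in> space M \<Longrightarrow> \<bar>f x\<bar> \<le> \<bar>g x\<bar>"
  shows "scalarly_integrable f"
  unfolding scalarly_integrable_def
proof (intro conjI allI)
  fix x' show "integrable (V x') f"
    using assms by (intro Bochner_Integration.integrable_bound[of "V x'" g f])
      (auto simp: scalarly_integrable_def intro!: AE_I2)
qed (use assms in simp)

lemma simple_integral_representable:
  fixes s :: "'a \<Rightarrow> real"
  assumes s: "simple_function M s"
  shows "\<exists>w. \<forall>x'. blinfun_apply x' w = (LINT x|V x'. polar x' x * s x)"
proof (intro exI allI)
  fix x'
  interpret finite_measure "V x'" by (rule finite_V)
  let ?A = "\<lambda>c. s -` {c} \<inter> space M"
  have A: "?A c \<in> sets M" for c using s by (rule simple_functionD)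
  have fin: "finite (s ` space M)" using s by (rule simple_functionD)
  have 1: "integrable (V x') (\<lambda>x. c * (indicator (?A c) x * polar x' x))" for c
    by (intro integrable_mult_right indicator_polar_integrable[of x' "\<lambda>_. 1", simplified] A)
  have "(LINT x|V x'. polar x' x * s x) =
      (LINT x|V x'. (\<Sum>c\<in>s ` space M. c * (indicator (?A c) x * polar x' x)))"
  proof (rule Bochner_Integration.integral_cong)
    fix x assume "x \<in> space (V x')"
    then have x: "x \<in> space M" by simp
    have "(\<Sum>c\<in>s ` space M. c * (indicator (?A c) x * polar x' x)) =
        (\<Sum>c\<in>s ` space M. if c = s x then s x * polar x' x else 0)"
      using x by (intro sum.cong) (auto simp: indicator_def)
    also have "\<dots> = s x * polar x' x" using fin x by (subst sum.delta) auto
    finally show "polar x' x * s x = (\<Sum>c\<in>s ` space M. c * (indicator (?A c) x * polar x' x))" by simp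
  qed simp
  also have "\<dots> = (\<Sum>c\<in>s ` space M. (LINT x|V x'. c * (indicator (?A c) x * polar x' x)))"
    by (rule Bochner_Integration.integral_sum) (rule 1)
  also have "\<dots> = blinfun_apply x' (\<Sum>c\<in>s ` space M. c *\<^sub>R m (?A c))"
    by (simp add: blinfun.sum_right blinfun.scaleR_right polar_measure[OF A])
  finally show "blinfun_apply x' (\<Sum>c\<in>s ` space M. c *\<^sub>R m (?A c)) = (LINT x|V x'. polar x' x * s x)" ..
qed

text \<open>For a simple function \<open>s\<close> with \<open>\<bar>s\<bar> \<le> 2 \<bar>h\<bar>\<close>, the integral of \<open>s\<close> against \<open>\<langle>m,x'\<rangle>\<close> is the
  value of \<open>x'\<close> at a vector of \<open>X\<close>. These vectors are bounded functionals of \<open>x'\<close>, pointwise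
  bounded by the integrability of \<open>h\<close>, hence uniformly bounded. Approximating \<open>\<sigma> \<bar>h\<bar>\<close> by simple
  functions gives the bound for the integral of \<open>\<bar>h\<bar>\<close>.\<close>

lemma scalarly_integrable_semivariation:
  assumes h: "scalarly_integrable h"
  shows "\<exists>C\<ge>0. \<forall>x'. (LINT x|V x'. \<bar>h x\<bar>) \<le> C * norm x'"
proof -
  have hm [measurable]: "h \<in> borel_measurable M" and hi: "\<And>x'. integrable (V x') h"
    using h by (auto simp: scalarly_integrable_def)
  define W where "W = {w. \<exists>s. simple_function M s \<and> (\<forall>x\<in>space M. \<bar>s x\<bar> \<le> 2 * \<bar>h x\<bar>) \<and>
      (\<forall>x'. blinfun_apply x' w = (LINT x|V x'. polar x' x * s x))}"
  have "\<exists>C\<ge>0. \<forall>f\<in>(\<lambda>w (x' :: 'x \<Rightarrow>\<^sub>L real). blinfun_apply x' w) ` W. \<forall>x'. norm (f x') \<le> C * norm x'"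
  proof (rule Banach_Steinhaus)
    fix f assume "f \<in> (\<lambda>w (x' :: 'x \<Rightarrow>\<^sub>L real). blinfun_apply x' w) ` W"
    then show "bounded_linear f" by (auto intro: blinfun.bounded_linear_left)
  next
    fix x'
    have "norm (blinfun_apply x' w) \<le> (LINT x|V x'. 2 * \<bar>h x\<bar>)" if "w \<in> W" for w
    proof -
      obtain s where s: "simple_function M s" "\<forall>x\<in>space M. \<bar>s x\<bar> \<le> 2 * \<bar>h x\<bar>"
          "\<forall>x'. blinfun_apply x' w = (LINT x|V x'. polar x' x * s x)"
        using \<open>w \<in> W\<close> by (auto simp: W_def)
      have [measurable]: "s \<in> borel_measurable M" using s(1) by (rule borel_measurable_simple_function)
      have "integrable (V x') (\<lambda>x. 2 * \<bar>h x\<bar>)" using hi[of x'] by simp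
      then have i: "integrable (V x') (\<lambda>x. polar x' x * s x)"
        by (rule Bochner_Integration.integrable_bound) (use s(2) in \<open>auto simp: abs_mult intro!: AE_I2\<close>)
      have "norm (blinfun_apply x' w) \<le> (LINT x|V x'. norm (polar x' x * s x))"
        using s(3) integral_norm_bound by auto
      also have "\<dots> \<le> (LINT x|V x'. 2 * \<bar>h x\<bar>)"
      proof (rule integral_mono)
        show "integrable (V x') (\<lambda>x. norm (polar x' x * s x))" by (rule integrable_norm[OF i])
      qed (use hi[of x'] s(2) in \<open>auto simp: abs_mult\<close>)
      finally show ?thesis .
    qed
    then show "\<exists>B. \<forall>f\<in>(\<lambda>w (x' :: 'x \<Rightarrow>\<^sub>L real). blinfun_apply x' w) ` W. norm (f x') \<le> B" by auto
  qed
  then obtain C where C: "C \<ge> 0" "\<And>w x'. w \<in> W \<Longrightarrow> \<bar>blinfun_apply x' w\<bar> \<le> C * norm x'" by auto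
  have "(LINT x|V x'. \<bar>h x\<bar>) \<le> C * norm x'" for x'
  proof -
    have "(\<lambda>x. polar x' x * \<bar>h x\<bar>) \<in> borel_measurable M" by measurable
    from borel_measurable_implies_sequence_metric[OF this, of 0]
    obtain F where F0: "\<forall>i. simple_function M (F i)"
        "\<forall>x\<in>space M. (\<lambda>i. F i x) \<longlonglongrightarrow> polar x' x * \<bar>h x\<bar>"
        "\<forall>i. \<forall>x\<in>space M. dist (F i x) 0 \<le> 2 * dist (polar x' x * \<bar>h x\<bar>) 0"
      by blast
    have F: "\<And>i. simple_function M (F i)"
        "\<And>x. x \<in> space M \<Longrightarrow> (\<lambda>i. F i x) \<longlonglongrightarrow> polar x' x * \<bar>h x\<bar>"
        "\<And>i x. x \<in> space M \<Longrightarrow> \<bar>F i x\<bar> \<le> 2 * \<bar>h x\<bar>"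
      using F0 by (simp_all add: abs_mult)
    have [measurable]: "F i \<in> borel_measurable M" for i using F(1) by (rule borel_measurable_simple_function)
    have "(\<lambda>i. LINT x|V x'. polar x' x * F i x) \<longlonglongrightarrow> (LINT x|V x'. \<bar>h x\<bar>)"
    proof (rule integral_dominated_convergence)
      show "integrable (V x') (\<lambda>x. 2 * \<bar>h x\<bar>)" using hi[of x'] by simp
      show "AE x in V x'. (\<lambda>i. polar x' x * F i x) \<longlonglongrightarrow> \<bar>h x\<bar>"
      proof (rule AE_I2)
        fix x assume "x \<in> space (V x')"
        then have "(\<lambda>i. polar x' x * F i x) \<longlonglongrightarrow> polar x' x * (polar x' x * \<bar>h x\<bar>)"
          by (intro tendsto_intros F) simp
        then show "(\<lambda>i. polar x' x * F i x) \<longlonglongrightarrow> \<bar>h x\<bar>" by (simp flip: mult.assoc)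
      qed
    qed (use F(3) in \<open>auto simp: abs_mult intro!: AE_I2\<close>)
    moreover have "(LINT x|V x'. polar x' x * F i x) \<le> C * norm x'" for i
    proof -
      obtain w where w: "\<And>x'. blinfun_apply x' w = (LINT x|V x'. polar x' x * F i x)"
        using simple_integral_representable[OF F(1)] by blast
      then have "w \<in> W" unfolding W_def using F by blast
      from C(2)[OF this, of x'] show ?thesis using w by simp
    qed
    ultimately show ?thesis by (intro LIMSEQ_le_const2) auto
  qed
  then show ?thesis using C(1) by blast
qed

lemma vm_integrable_iff:
  "vm_integrable M m h \<longleftrightarrow> scalarly_integrable h \<and>
    (\<forall>A\<in>sets M. \<exists>v. \<forall>x'. blinfun_apply x' v = (LINT x|V x'. indicator A x * (polar x' x * h x)))"
  unfolding vm_integrable_def is_vm_integral_def scalarly_integrable_def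
  using polar_signed_integral by auto

text \<open>The functionals separate the points of \<open>X\<close>, so the vector in the definition of the integral
  is unique.\<close>

lemma vm_integral_eqI:
  assumes h: "scalarly_integrable h"
    and v: "\<And>x'. blinfun_apply x' v = (LINT x|V x'. polar x' x * h x)"
  shows "vm_integral M m h = v"
proof -
  have "signed_integral M (scalar_measure m x') (space M) h = (LINT x|V x'. polar x' x * h x)" for x'
  proof -
    have "signed_integral M (scalar_measure m x') (space M) h =
        (LINT x|V x'. indicator (space M) x * (polar x' x * h x))"
      using h by (intro polar_signed_integral) (auto simp: scalarly_integrable_def)
    also have "\<dots> = (LINT x|V x'. polar x' x * h x)"
      by (rule Bochner_Integration.integral_cong) auto
    finally show ?thesis .
  qed
  then have "is_vm_integral M m (space M) h w \<longleftrightarrow> (\<forall>x' :: 'x \<Rightarrow>\<^sub>L real. blinfun_apply x' w = blinfun_apply x' v)" for w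
    by (simp add: is_vm_integral_def v)
  then have "is_vm_integral M m (space M) h w \<longleftrightarrow> w = v" for w
    using functionals_separate[of w v] by auto
  then show ?thesis by (simp add: vm_integral_def)
qed

lemma apply_vm_integral:
  assumes h: "vm_integrable M m h"
  shows "blinfun_apply x' (vm_integral M m h) = (LINT x|V x'. polar x' x * h x)"
proof -
  obtain v where v: "\<And>x'. blinfun_apply x' v = (LINT x|V x'. indicator (space M) x * (polar x' x * h x))"
    using h unfolding vm_integrable_iff by blast
  have v: "blinfun_apply x' v = (LINT x|V x'. polar x' x * h x)" for x'
    unfolding v by (rule Bochner_Integration.integral_cong) auto
  have "scalarly_integrable h" using h by (simp add: vm_integrable_iff)
  from vm_integral_eqI[OF this v] show ?thesis using v by simp
qed

lemma vm_integrable_lincomb: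
  assumes f: "vm_integrable M m f" and g: "vm_integrable M m g"
  shows "vm_integrable M m (\<lambda>x. a * f x + b * g x)"
    and "vm_integral M m (\<lambda>x. a * f x + b * g x) = a *\<^sub>R vm_integral M m f + b *\<^sub>R vm_integral M m g"
proof -
  have fi: "integrable (V x') f" and gi: "integrable (V x') g" for x'
    using f g by (auto simp: vm_integrable_iff scalarly_integrable_def)
  have s: "scalarly_integrable (\<lambda>x. a * f x + b * g x)"
    using f g by (auto simp: vm_integrable_iff scalarly_integrable_def)
  show "vm_integrable M m (\<lambda>x. a * f x + b * g x)"
    unfolding vm_integrable_iff
  proof (intro conjI s ballI)
    fix A assume A: "A \<in> sets M"
    obtain v where v: "\<And>x'. blinfun_apply x' v = (LINT x|V x'. indicator A x * (polar x' x * f x))"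
      using f A unfolding vm_integrable_iff by blast
    obtain w where w: "\<And>x'. blinfun_apply x' w = (LINT x|V x'. indicator A x * (polar x' x * g x))"
      using g A unfolding vm_integrable_iff by blast
    have "blinfun_apply x' (a *\<^sub>R v + b *\<^sub>R w) =
        (LINT x|V x'. indicator A x * (polar x' x * (a * f x + b * g x)))" for x'
    proof -
      have "blinfun_apply x' (a *\<^sub>R v + b *\<^sub>R w) =
          (LINT x|V x'. a * (indicator A x * (polar x' x * f x)) + b * (indicator A x * (polar x' x * g x)))"
        using indicator_polar_integrable[OF fi A] indicator_polar_integrable[OF gi A]
        by (simp add: blinfun.add_right blinfun.scaleR_right v w)
      also have "\<dots> = (LINT x|V x'. indicator A x * (polar x' x * (a * f x + b * g x)))"
        by (rule Bochner_Integration.integral_cong) (auto simp: algebra_simps)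
      finally show ?thesis .
    qed
    then show "\<exists>v. \<forall>x'. blinfun_apply x' v =
        (LINT x|V x'. indicator A x * (polar x' x * (a * f x + b * g x)))" by blast
  qed
  show "vm_integral M m (\<lambda>x. a * f x + b * g x) = a *\<^sub>R vm_integral M m f + b *\<^sub>R vm_integral M m g"
  proof (rule vm_integral_eqI[OF s])
    fix x'
    have "blinfun_apply x' (a *\<^sub>R vm_integral M m f + b *\<^sub>R vm_integral M m g) =
        (LINT x|V x'. a * (polar x' x * f x) + b * (polar x' x * g x))"
      using polar_integrable[OF fi] polar_integrable[OF gi]
      by (simp add: blinfun.add_right blinfun.scaleR_right apply_vm_integral f g)
    also have "\<dots> = (LINT x|V x'. polar x' x * (a * f x + b * g x))"
      by (rule Bochner_Integration.integral_cong) (auto simp: algebra_simps)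
    finally show "blinfun_apply x' (a *\<^sub>R vm_integral M m f + b *\<^sub>R vm_integral M m g) =
        (LINT x|V x'. polar x' x * (a * f x + b * g x))" .
  qed
qed

text \<open>Write \<open>f = k g\<close> with \<open>\<bar>k\<bar> \<le> 1\<close> and round \<open>k\<close> to multiples of \<open>1 / (n+1)\<close>. The
  corresponding combination of the vectors \<open>\<integral>\<^sub>B g dm\<close> differs weakly from the desired integral
  by at most \<open>C \<parallel>x'\<parallel> / (n+1)\<close>, so these vectors form a Cauchy sequence in norm.\<close>

lemma vm_integrable_ideal:
  assumes g: "vm_integrable M m g" and f [measurable]: "f \<in> borel_measurable M"
    and le: "\<And>x. x \<in> space M \<Longrightarrow> \<bar>f x\<bar> \<le> \<bar>g x\<bar>"
  shows "vm_integrable M m f"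
proof -
  have gs: "scalarly_integrable g" using g by (simp add: vm_integrable_iff)
  have [measurable]: "g \<in> borel_measurable M" and gi: "\<And>x'. integrable (V x') g"
    using gs by (auto simp: scalarly_integrable_def)
  obtain C where C: "C \<ge> 0" "\<And>x'. (LINT x|V x'. \<bar>g x\<bar>) \<le> C * norm x'"
    using scalarly_integrable_semivariation[OF gs] by blast
  have fs: "scalarly_integrable f" by (rule scalarly_integrable_bound[OF gs f le])
  obtain \<nu> where \<nu>: "\<And>A x'. A \<in> sets M \<Longrightarrow>
      blinfun_apply x' (\<nu> A) = (LINT x|V x'. indicator A x * (polar x' x * g x))"
    using g unfolding vm_integrable_iff by metis
  define k where "k x = (if g x = 0 then 0 else f x / g x)" for x
  have k [measurable]: "k \<in> borel_measurable M" unfolding k_def by measurable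
  have kg: "k x * g x = f x" "\<bar>k x\<bar> \<le> 1" if "x \<in> space M" for x
    using le[OF that] by (auto simp: k_def field_simps abs_divide)
  have "\<exists>v. \<forall>x'. blinfun_apply x' v = (LINT x|V x'. indicator A x * (polar x' x * f x))"
    if A: "A \<in> sets M" for A
  proof -
    \<comment> \<open>\<open>B n j\<close> is the part of \<open>A\<close> where \<open>k\<close> is rounded down to \<open>j / (n+1)\<close>.\<close>
    define B where "B n j = {x \<in> space M. x \<in> A \<and> \<lfloor>real (Suc n) * k x\<rfloor> = j}" for n j
    have B: "B n j \<in> sets M" for n j unfolding B_def using A by measurable
    define J where "J n = {- int (Suc n)..int (Suc n)}" for n
    define u where "u n x = (\<Sum>j\<in>J n. (real_of_int j / real (Suc n)) * indicator (B n j) x)" for n x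
    define v where "v n = (\<Sum>j\<in>J n. (real_of_int j / real (Suc n)) *\<^sub>R \<nu> (B n j))" for n
    have u: "\<bar>u n x - indicator A x * k x\<bar> \<le> 1 / real (Suc n)" if x: "x \<in> space M" for n x
    proof (cases "x \<in> A")
      case False
      then have "u n x = 0" by (simp add: u_def B_def indicator_def)
      then show ?thesis using False by simp
    next
      case True
      define j where "j = \<lfloor>real (Suc n) * k x\<rfloor>"
      have "\<bar>real (Suc n) * k x\<bar> \<le> real (Suc n)"
        using kg(2)[OF x] by (simp add: abs_mult mult_left_le)
      then have "- int (Suc n) \<le> j" "j \<le> int (Suc n)" unfolding j_def by linarith+
      then have j: "j \<in> J n" unfolding J_def by simp
      have "u n x = (\<Sum>i\<in>J n. if i = j then real_of_int j / real (Suc n) else 0)"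
        unfolding u_def by (intro sum.cong) (use True x in \<open>auto simp: B_def j_def indicator_def\<close>)
      also have "\<dots> = real_of_int j / real (Suc n)" using j by (simp add: J_def)
      finally have "u n x = real_of_int j / real (Suc n)" .
      moreover have "real_of_int j \<le> real (Suc n) * k x" "real (Suc n) * k x < real_of_int j + 1"
        unfolding j_def by linarith+
      ultimately show ?thesis using True by (simp add: abs_le_iff field_simps)
    qed
    have um [measurable]: "u n \<in> borel_measurable M" for n unfolding u_def using B by measurable
    let ?L = "\<lambda>x'. LINT x|V x'. indicator A x * (polar x' x * f x)"
    have approx: "\<bar>blinfun_apply x' (v n) - ?L x'\<bar> \<le> C * norm x' / real (Suc n)" for x' n
    proof -
      have i1: "integrable (V x') (\<lambda>x. (real_of_int j / real (Suc n)) * (indicator (B n j) x * (polar x' x * g x)))" for j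
        by (intro integrable_mult_right indicator_polar_integrable gi B)
      have "blinfun_apply x' (v n) =
          (LINT x|V x'. (\<Sum>j\<in>J n. (real_of_int j / real (Suc n)) * (indicator (B n j) x * (polar x' x * g x))))"
        unfolding v_def
        by (subst Bochner_Integration.integral_sum[OF i1])
          (simp add: blinfun.sum_right blinfun.scaleR_right \<nu>[OF B])
      also have "\<dots> = (LINT x|V x'. u n x * (polar x' x * g x))"
        by (rule Bochner_Integration.integral_cong) (auto simp: u_def sum_distrib_right mult.assoc)
      finally have 1: "blinfun_apply x' (v n) = (LINT x|V x'. u n x * (polar x' x * g x))" .
      have i2: "integrable (V x') (\<lambda>x. u n x * (polar x' x * g x))"
        using Bochner_Integration.integrable_sum[of "J n", OF i1]
        by (simp add: u_def sum_distrib_right mult.assoc)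
      have i3: "integrable (V x') (\<lambda>x. indicator A x * (polar x' x * f x))"
        using fs A by (intro indicator_polar_integrable) (auto simp: scalarly_integrable_def)
      have "blinfun_apply x' (v n) - ?L x' =
          (LINT x|V x'. u n x * (polar x' x * g x) - indicator A x * (polar x' x * f x))"
        unfolding 1 by (rule Bochner_Integration.integral_diff[OF i2 i3, symmetric])
      also have "\<bar>\<dots>\<bar> \<le> (LINT x|V x'. \<bar>g x\<bar> / real (Suc n))"
      proof -
        have "\<bar>u n x * (polar x' x * g x) - indicator A x * (polar x' x * f x)\<bar> \<le> \<bar>g x\<bar> / real (Suc n)"
          if "x \<in> space M" for x
        proof -
          have "u n x * (polar x' x * g x) - indicator A x * (polar x' x * f x) =
              (u n x - indicator A x * k x) * (polar x' x * g x)"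
            using kg(1)[OF that] by (simp add: algebra_simps)
          then have "\<bar>u n x * (polar x' x * g x) - indicator A x * (polar x' x * f x)\<bar> =
              \<bar>u n x - indicator A x * k x\<bar> * \<bar>g x\<bar>" by (simp add: abs_mult)
          also have "\<dots> \<le> 1 / real (Suc n) * \<bar>g x\<bar>" using u[OF that, of n] by (intro mult_right_mono) auto
          finally show ?thesis by simp
        qed
        then have "(LINT x|V x'. norm (u n x * (polar x' x * g x) - indicator A x * (polar x' x * f x)))
            \<le> (LINT x|V x'. \<bar>g x\<bar> / real (Suc n))"
          using gi[of x'] by (intro integral_mono integrable_norm Bochner_Integration.integrable_diff i2 i3) auto
        from order_trans[OF integral_norm_bound this] show ?thesis unfolding real_norm_def .
      qed
      also have "\<dots> = (LINT x|V x'. \<bar>g x\<bar>) / real (Suc n)" by simp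
      also have "\<dots> \<le> C * norm x' / real (Suc n)" using C(2) by (intro divide_right_mono) auto
      finally show ?thesis .
    qed
    have "Cauchy v"
    proof (rule metric_CauchyI)
      fix e :: real assume e: "e > 0"
      obtain N where N: "2 * C / e < real N" using reals_Archimedean2 by blast
      have small: "C / real (Suc n) < e / 2" if "n \<ge> N" for n
      proof -
        have "2 * C / e < real (Suc n)" using N that by simp
        then show ?thesis using e by (simp add: field_simps)
      qed
      have "dist (v n) (v l) < e" if nl: "n \<ge> N" "l \<ge> N" for n l
      proof -
        have "norm (v n - v l) \<le> C / real (Suc n) + C / real (Suc l)"
        proof (rule norm_le_by_functionals)
          fix x' :: "'x \<Rightarrow>\<^sub>L real" assume x': "norm x' \<le> 1"
          have "C * norm x' / real (Suc i) \<le> C / real (Suc i)" for i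
            using C(1) x' by (intro divide_right_mono mult_left_le) auto
          then show "blinfun_apply x' (v n - v l) \<le> C / real (Suc n) + C / real (Suc l)"
            using approx[of x' n] approx[of x' l] unfolding blinfun.diff_right
            by (smt (verit, best))
        qed
        then show ?thesis using small[OF nl(1)] small[OF nl(2)] unfolding dist_norm by linarith
      qed
      then show "\<exists>N. \<forall>n\<ge>N. \<forall>l\<ge>N. dist (v n) (v l) < e" by blast
    qed
    then obtain w where w: "v \<longlonglongrightarrow> w" using Cauchy_convergent convergent_def by blast
    have "blinfun_apply x' w = ?L x'" for x'
    proof (rule LIMSEQ_unique)
      show "(\<lambda>n. blinfun_apply x' (v n)) \<longlonglongrightarrow> blinfun_apply x' w" by (intro tendsto_intros w)
      have "(\<lambda>n. C * norm x' * (1 / real (Suc n))) \<longlonglongrightarrow> C * norm x' * 0"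
        by (intro tendsto_intros LIMSEQ_Suc[OF lim_1_over_n])
      then have "(\<lambda>n. C * norm x' / real (Suc n)) \<longlonglongrightarrow> 0" by simp
      then have "(\<lambda>n. blinfun_apply x' (v n) - ?L x') \<longlonglongrightarrow> 0"
        by (rule Lim_null_comparison[rotated]) (use approx in auto)
      then show "(\<lambda>n. blinfun_apply x' (v n)) \<longlonglongrightarrow> ?L x'" by (simp add: LIM_zero_iff)
    qed
    then show ?thesis by blast
  qed
  then show ?thesis using fs by (auto simp: vm_integrable_iff)
qed

lemma vm_integral_cong_AE:
  assumes f: "vm_integrable M m f" and g [measurable]: "g \<in> borel_measurable M" and AE: "AE x in \<eta>. f x = g x"
  shows "vm_integrable M m g" "vm_integral M m g = vm_integral M m f"
proof -
  have fs: "scalarly_integrable f" using f by (simp add: vm_integrable_iff)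
  then have [measurable]: "f \<in> borel_measurable M" by (simp add: scalarly_integrable_def)
  have AE': "AE x in V x'. f x = g x" for x' by (rule AE_transfer[OF AE])
  have gs: "scalarly_integrable g"
    unfolding scalarly_integrable_def
  proof (intro conjI allI g)
    fix x'
    show "integrable (V x') g"
      using fs AE'[of x'] unfolding scalarly_integrable_def
      by (subst integrable_cong_AE[where g=f]) auto
  qed
  have eq: "(LINT x|V x'. indicator A x * (polar x' x * g x)) = (LINT x|V x'. indicator A x * (polar x' x * f x))"
    if "A \<in> sets M" for A x'
    using that AE'[of x'] by (intro integral_cong_AE) auto
  show gi: "vm_integrable M m g"
    using f gs by (auto simp: vm_integrable_iff eq)
  show "vm_integral M m g = vm_integral M m f"
  proof (rule vm_integral_eqI[OF gs])
    fix x'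
    show "blinfun_apply x' (vm_integral M m f) = (LINT x|V x'. polar x' x * g x)"
      unfolding apply_vm_integral[OF f] using AE'[of x'] by (intro integral_cong_AE) auto
  qed
qed

lemma vm_integrable_const: "vm_integrable M m (\<lambda>x. c)"
proof -
  have "vm_integrable M m (\<lambda>x. 1)"
    unfolding vm_integrable_iff scalarly_integrable_def
    using finite_V by (auto simp: polar_measure[symmetric] finite_measure.integrable_const)
  from vm_integrable_lincomb(1)[OF this this, of c 0] show ?thesis by simp
qed

lemma vm_integrable_bounded:
  assumes "f \<in> borel_measurable M" "\<And>x. x \<in> space M \<Longrightarrow> \<bar>f x\<bar> \<le> c"
  shows "vm_integrable M m f"
proof (rule vm_integrable_ideal[OF vm_integrable_const assms(1)])
  fix x assume "x \<in> space M" then show "\<bar>f x\<bar> \<le> \<bar>c\<bar>" using assms(2)[of x] by simp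
qed

end

section \<open>Classes of \<open>p\<close>-integrable functions\<close>

lemma conjugate_exponent_cases:
  fixes p p' :: ennreal
  assumes "1 \<le> p" "inverse p + inverse p' = 1"
  obtains (top) "p = top" "p' = 1" | (one) "p = 1" "p' = top"
    | (real) a b where "p = ennreal a" "p' = ennreal b" "1 < a" "1 < b" "1 / a + 1 / b = 1"
proof (cases "p = top \<or> p = 1")
  case True
  then show ?thesis
  proof
    assume p: "p = top"
    then have "inverse p' = 1" using assms by simp
    moreover from this have "p' \<noteq> 0" "p' \<noteq> top" by auto
    then obtain r where r: "p' = ennreal r" "r > 0" by (cases p') (auto simp: less_le)
    ultimately have "ennreal (inverse r) = ennreal 1" by (simp add: inverse_ennreal)
    then have "inverse r = 1" using r(2) by (subst (asm) ennreal_inj) auto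
    then have "p' = 1" using r(1) by simp
    then show ?thesis using p top by blast
  next
    assume p: "p = 1"
    then have "1 + inverse p' = 1 + 0" using assms by simp
    then have "inverse p' = 0" by (subst (asm) ennreal_add_left_cancel) simp
    then show ?thesis using p one by simp
  qed
next
  case False
  then obtain a where a: "p = ennreal a" "a \<ge> 0" by (cases p) auto
  have a1: "a > 1" using a False assms(1) by (cases "a = 1") (auto simp: ennreal_1[symmetric] simp del: ennreal_1)
  have ip: "inverse p = ennreal (1 / a)" using a a1 by (simp add: inverse_ennreal divide_inverse)
  have "p' \<noteq> 0" using assms(2) by auto
  moreover have "p' \<noteq> top" using assms(2) ip a1 by (auto simp: ennreal_1[symmetric] simp del: ennreal_1)
  ultimately obtain b where b: "p' = ennreal b" "b > 0" by (cases p') (auto simp: less_le)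
  have "inverse p' = ennreal (1 / b)" using b by (simp add: inverse_ennreal divide_inverse)
  then have "ennreal (1 / a + 1 / b) = ennreal 1" using assms(2) ip a1 b by (simp add: ennreal_plus)
  then have ab: "1 / a + 1 / b = 1" using a1 b by (subst (asm) ennreal_inj) auto
  have "0 < 1 / a" using a1 by simp
  then have "1 / b < 1" using ab by linarith
  then have "b > 1" using b by (simp add: field_simps)
  then show ?thesis using real[OF a(1) b(1) a1 _ ab] by blast
qed

lemma conjugate_exponent_ge_1:
  fixes p p' :: ennreal
  assumes "1 \<le> p" "inverse p + inverse p' = 1"
  shows "1 \<le> p'"
  using assms
proof (cases rule: conjugate_exponent_cases)
  case (real a b)
  then show ?thesis by (metis ennreal_1 ennreal_leI less_imp_le)
qed auto

text \<open>Young's inequality without the optimal constants. Compare \<open>x\<close> with \<open>y powr (b / a)\<close>.\<close>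

lemma mult_le_powr_add:
  fixes x y :: real
  assumes "x \<ge> 0" "y \<ge> 0" and ab: "a > 1" "b > 1" "1 / a + 1 / b = 1"
  shows "x * y \<le> x powr a + y powr b"
proof (cases "x \<le> y powr (b / a)")
  case True
  have "x * y \<le> y powr (b / a) * y" using True assms by (intro mult_right_mono)
  also have "\<dots> = y powr (b / a + 1)" using assms(2) by (cases "y = 0") (simp_all add: powr_add)
  also have "b / a + 1 = b" using ab by (simp add: field_simps)
  finally show ?thesis by (simp add: add_increasing)
next
  case False
  then have "y powr (b / a) \<le> x" by simp
  then have "(y powr (b / a)) powr (a / b) \<le> x powr (a / b)" using ab by (intro powr_mono2) auto
  then have y: "y \<le> x powr (a / b)" using assms by (simp add: powr_powr)
  have "x * y \<le> x * x powr (a / b)" using y assms by (intro mult_left_mono)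
  also have "\<dots> = x powr (1 + a / b)" using assms(1) by (cases "x = 0") (simp_all add: powr_add)
  also have "1 + a / b = a" using ab by (simp add: field_simps)
  finally show ?thesis by (simp add: add_increasing2)
qed

context rybakov_space
begin

lemma ae_class_self: "f \<in> borel_measurable M \<Longrightarrow> f \<in> ae_class \<eta> f"
  by (simp add: ae_class_def measurable_\<eta>)

lemma ae_class_eqI:
  assumes "f \<in> borel_measurable M" "g \<in> borel_measurable M" "AE x in \<eta>. f x = g x"
  shows "ae_class \<eta> f = ae_class \<eta> g"
proof -
  have "(AE x in \<eta>. h x = f x) \<longleftrightarrow> (AE x in \<eta>. h x = g x)" for h
  proof
    assume "AE x in \<eta>. h x = f x"
    with assms(3) show "AE x in \<eta>. h x = g x" by eventually_elim simp
  next
    assume "AE x in \<eta>. h x = g x"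
    with assms(3) show "AE x in \<eta>. h x = f x" by eventually_elim simp
  qed
  then show ?thesis by (auto simp: ae_class_def)
qed

lemma ae_rep_class:
  assumes "f \<in> borel_measurable M"
  shows "ae_rep (ae_class \<eta> f) \<in> borel_measurable M" "AE x in \<eta>. ae_rep (ae_class \<eta> f) x = f x"
proof -
  have "ae_rep (ae_class \<eta> f) \<in> ae_class \<eta> f"
    unfolding ae_rep_def using ae_class_self[OF assms] by (rule someI[of "\<lambda>g. g \<in> ae_class \<eta> f"])
  then show "ae_rep (ae_class \<eta> f) \<in> borel_measurable M" "AE x in \<eta>. ae_rep (ae_class \<eta> f) x = f x"
    by (auto simp: ae_class_def measurable_\<eta>)
qed

definition in_Lp :: "ennreal \<Rightarrow> ('a \<Rightarrow> real) \<Rightarrow> bool" where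
  "in_Lp p f \<longleftrightarrow> f \<in> borel_measurable M \<and>
    (if p = top then esssup \<eta> (\<lambda>x. ennreal \<bar>f x\<bar>) < top
     else vm_integrable M m (\<lambda>x. \<bar>f x\<bar> powr enn2real p))"

lemma Lp_vm_eq: "Lp_vm M m \<eta> p = ae_class \<eta> ` {f. in_Lp p f}"
  by (auto simp: Lp_vm_def in_Lp_def)

lemma in_Lp_measurable: "in_Lp p f \<Longrightarrow> f \<in> borel_measurable M"
  by (simp add: in_Lp_def)

lemma in_Lp_cong:
  assumes f: "in_Lp p f" and g: "g \<in> borel_measurable M" and AE: "AE x in \<eta>. f x = g x"
  shows "in_Lp p g"
proof (cases "p = top")
  case True
  have "esssup \<eta> (\<lambda>x. ennreal \<bar>g x\<bar>) = esssup \<eta> (\<lambda>x. ennreal \<bar>f x\<bar>)"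
    using AE g in_Lp_measurable[OF f] by (intro esssup_AE_cong) (auto simp: measurable_\<eta>)
  then show ?thesis using f g True by (simp add: in_Lp_def)
next
  case False
  have "vm_integrable M m (\<lambda>x. \<bar>g x\<bar> powr enn2real p)"
    by (rule vm_integral_cong_AE(1)[of "\<lambda>x. \<bar>f x\<bar> powr enn2real p"])
      (use f g AE False in \<open>auto simp: in_Lp_def\<close>)
  then show ?thesis using g False by (simp add: in_Lp_def)
qed

lemma in_Lp_rep:
  assumes "F \<in> Lp_vm M m \<eta> p"
  shows "in_Lp p (ae_rep F)" "ae_class \<eta> (ae_rep F) = F"
proof -
  obtain f where f: "in_Lp p f" "F = ae_class \<eta> f" using assms by (auto simp: Lp_vm_eq)
  note r = ae_rep_class[OF in_Lp_measurable[OF f(1)]]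
  have "AE x in \<eta>. f x = ae_rep F x" using r(2) unfolding f(2) by eventually_elim simp
  then show "in_Lp p (ae_rep F)" using in_Lp_cong[OF f(1)] r(1) f(2) by simp
  show "ae_class \<eta> (ae_rep F) = F"
    using ae_class_eqI[OF r(1) in_Lp_measurable[OF f(1)] r(2)] f(2) by simp
qed

lemma in_Lp_of_class:
  assumes "ae_class \<eta> f \<in> Lp_vm M m \<eta> p" "f \<in> borel_measurable M"
  shows "in_Lp p f"
  using in_Lp_cong[OF in_Lp_rep(1)[OF assms(1)] assms(2)] ae_rep_class(2)[OF assms(2)] by simp

lemma esssup_le_iff:
  assumes "f \<in> borel_measurable M"
  shows "esssup \<eta> (\<lambda>x. ennreal \<bar>f x\<bar>) \<le> c \<longleftrightarrow> (AE x in \<eta>. ennreal \<bar>f x\<bar> \<le> c)"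
proof
  have m: "(\<lambda>x. ennreal \<bar>f x\<bar>) \<in> borel_measurable \<eta>" using assms by (simp add: measurable_\<eta>)
  show "AE x in \<eta>. ennreal \<bar>f x\<bar> \<le> c" if "esssup \<eta> (\<lambda>x. ennreal \<bar>f x\<bar>) \<le> c"
    using esssup_AE[of "\<lambda>x. ennreal \<bar>f x\<bar>" \<eta>]
  proof eventually_elim
    case (elim x) then show ?case using that by (rule order_trans)
  qed
  show "esssup \<eta> (\<lambda>x. ennreal \<bar>f x\<bar>) \<le> c" if "AE x in \<eta>. ennreal \<bar>f x\<bar> \<le> c"
    using m that by (rule esssup_I)
qed

lemma in_Lp_top_bounded:
  assumes "in_Lp top f"
  shows "\<exists>C\<ge>0. AE x in \<eta>. \<bar>f x\<bar> \<le> C"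
proof -
  let ?s = "esssup \<eta> (\<lambda>x. ennreal \<bar>f x\<bar>)"
  have f: "f \<in> borel_measurable M" "?s < top" using assms by (auto simp: in_Lp_def)
  have s: "?s = ennreal (enn2real ?s)" using f(2) by simp
  have "AE x in \<eta>. ennreal \<bar>f x\<bar> \<le> ennreal (enn2real ?s)"
    using esssup_le_iff[OF f(1), of "ennreal (enn2real ?s)"] s by simp
  then have "AE x in \<eta>. \<bar>f x\<bar> \<le> enn2real ?s" by eventually_elim (simp add: ennreal_le_iff)
  then show ?thesis by (intro exI[of _ "enn2real ?s"]) simp
qed

text \<open>The bound holds only almost everywhere, so the bounded factor is first truncated.\<close>

lemma vm_integrable_mult_bounded:
  assumes f: "f \<in> borel_measurable M" "AE x in \<eta>. \<bar>f x\<bar> \<le> C" and g: "in_Lp 1 g"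
  shows "vm_integrable M m (\<lambda>x. f x * g x)"
proof -
  have gm [measurable]: "g \<in> borel_measurable M" using g by (rule in_Lp_measurable)
  note f(1) [measurable]
  have "vm_integrable M m (\<lambda>x. \<bar>g x\<bar>)" using g by (simp add: in_Lp_def)
  then have gi: "vm_integrable M m g" by (rule vm_integrable_ideal) auto
  define f' where "f' x = max (- \<bar>C\<bar>) (min \<bar>C\<bar> (f x))" for x
  have [measurable]: "f' \<in> borel_measurable M" unfolding f'_def by measurable
  have "vm_integrable M m (\<lambda>x. f' x * g x)"
  proof (rule vm_integrable_ideal)
    show "vm_integrable M m (\<lambda>x. C * g x + 0 * g x)" by (rule vm_integrable_lincomb(1)[OF gi gi])
    fix x
    have "\<bar>f' x\<bar> \<le> \<bar>C\<bar>" by (auto simp: f'_def)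
    then show "\<bar>f' x * g x\<bar> \<le> \<bar>C * g x + 0 * g x\<bar>" by (simp add: abs_mult mult_right_mono)
  qed measurable
  then show ?thesis
  proof (rule vm_integral_cong_AE(1))
    show "AE x in \<eta>. f' x * g x = f x * g x"
      using f(2) by eventually_elim (auto simp: f'_def)
    show "(\<lambda>x. f x * g x) \<in> borel_measurable M" by measurable
  qed
qed

lemma vm_integrable_mult:
  assumes pp: "1 \<le> p" "inverse p + inverse p' = 1" and f: "in_Lp p f" and g: "in_Lp p' g"
  shows "vm_integrable M m (\<lambda>x. f x * g x)"
  using pp
proof (cases rule: conjugate_exponent_cases)
  case top
  then show ?thesis
    using in_Lp_top_bounded f g vm_integrable_mult_bounded in_Lp_measurable by metis
next
  case one
  then have "vm_integrable M m (\<lambda>x. g x * f x)"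
    using in_Lp_top_bounded f g vm_integrable_mult_bounded in_Lp_measurable by metis
  then show ?thesis by (simp add: mult.commute)
next
  case (real a b)
  have fa: "vm_integrable M m (\<lambda>x. \<bar>f x\<bar> powr a)" and gb: "vm_integrable M m (\<lambda>x. \<bar>g x\<bar> powr b)"
    using f g real by (simp_all add: in_Lp_def)
  show ?thesis
  proof (rule vm_integrable_ideal[OF vm_integrable_lincomb(1)[OF fa gb, of 1 1]])
    fix x
    show "\<bar>f x * g x\<bar> \<le> \<bar>1 * \<bar>f x\<bar> powr a + 1 * \<bar>g x\<bar> powr b\<bar>"
      using mult_le_powr_add[of "\<bar>f x\<bar>" "\<bar>g x\<bar>" a b] real by (simp add: abs_mult)
  qed (intro borel_measurable_times in_Lp_measurable[OF f] in_Lp_measurable[OF g])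
qed

lemma vm_pairing_class:
  assumes f: "f \<in> borel_measurable M" and g: "g \<in> borel_measurable M"
    and i: "vm_integrable M m (\<lambda>x. f x * g x)"
  shows "vm_pairing M m (ae_class \<eta> f) (ae_class \<eta> g) = vm_integral M m (\<lambda>x. f x * g x)"
  unfolding vm_pairing_def
proof (rule vm_integral_cong_AE(2)[OF i])
  show "AE x in \<eta>. f x * g x = ae_rep (ae_class \<eta> f) x * ae_rep (ae_class \<eta> g) x"
    using ae_rep_class(2)[OF f] ae_rep_class(2)[OF g] by eventually_elim simp
qed (intro borel_measurable_times ae_rep_class f g)

lemma vm_pairing_commute: "vm_pairing M m F G = vm_pairing M m G F"
  by (simp add: vm_pairing_def mult.commute)

lemma Lp_norm_class_finite:
  assumes f: "f \<in> borel_measurable M" and p: "p \<noteq> top"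
  shows "Lp_norm M m \<eta> p (ae_class \<eta> f) =
    (SUP x'\<in>cball 0 1. LINT x|V x'. \<bar>f x\<bar> powr enn2real p) powr (1 / enn2real p)"
proof -
  have "(LINT x|V x'. \<bar>ae_rep (ae_class \<eta> f) x\<bar> powr enn2real p) =
      (LINT x|V x'. \<bar>f x\<bar> powr enn2real p)" for x'
    using AE_transfer[OF ae_rep_class(2)[OF f], of x'] ae_rep_class(1)[OF f] f
    by (intro integral_cong_AE) auto
  then show ?thesis using p by (simp add: Lp_norm_def)
qed

lemma Lp_norm_class_top:
  assumes f: "f \<in> borel_measurable M"
  shows "Lp_norm M m \<eta> top (ae_class \<eta> f) = enn2real (esssup \<eta> (\<lambda>x. ennreal \<bar>f x\<bar>))"
proof -
  have "esssup \<eta> (\<lambda>x. ennreal \<bar>ae_rep (ae_class \<eta> f) x\<bar>) = esssup \<eta> (\<lambda>x. ennreal \<bar>f x\<bar>)"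
    using ae_rep_class[OF f] f by (intro esssup_AE_cong) (auto simp: measurable_\<eta>)
  then show ?thesis by (simp add: Lp_norm_def)
qed

lemma semivariation_bdd_above:
  assumes "vm_integrable M m h" "\<And>x. h x \<ge> 0"
  shows "bdd_above ((\<lambda>x'. LINT x|V x'. h x) ` cball 0 1)"
proof -
  obtain C where C: "C \<ge> 0" "\<And>x'. (LINT x|V x'. \<bar>h x\<bar>) \<le> C * norm x'"
    using scalarly_integrable_semivariation[of h] assms by (auto simp: vm_integrable_iff)
  have "(LINT x|V x'. h x) \<le> C" if "x' \<in> cball 0 1" for x'
  proof -
    have "(LINT x|V x'. h x) \<le> C * norm x'" using C(2)[of x'] assms(2) by simp
    also have "\<dots> \<le> C" using that C(1) by (simp add: mult_left_le)
    finally show ?thesis .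
  qed
  then show ?thesis by (rule bdd_aboveI2)
qed

text \<open>The supremum in the norm is a real supremum, which is meaningful because the integrals over
  the dual ball are bounded by the semivariation.\<close>

lemma Lp_norm_le_iff:
  assumes f: "in_Lp p f" and p: "1 \<le> p" and c: "0 \<le> c"
  shows "Lp_norm M m \<eta> p (ae_class \<eta> f) \<le> c \<longleftrightarrow>
    (if p = top then (AE x in \<eta>. \<bar>f x\<bar> \<le> c)
     else (\<forall>x'\<in>cball 0 1. (LINT x|V x'. \<bar>f x\<bar> powr enn2real p) \<le> c powr enn2real p))"
proof (cases "p = top")
  case True
  let ?s = "esssup \<eta> (\<lambda>x. ennreal \<bar>f x\<bar>)"
  have fm: "f \<in> borel_measurable M" "?s < top" using f True by (auto simp: in_Lp_def)
  have "enn2real ?s \<le> c \<longleftrightarrow> ?s \<le> ennreal c"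
    using fm(2) c by (metis enn2real_leI enn2real_nonneg ennreal_enn2real ennreal_leI)
  also have "\<dots> \<longleftrightarrow> (AE x in \<eta>. \<bar>f x\<bar> \<le> c)" using c by (simp add: esssup_le_iff[OF fm(1)] ennreal_le_iff)
  finally show ?thesis using True Lp_norm_class_top[OF fm(1)] by simp
next
  case False
  let ?a = "enn2real p"
  have a: "?a \<ge> 1" using p False enn2real_mono[of 1 p] by (simp add: less_top)
  let ?I = "\<lambda>x'. LINT x|V x'. \<bar>f x\<bar> powr ?a"
  define s where "s = (SUP x'\<in>cball 0 1. ?I x')"
  have bdd: "bdd_above (?I ` cball 0 1)"
    using f False by (intro semivariation_bdd_above) (auto simp: in_Lp_def)
  have s0: "0 \<le> s"
    unfolding s_def by (rule cSUP_upper2[OF bdd, of 0]) (auto intro: integral_nonneg)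
  have "s powr (1 / ?a) \<le> c \<longleftrightarrow> s \<le> c powr ?a"
  proof
    assume "s powr (1 / ?a) \<le> c"
    then have "(s powr (1 / ?a)) powr ?a \<le> c powr ?a" using a by (intro powr_mono2) auto
    then show "s \<le> c powr ?a" using a s0 by (simp add: powr_powr)
  next
    assume "s \<le> c powr ?a"
    then have "s powr (1 / ?a) \<le> (c powr ?a) powr (1 / ?a)" using a s0 by (intro powr_mono2) auto
    then show "s powr (1 / ?a) \<le> c" using a c by (simp add: powr_powr)
  qed
  also have "s \<le> c powr ?a \<longleftrightarrow> (\<forall>x'\<in>cball 0 1. ?I x' \<le> c powr ?a)"
    unfolding s_def by (intro cSUP_le_iff bdd) auto
  finally show ?thesis
    using False Lp_norm_class_finite[OF in_Lp_measurable[OF f] False] by (simp add: s_def)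
qed

lemma Lp_norm_nonneg: "0 \<le> Lp_norm M m \<eta> p F"
  by (simp add: Lp_norm_def)

text \<open>Fatou's lemma. It makes unit balls closed under convergence of coordinates, without
  continuity of the norm.\<close>

lemma Lp_norm_le_limit:
  assumes p: "1 \<le> p" and fn: "\<And>n. in_Lp p (f n)" and f: "in_Lp p g"
    and lim: "\<And>x. (\<lambda>n. f n x) \<longlonglongrightarrow> g x"
    and le: "\<And>n. Lp_norm M m \<eta> p (ae_class \<eta> (f n)) \<le> 1"
  shows "Lp_norm M m \<eta> p (ae_class \<eta> g) \<le> 1"
proof (cases "p = top")
  case True
  then have "AE x in \<eta>. \<bar>f n x\<bar> \<le> 1" for n using le[of n] Lp_norm_le_iff[OF fn p, of 1] by simp
  then have "AE x in \<eta>. \<forall>n. \<bar>f n x\<bar> \<le> 1" by (simp add: AE_all_countable)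
  then have "AE x in \<eta>. \<bar>g x\<bar> \<le> 1"
  proof eventually_elim
    case (elim x)
    show ?case by (rule LIMSEQ_le_const2[OF tendsto_rabs[OF lim]]) (use elim in auto)
  qed
  then show ?thesis using True Lp_norm_le_iff[OF f p, of 1] by simp
next
  case False
  let ?a = "enn2real p"
  have a: "?a \<ge> 1" using p False enn2real_mono[of 1 p] by (simp add: less_top)
  have "(LINT x|V x'. \<bar>g x\<bar> powr ?a) \<le> 1" if x': "x' \<in> cball 0 1" for x'
  proof -
    have i: "integrable (V x') (\<lambda>x. \<bar>f n x\<bar> powr ?a)" "integrable (V x') (\<lambda>x. \<bar>g x\<bar> powr ?a)" for n
      using fn[of n] f False by (auto simp: in_Lp_def vm_integrable_iff scalarly_integrable_def)
    have m: "f n \<in> borel_measurable M" "g \<in> borel_measurable M" for n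
      using fn f by (auto dest: in_Lp_measurable)
    have "ennreal (LINT x|V x'. \<bar>g x\<bar> powr ?a) = (\<integral>\<^sup>+x. ennreal (\<bar>g x\<bar> powr ?a) \<partial>V x')"
      by (rule nn_integral_eq_integral[OF i(2), symmetric]) simp
    also have "\<dots> = (\<integral>\<^sup>+x. liminf (\<lambda>n. ennreal (\<bar>f n x\<bar> powr ?a)) \<partial>V x')"
    proof (rule nn_integral_cong)
      fix x
      have "(\<lambda>n. ennreal (\<bar>f n x\<bar> powr ?a)) \<longlonglongrightarrow> ennreal (\<bar>g x\<bar> powr ?a)"
        using a by (intro tendsto_ennrealI tendsto_powr2 tendsto_rabs lim tendsto_const) auto
      then show "ennreal (\<bar>g x\<bar> powr ?a) = liminf (\<lambda>n. ennreal (\<bar>f n x\<bar> powr ?a))"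
        by (rule lim_imp_Liminf[OF trivial_limit_sequentially, symmetric])
    qed
    also have "\<dots> \<le> liminf (\<lambda>n. \<integral>\<^sup>+x. ennreal (\<bar>f n x\<bar> powr ?a) \<partial>V x')"
      using m by (intro nn_integral_liminf) simp
    also have "\<dots> \<le> 1"
    proof (rule order_trans[OF Liminf_le_Limsup])
      have "(\<integral>\<^sup>+x. ennreal (\<bar>f n x\<bar> powr ?a) \<partial>V x') \<le> 1" for n
      proof -
        have "(LINT x|V x'. \<bar>f n x\<bar> powr ?a) \<le> 1"
          using le[of n] Lp_norm_le_iff[OF fn p, of 1 n] False x' by simp
        moreover have "(\<integral>\<^sup>+x. ennreal (\<bar>f n x\<bar> powr ?a) \<partial>V x') = ennreal (LINT x|V x'. \<bar>f n x\<bar> powr ?a)"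
          by (rule nn_integral_eq_integral[OF i(1)]) simp
        ultimately show ?thesis by (metis ennreal_1 ennreal_leI)
      qed
      then show "limsup (\<lambda>n. \<integral>\<^sup>+x. ennreal (\<bar>f n x\<bar> powr ?a) \<partial>V x') \<le> 1"
        by (intro Limsup_bounded) simp
    qed simp
    finally show ?thesis by (metis ennreal_1 ennreal_le_iff zero_le_one)
  qed
  then show ?thesis using False Lp_norm_le_iff[OF f p, of 1] by simp
qed

lemma in_Lp_bounded:
  assumes f: "f \<in> borel_measurable M" "\<And>x. x \<in> space M \<Longrightarrow> \<bar>f x\<bar> \<le> c"
  shows "in_Lp p f"
proof (cases "p = top")
  case True
  have "AE x in \<eta>. ennreal \<bar>f x\<bar> \<le> ennreal c"
    using f(2) by (intro AE_I2 ennreal_leI) (auto simp: space_\<eta>)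
  then have "esssup \<eta> (\<lambda>x. ennreal \<bar>f x\<bar>) \<le> ennreal c" using esssup_le_iff[OF f(1)] by simp
  then show ?thesis using f(1) True by (auto simp: in_Lp_def intro: le_less_trans)
next
  case False
  have "vm_integrable M m (\<lambda>x. \<bar>f x\<bar> powr enn2real p)"
    using f by (intro vm_integrable_bounded[of _ "c powr enn2real p"]) (auto intro!: powr_mono2)
  then show ?thesis using f(1) False by (simp add: in_Lp_def)
qed

lemma Lp_norm_bounded:
  assumes p: "1 \<le> p"
  shows "\<exists>K\<ge>0. \<forall>f c. f \<in> borel_measurable M \<longrightarrow> 0 \<le> c \<longrightarrow> (\<forall>x\<in>space M. \<bar>f x\<bar> \<le> c) \<longrightarrow>
    Lp_norm M m \<eta> p (ae_class \<eta> f) \<le> K * c"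
proof -
  obtain C where C: "C \<ge> 0" "\<And>x'. (LINT x|V x'. \<bar>1::real\<bar>) \<le> C * norm x'"
    using scalarly_integrable_semivariation[of "\<lambda>_. 1"] vm_integrable_const[of 1]
    by (auto simp: vm_integrable_iff)
  have "Lp_norm M m \<eta> p (ae_class \<eta> f) \<le> (C + 1) * c"
    if f: "f \<in> borel_measurable M" and c: "0 \<le> c" "\<forall>x\<in>space M. \<bar>f x\<bar> \<le> c" for f c
  proof -
    have mem: "in_Lp p f" using f c by (intro in_Lp_bounded) auto
    have Cc: "c \<le> (C + 1) * c" using C c by (simp add: algebra_simps)
    show ?thesis
    proof (cases "p = top")
      case True
      have "AE x in \<eta>. \<bar>f x\<bar> \<le> (C + 1) * c" using c Cc by (intro AE_I2) (force simp: space_\<eta>)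
      then show ?thesis using True Lp_norm_le_iff[OF mem p, of "(C + 1) * c"] C c by simp
    next
      case False
      let ?a = "enn2real p"
      have a: "?a \<ge> 1" using p False enn2real_mono[of 1 p] by (simp add: less_top)
      have "(LINT x|V x'. \<bar>f x\<bar> powr ?a) \<le> ((C + 1) * c) powr ?a" if x': "x' \<in> cball 0 1" for x'
      proof -
        interpret finite_measure "V x'" by (rule finite_V)
        have "(LINT x|V x'. \<bar>f x\<bar> powr ?a) \<le> (LINT x|V x'. c powr ?a * \<bar>1\<bar>)"
        proof (rule integral_mono)
          show "integrable (V x') (\<lambda>x. \<bar>f x\<bar> powr ?a)"
            using mem False by (auto simp: in_Lp_def vm_integrable_iff scalarly_integrable_def)
        qed (use c a in \<open>auto intro!: powr_mono2\<close>)
        also have "\<dots> = c powr ?a * (LINT x|V x'. \<bar>1\<bar>)" by (rule integral_mult_right_zero)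
        also have "\<dots> \<le> c powr ?a * (C * norm x')" by (intro mult_left_mono C) simp
        also have "\<dots> \<le> c powr ?a * (C + 1)"
          using x' C(1) mult_left_le[of "norm x'" C] by (intro mult_left_mono) auto
        also have "\<dots> \<le> c powr ?a * (C + 1) powr ?a"
          using a C(1) powr_mono[of 1 ?a "C + 1"] by (intro mult_left_mono) auto
        also have "\<dots> = ((C + 1) * c) powr ?a" using C(1) c by (simp add: powr_mult mult.commute)
        finally show ?thesis .
      qed
      then show ?thesis using False Lp_norm_le_iff[OF mem p, of "(C + 1) * c"] C c by simp
    qed
  qed
  then show ?thesis using C(1) by (intro exI[of _ "C + 1"]) auto
qed

text \<open>A substitute for Hoelder's inequality against a constant: integrate
  \<open>\<bar>f\<bar> \<le> d + d powr (1 - p) * \<bar>f\<bar> powr p\<close> for \<open>d\<close> just above the norm of \<open>f\<close>.\<close>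

lemma L1_le_Lp_norm:
  assumes p: "1 \<le> p" and f: "in_Lp p f" and x': "norm x' \<le> 1"
  shows "(LINT x|V x'. \<bar>f x\<bar>) \<le> (measure (V x') (space M) + 1) * Lp_norm M m \<eta> p (ae_class \<eta> f)"
proof -
  interpret finite_measure "V x'" by (rule finite_V)
  let ?N = "Lp_norm M m \<eta> p (ae_class \<eta> f)" and ?v = "measure (V x') (space M)"
  note fm [measurable] = in_Lp_measurable[OF f]
  have v: "?v + 1 > 0" by (simp add: add_nonneg_pos)
  have key: "(LINT x|V x'. \<bar>f x\<bar>) \<le> (?v + 1) * d" if d: "?N < d" for d
  proof -
    have d0: "d > 0" using d Lp_norm_nonneg[of p "ae_class \<eta> f"] by linarith
    show ?thesis
    proof (cases "p = top")
      case True
      have "AE x in \<eta>. \<bar>f x\<bar> \<le> d" using d d0 True Lp_norm_le_iff[OF f p, of d] by simp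
      then have AE: "AE x in V x'. \<bar>f x\<bar> \<le> d" by (rule AE_transfer)
      have "(LINT x|V x'. \<bar>f x\<bar>) \<le> (LINT x|V x'. d)"
        using AE by (intro integral_mono_AE integrable_const_bound[of _ d]) auto
      also have "\<dots> = ?v * d" by simp
      also have "\<dots> \<le> (?v + 1) * d" using d0 by simp
      finally show ?thesis .
    next
      case False
      let ?a = "enn2real p"
      have a: "?a \<ge> 1" using p False enn2real_mono[of 1 p] by (simp add: less_top)
      have i: "integrable (V x') (\<lambda>x. \<bar>f x\<bar> powr ?a)"
        using f False by (auto simp: in_Lp_def vm_integrable_iff scalarly_integrable_def)
      have A: "(LINT x|V x'. \<bar>f x\<bar> powr ?a) \<le> d powr ?a"
        using d d0 False Lp_norm_le_iff[OF f p, of d] x' by simp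
      have pt: "\<bar>f x\<bar> \<le> d + d powr (1 - ?a) * \<bar>f x\<bar> powr ?a" for x
      proof (cases "\<bar>f x\<bar> \<le> d")
        case False
        then have "d powr (?a - 1) \<le> \<bar>f x\<bar> powr (?a - 1)" using d0 a by (intro powr_mono2) auto
        then have "d powr (1 - ?a) * d powr (?a - 1) \<le> d powr (1 - ?a) * \<bar>f x\<bar> powr (?a - 1)"
          by (rule mult_left_mono) simp
        then have "1 \<le> d powr (1 - ?a) * \<bar>f x\<bar> powr (?a - 1)"
          using d0 by (simp flip: powr_add)
        then have "\<bar>f x\<bar> * 1 \<le> \<bar>f x\<bar> * (d powr (1 - ?a) * \<bar>f x\<bar> powr (?a - 1))"
          by (rule mult_left_mono) simp
        also have "\<dots> = d powr (1 - ?a) * \<bar>f x\<bar> powr ?a"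
          using False d0 by (simp add: powr_diff)
        finally show ?thesis using d0 by simp
      qed (use d0 in \<open>simp add: add_increasing2\<close>)
      have "(LINT x|V x'. \<bar>f x\<bar>) \<le> (LINT x|V x'. d + d powr (1 - ?a) * \<bar>f x\<bar> powr ?a)"
      proof (rule integral_mono)
        show i2: "integrable (V x') (\<lambda>x. d + d powr (1 - ?a) * \<bar>f x\<bar> powr ?a)" using i by simp
        show "integrable (V x') (\<lambda>x. \<bar>f x\<bar>)"
          by (rule Bochner_Integration.integrable_bound[OF i2])
            (use pt in \<open>auto intro!: AE_I2 intro: order_trans[OF _ abs_ge_self]\<close>)
      qed (rule pt)
      also have "\<dots> = ?v * d + d powr (1 - ?a) * (LINT x|V x'. \<bar>f x\<bar> powr ?a)"
        using i by simp
      also have "\<dots> \<le> ?v * d + d powr (1 - ?a) * d powr ?a" using A by (intro add_left_mono mult_left_mono) auto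
      also have "d powr (1 - ?a) * d powr ?a = d" using d0 by (simp flip: powr_add)
      finally show ?thesis by (simp add: algebra_simps)
    qed
  qed
  have "(LINT x|V x'. \<bar>f x\<bar>) / (?v + 1) \<le> ?N"
  proof (rule dense_ge)
    fix d assume "?N < d"
    from key[OF this] show "(LINT x|V x'. \<bar>f x\<bar>) / (?v + 1) \<le> d" using v by (simp add: field_simps)
  qed
  then show ?thesis using v by (simp add: field_simps)
qed

end

section \<open>The pairing and the topologies it induces\<close>

context rybakov_space
begin

lemma ae_add_class:
  assumes "f \<in> borel_measurable M" "g \<in> borel_measurable M"
  shows "ae_add \<eta> (ae_class \<eta> f) (ae_class \<eta> g) = ae_class \<eta> (\<lambda>x. f x + g x)"
  unfolding ae_add_def
proof (rule ae_class_eqI)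
  show "AE x in \<eta>. ae_rep (ae_class \<eta> f) x + ae_rep (ae_class \<eta> g) x = f x + g x"
    using ae_rep_class(2)[OF assms(1)] ae_rep_class(2)[OF assms(2)] by eventually_elim simp
qed (intro borel_measurable_add ae_rep_class assms)+

lemma ae_diff_class:
  assumes "f \<in> borel_measurable M" "g \<in> borel_measurable M"
  shows "ae_diff \<eta> (ae_class \<eta> f) (ae_class \<eta> g) = ae_class \<eta> (\<lambda>x. f x - g x)"
  unfolding ae_diff_def
proof (rule ae_class_eqI)
  show "AE x in \<eta>. ae_rep (ae_class \<eta> f) x - ae_rep (ae_class \<eta> g) x = f x - g x"
    using ae_rep_class(2)[OF assms(1)] ae_rep_class(2)[OF assms(2)] by eventually_elim simp
qed (intro borel_measurable_diff ae_rep_class assms)+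

lemma ae_scale_class:
  assumes "f \<in> borel_measurable M"
  shows "ae_scale \<eta> c (ae_class \<eta> f) = ae_class \<eta> (\<lambda>x. c * f x)"
  unfolding ae_scale_def
proof (rule ae_class_eqI)
  show "AE x in \<eta>. c * ae_rep (ae_class \<eta> f) x = c * f x"
    using ae_rep_class(2)[OF assms(1)] by eventually_elim simp
qed (intro borel_measurable_times borel_measurable_const ae_rep_class assms)+

lemma vm_pairing_lincomb:
  assumes m: "f \<in> borel_measurable M" "f' \<in> borel_measurable M" "g \<in> borel_measurable M"
    and i: "vm_integrable M m (\<lambda>x. f x * g x)" "vm_integrable M m (\<lambda>x. f' x * g x)"
  shows "vm_pairing M m (ae_class \<eta> (\<lambda>x. a * f x + b * f' x)) (ae_class \<eta> g) =
    a *\<^sub>R vm_pairing M m (ae_class \<eta> f) (ae_class \<eta> g) + b *\<^sub>R vm_pairing M m (ae_class \<eta> f') (ae_class \<eta> g)"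
proof -
  have eq: "(\<lambda>x. (a * f x + b * f' x) * g x) = (\<lambda>x. a * (f x * g x) + b * (f' x * g x))"
    by (auto simp: algebra_simps)
  have "vm_pairing M m (ae_class \<eta> (\<lambda>x. a * f x + b * f' x)) (ae_class \<eta> g) =
      vm_integral M m (\<lambda>x. (a * f x + b * f' x) * g x)"
    using m vm_integrable_lincomb(1)[OF i, of a b] by (intro vm_pairing_class) (auto simp: eq)
  then show ?thesis
    unfolding eq using vm_integrable_lincomb(2)[OF i, of a b] m i by (simp add: vm_pairing_class)
qed

lemma vm_pairing_diff:
  assumes F: "F \<in> Lp_vm M m \<eta> p" "F' \<in> Lp_vm M m \<eta> p" and G: "G \<in> Lp_vm M m \<eta> p'"
    and i: "\<And>f g. in_Lp p f \<Longrightarrow> in_Lp p' g \<Longrightarrow> vm_integrable M m (\<lambda>x. f x * g x)"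
  shows "vm_pairing M m (ae_diff \<eta> F F') G = vm_pairing M m F G - vm_pairing M m F' G"
proof -
  note r = in_Lp_rep[OF F(1)] in_Lp_rep[OF F(2)] in_Lp_rep[OF G]
  have "ae_diff \<eta> F F' = ae_class \<eta> (\<lambda>x. 1 * ae_rep F x + (- 1) * ae_rep F' x)"
    by (simp add: ae_diff_def)
  then show ?thesis
    using vm_pairing_lincomb[of "ae_rep F" "ae_rep F'" "ae_rep G" 1 "- 1"] r i
    by (simp add: in_Lp_measurable)
qed

lemma topspace_tau_m: "topspace (tau_m M m \<eta> P R) = P"
  unfolding tau_m_def seminorm_topology_def topology_generated_by_topspace by auto

lemma openin_tau_m:
  assumes "G \<in> R" "F0 \<in> P" "0 < \<epsilon>"
  shows "openin (tau_m M m \<eta> P R) {F \<in> P. norm (vm_pairing M m (ae_diff \<eta> F F0) G) < \<epsilon>}"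
  unfolding tau_m_def seminorm_topology_def
  by (intro topology_generated_by_Basis insertI2 CollectI exI[of _ "\<lambda>F. norm (vm_pairing M m F G)"]
      exI[of _ F0] exI[of _ \<epsilon>]) (use assms in auto)

lemma limitin_tau_m:
  assumes lim: "limitin (tau_m M m \<eta> P R) \<sigma> l sequentially"
    and P: "P \<subseteq> Lp_vm M m \<eta> p" and R: "R \<subseteq> Lp_vm M m \<eta> p'" and G: "G \<in> R"
    and i: "\<And>f g. in_Lp p f \<Longrightarrow> in_Lp p' g \<Longrightarrow> vm_integrable M m (\<lambda>x. f x * g x)"
  shows "(\<lambda>n. vm_pairing M m (ae_diff \<eta> (\<sigma> n) l) G) \<longlonglongrightarrow> 0"
proof (rule tendstoI)
  fix \<epsilon> :: real assume \<epsilon>: "\<epsilon> > 0"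
  have l: "l \<in> P" using lim by (auto simp: limitin_def topspace_tau_m)
  have "vm_pairing M m (ae_diff \<eta> l l) G = 0"
    using vm_pairing_diff[of l p l G p', OF _ _ _ i] l P R G by auto
  then have "l \<in> {F \<in> P. norm (vm_pairing M m (ae_diff \<eta> F l) G) < \<epsilon>}" using l \<epsilon> by simp
  then have "\<forall>\<^sub>F n in sequentially. \<sigma> n \<in> {F \<in> P. norm (vm_pairing M m (ae_diff \<eta> F l) G) < \<epsilon>}"
    using lim openin_tau_m[OF G l \<epsilon>] unfolding limitin_def by blast
  then show "\<forall>\<^sub>F n in sequentially. dist (vm_pairing M m (ae_diff \<eta> (\<sigma> n) l) G) 0 < \<epsilon>"
    by eventually_elim simp
qed

text \<open>By linearity, the pairings of \<open>F\<close> and \<open>F0\<close> with \<open>G\<close> differ by the pairing of the difference,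
  which is small on a basic neighbourhood of \<open>F0\<close>.\<close>

lemma continuous_map_tau_m:
  assumes P: "P \<subseteq> Lp_vm M m \<eta> p" and R: "R \<subseteq> Lp_vm M m \<eta> p'" and G: "G \<in> R"
    and i: "\<And>f g. in_Lp p f \<Longrightarrow> in_Lp p' g \<Longrightarrow> vm_integrable M m (\<lambda>x. f x * g x)"
  shows "continuous_map (tau_m M m \<eta> P R) euclideanreal (\<lambda>F. norm (vm_pairing M m F G))"
  unfolding continuous_map
proof (intro conjI allI impI)
  let ?h = "\<lambda>F. norm (vm_pairing M m F G)"
  fix U :: "real set" assume "openin euclideanreal U"
  then have U: "open U" by simp
  show "openin (tau_m M m \<eta> P R) {F \<in> topspace (tau_m M m \<eta> P R). ?h F \<in> U}"
  proof (subst openin_subopen, intro ballI)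
    fix F0 assume "F0 \<in> {F \<in> topspace (tau_m M m \<eta> P R). ?h F \<in> U}"
    then have F0: "F0 \<in> P" "?h F0 \<in> U" by (auto simp: topspace_tau_m)
    obtain \<epsilon> where \<epsilon>: "\<epsilon> > 0" "ball (?h F0) \<epsilon> \<subseteq> U" using U F0(2) openE by blast
    let ?W = "{F \<in> P. norm (vm_pairing M m (ae_diff \<eta> F F0) G) < \<epsilon>}"
    have diff: "vm_pairing M m (ae_diff \<eta> F F0) G = vm_pairing M m F G - vm_pairing M m F0 G" if "F \<in> P" for F
      using vm_pairing_diff[of F p F0 G p', OF _ _ _ i] that F0(1) P R G by blast
    have "?h F \<in> U" if "F \<in> ?W" for F
    proof -
      have "dist (?h F0) (?h F) < \<epsilon>"
        using that diff[of F] norm_triangle_ineq3[of "vm_pairing M m F G" "vm_pairing M m F0 G"]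
        by (auto simp: dist_real_def abs_minus_commute)
      then show ?thesis using \<epsilon>(2) by auto
    qed
    then show "\<exists>W. openin (tau_m M m \<eta> P R) W \<and> F0 \<in> W \<and> W \<subseteq> {F \<in> topspace (tau_m M m \<eta> P R). ?h F \<in> U}"
      using openin_tau_m[OF G F0(1) \<epsilon>(1)] diff[OF F0(1)] F0(1) \<epsilon>(1)
      by (intro exI[of _ ?W]) (auto simp: topspace_tau_m)
  qed
qed simp

text \<open>Differences of values of \<open>A\<close> are again values of \<open>A\<close>, so the preimage of a generating set is
  a translate of the set where a continuous function is small.\<close>

lemma continuous_map_into_tau_m:
  fixes A :: "'e::real_normed_vector \<Rightarrow> ('a \<Rightarrow> real) set"
  assumes diff: "\<And>e e'. ae_diff \<eta> (A e) (A e') = A (e - e')"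
    and cont: "\<And>G. G \<in> R \<Longrightarrow> continuous_on UNIV (\<lambda>e. vm_pairing M m (A e) G)"
  shows "continuous_map euclidean (tau_m M m \<eta> (range A) R) A"
  unfolding tau_m_def seminorm_topology_def
proof (rule continuous_on_generated_topo)
  fix U assume "U \<in> insert (range A) {{F \<in> range A. s (ae_diff \<eta> F F0) < \<epsilon>} |s F0 \<epsilon>.
      s \<in> (\<lambda>G F. norm (vm_pairing M m F G)) ` R \<and> F0 \<in> range A \<and> 0 < \<epsilon>}"
  then consider "U = range A"
    | G e0 \<epsilon> where "G \<in> R" "U = {F \<in> range A. norm (vm_pairing M m (ae_diff \<eta> F (A e0)) G) < \<epsilon>}"
    by blast
  then show "openin euclidean (A -` U \<inter> topspace euclidean)"
  proof cases
    case 1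
    then have "A -` U = UNIV" by auto
    then show ?thesis by simp
  next
    case (2 G e0 \<epsilon>)
    have "A -` U = {e. norm (vm_pairing M m (A (e - e0)) G) < \<epsilon>}"
      unfolding 2(2) by (auto simp: diff)
    moreover have "open {e. norm (vm_pairing M m (A (e - e0)) G) < \<epsilon>}"
      by (intro open_Collect_less continuous_intros
          continuous_on_compose2[OF cont[OF 2(1)], of _ "\<lambda>e. e - e0"]) auto
    ultimately show ?thesis by simp
  qed
qed auto

text \<open>Transports \<open>norming_form\<close> to spaces of classes that are parametrised by one normed space. It
  is used twice, with the roles of \<open>A\<close> and \<open>A'\<close> exchanged.\<close>

lemma m_normingI:
  fixes A A' :: "'e::real_normed_vector \<Rightarrow> ('a \<Rightarrow> real) set" and \<beta> :: "'e \<Rightarrow> 'e \<Rightarrow> 'x"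
  assumes A: "\<And>e e'. ae_add \<eta> (A e) (A e') = A (e + e')" "\<And>t e. ae_scale \<eta> t (A e) = A (t *\<^sub>R e)"
      "\<And>e. A e = ae_zero \<eta> \<longleftrightarrow> e = 0"
    and pair: "\<And>e e'. vm_pairing M m (A e) (A' e') = \<beta> e e'"
    and lin: "\<And>e'. linear (\<lambda>e. \<beta> e e')"
    and scale: "\<And>t e e'. \<beta> e (t *\<^sub>R e') = t *\<^sub>R \<beta> e e'"
    and bdd: "\<And>e e'. norm (\<beta> e e') \<le> C * norm e * norm e'" "C > 0"
    and coercive: "\<And>e. c * (norm e)\<^sup>2 \<le> norm (\<beta> e e)" "c > 0"
    and \<nu>: "\<And>e. c1 * norm e \<le> Lp_norm M m \<eta> p' (A' e)" "\<And>e. Lp_norm M m \<eta> p' (A' e) \<le> C1 * norm e"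
      "c1 > 0" "C1 > 0"
    and \<rho>: "\<And>e. c2 * norm e \<le> Lp_norm M m \<eta> p (A e)" "\<And>e. Lp_norm M m \<eta> p (A e) \<le> C2 * norm e"
      "c2 > 0" "C2 > 0"
  shows "m_norming M m \<eta> p p' (range A) (range A')"
proof -
  define N where "N F = (SUP G\<in>Lp_unit_ball M m \<eta> p' (range A'). norm (vm_pairing M m F G))" for F
  have ball: "Lp_unit_ball M m \<eta> p' (range A') = A' ` {e'. Lp_norm M m \<eta> p' (A' e') \<le> 1}"
    by (auto simp: Lp_unit_ball_def)
  have N: "N (A e) = (SUP e'\<in>{e'. Lp_norm M m \<eta> p' (A' e') \<le> 1}. norm (\<beta> e e'))" for e
    unfolding N_def ball image_image pair ..
  note nf = norming_form[where N = "\<lambda>e. N (A e)" and \<nu> = "\<lambda>e. Lp_norm M m \<eta> p' (A' e)",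
      OF lin scale bdd coercive \<nu> N]
  have "is_norm_on \<eta> (range A) N"
    unfolding is_norm_on_def using nf(1-4) by (auto simp: A)
  moreover have "equivalent_on (range A) N (Lp_norm M m \<eta> p)"
    unfolding equivalent_on_def
  proof (intro exI conjI ballI)
    show "c / C1 / C2 > 0" "C / c1 / c2 > 0" using bdd coercive \<nu> \<rho> by auto
    fix F assume "F \<in> range A"
    then obtain e where e: "F = A e" by blast
    have "c / C1 * (Lp_norm M m \<eta> p (A e) / C2) \<le> c / C1 * norm e"
      using \<rho>(2)[of e] \<rho>(4) coercive(2) \<nu>(4) by (intro mult_left_mono) (auto simp: field_simps)
    then show "c / C1 / C2 * Lp_norm M m \<eta> p F \<le> N F" using nf(5)[of e] by (simp add: e)
    have "C / c1 * norm e \<le> C / c1 * (Lp_norm M m \<eta> p (A e) / c2)"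
      using \<rho>(1)[of e] \<rho>(3) bdd(2) \<nu>(3) by (intro mult_left_mono) (auto simp: field_simps)
    then show "N F \<le> C / c1 / c2 * Lp_norm M m \<eta> p F" using nf(6)[of e] by (simp add: e)
  qed
  moreover have "N = (\<lambda>F. SUP G\<in>Lp_unit_ball M m \<eta> p' (range A'). norm (vm_pairing M m F G))"
    by (simp add: N_def fun_eq_iff)
  ultimately show ?thesis unfolding m_norming_def Let_def by simp
qed

end

section \<open>Dual systems for the domain of an isomorphism\<close>

locale lp_operator = rybakov_space M m \<eta>
  for M :: "'a measure" and m :: "'a set \<Rightarrow> 'x::banach" and \<eta> :: "'a measure" +
  fixes p p' :: ennreal and P :: "('a \<Rightarrow> real) set set" and T :: "('a \<Rightarrow> real) set \<Rightarrow> 'e::banach"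
  assumes p: "1 \<le> p" and pp: "inverse p + inverse p' = 1"
    and P: "Lp_subspace M m \<eta> p P" and T: "Lp_isomorphism M m \<eta> p P T"
begin

text \<open>The inverse of \<open>T\<close> parametrises \<open>P\<close> by the normed type of \<open>E\<close>, where topology and linear
  algebra are available; \<open>P\<close> itself is only a set of classes.\<close>

definition Tinv :: "'e \<Rightarrow> ('a \<Rightarrow> real) set" where
  "Tinv e = the_inv_into P T e"

lemma p': "1 \<le> p'"
  by (rule conjugate_exponent_ge_1[OF p pp])

lemma product_integrable: "in_Lp p f \<Longrightarrow> in_Lp p' g \<Longrightarrow> vm_integrable M m (\<lambda>x. f x * g x)"
  by (rule vm_integrable_mult[OF p pp])

lemma product_integrable': "in_Lp p' f \<Longrightarrow> in_Lp p g \<Longrightarrow> vm_integrable M m (\<lambda>x. f x * g x)"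
  using product_integrable[of g f] by (simp add: mult.commute)

lemma P_Lp: "P \<subseteq> Lp_vm M m \<eta> p"
  and P_add: "F \<in> P \<Longrightarrow> G \<in> P \<Longrightarrow> ae_add \<eta> F G \<in> P"
  and P_scale: "F \<in> P \<Longrightarrow> ae_scale \<eta> c F \<in> P"
  using P by (auto simp: Lp_subspace_def ae_subspace_def)

lemma T_add: "F \<in> P \<Longrightarrow> G \<in> P \<Longrightarrow> T (ae_add \<eta> F G) = T F + T G"
  and T_scale: "F \<in> P \<Longrightarrow> T (ae_scale \<eta> c F) = c *\<^sub>R T F"
  and T_bij: "bij_betw T P UNIV"
  using T by (auto simp: Lp_isomorphism_def)

lemma Tinv_in: "Tinv e \<in> P" and T_Tinv [simp]: "T (Tinv e) = e"
proof -
  have "inj_on T P" "e \<in> T ` P" using T_bij by (auto simp: bij_betw_def)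
  then show "Tinv e \<in> P" "T (Tinv e) = e"
    unfolding Tinv_def by (auto intro: the_inv_into_into f_the_inv_into_f)
qed

lemma Tinv_T: "F \<in> P \<Longrightarrow> Tinv (T F) = F"
  using T_bij unfolding Tinv_def by (simp add: bij_betw_def the_inv_into_f_f)

lemma range_Tinv: "range Tinv = P"
  using Tinv_in Tinv_T by (metis image_subset_iff rangeI subsetI subset_antisym)

lemma Tinv_add: "ae_add \<eta> (Tinv e) (Tinv e') = Tinv (e + e')"
  using Tinv_T[OF P_add[OF Tinv_in Tinv_in], of e e'] by (simp add: T_add Tinv_in)

lemma Tinv_scale: "ae_scale \<eta> t (Tinv e) = Tinv (t *\<^sub>R e)"
  using Tinv_T[OF P_scale[OF Tinv_in], of t e] by (simp add: T_scale Tinv_in)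

lemma Tinv_zero: "Tinv 0 = ae_zero \<eta>"
  using Tinv_scale[of 0 0] by (simp add: ae_scale_def ae_zero_def)

lemma Tinv_eq_zero: "Tinv e = ae_zero \<eta> \<longleftrightarrow> e = 0"
  by (metis Tinv_zero T_Tinv)

lemma Tinv_norm_bounds:
  "\<exists>c>0. \<exists>C>0. \<forall>e. c * norm e \<le> Lp_norm M m \<eta> p (Tinv e) \<and> Lp_norm M m \<eta> p (Tinv e) \<le> C * norm e"
proof -
  obtain C1 where C1: "\<And>F. F \<in> P \<Longrightarrow> norm (T F) \<le> C1 * Lp_norm M m \<eta> p F"
    using T unfolding Lp_isomorphism_def by blast
  obtain C2 where C2: "\<And>e. Lp_norm M m \<eta> p (Tinv e) \<le> C2 * norm e"
    using T unfolding Lp_isomorphism_def Tinv_def by blast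
  have "1 / (\<bar>C1\<bar> + 1) * norm e \<le> Lp_norm M m \<eta> p (Tinv e)" for e
  proof -
    have "norm e \<le> C1 * Lp_norm M m \<eta> p (Tinv e)" using C1[OF Tinv_in[of e]] by simp
    also have "\<dots> \<le> (\<bar>C1\<bar> + 1) * Lp_norm M m \<eta> p (Tinv e)" by (intro mult_right_mono Lp_norm_nonneg) auto
    finally show ?thesis by (simp add: field_simps add_pos_nonneg)
  qed
  moreover have "Lp_norm M m \<eta> p (Tinv e) \<le> (\<bar>C2\<bar> + 1) * norm e" for e
    using order_trans[OF C2[of e] mult_right_mono[of C2 "\<bar>C2\<bar> + 1" "norm e"]] by simp
  moreover have "1 / (\<bar>C1\<bar> + 1) > 0" "\<bar>C2\<bar> + 1 > 0" by (simp_all add: add_nonneg_pos)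
  ultimately show ?thesis by blast
qed

definition rep :: "'e \<Rightarrow> 'a \<Rightarrow> real" where
  "rep e = ae_rep (Tinv e)"

lemma rep: "in_Lp p (rep e)" "ae_class \<eta> (rep e) = Tinv e"
  using in_Lp_rep[of "Tinv e" p] Tinv_in P_Lp by (auto simp: rep_def)

lemma rep_measurable [measurable]: "rep e \<in> borel_measurable M"
  using rep(1) by (rule in_Lp_measurable)

lemma Tinv_diff: "ae_diff \<eta> (Tinv e) (Tinv e') = Tinv (e - e')"
proof -
  have "Tinv (e - e') = ae_add \<eta> (Tinv e) (ae_scale \<eta> (- 1) (Tinv e'))" by (simp add: Tinv_add Tinv_scale)
  also have "\<dots> = ae_class \<eta> (\<lambda>x. rep e x + (- 1) * rep e' x)"
    unfolding rep(2)[symmetric] by (subst ae_scale_class, simp, subst ae_add_class) auto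
  also have "\<dots> = ae_diff \<eta> (Tinv e) (Tinv e')" unfolding rep(2)[symmetric] by (simp add: ae_diff_class)
  finally show ?thesis ..
qed

text \<open>Linear combinations of classes are represented by the same combinations of functions; this
  links the dimension of \<open>P\<close> with that of \<open>E\<close>.\<close>

lemma Tinv_sum:
  assumes "finite I"
  shows "Tinv (\<Sum>i\<in>I. c i *\<^sub>R v i) = ae_class \<eta> (\<lambda>x. \<Sum>i\<in>I. c i * rep (v i) x)"
  using assms
proof (induction I rule: finite_induct)
  case empty
  show ?case by (simp add: Tinv_zero ae_zero_def)
next
  case (insert i I)
  have "Tinv (\<Sum>i\<in>insert i I. c i *\<^sub>R v i) = ae_add \<eta> (ae_scale \<eta> (c i) (Tinv (v i))) (Tinv (\<Sum>i\<in>I. c i *\<^sub>R v i))"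
    using insert.hyps by (simp add: Tinv_add Tinv_scale)
  also have "\<dots> = ae_class \<eta> (\<lambda>x. c i * rep (v i) x + (\<Sum>i\<in>I. c i * rep (v i) x))"
    unfolding insert.IH unfolding rep(2)[symmetric] by (subst ae_scale_class, simp, subst ae_add_class) auto
  finally show ?case using insert by simp
qed

lemma ae_finite_dimensional_iff:
  "ae_finite_dimensional \<eta> P \<longleftrightarrow> (\<exists>B :: 'e set. finite B \<and> span B = UNIV)"
proof
  assume "ae_finite_dimensional \<eta> P"
  then obtain B where B: "finite B" "B \<subseteq> P"
      "\<And>F. F \<in> P \<Longrightarrow> \<exists>c. F = ae_class \<eta> (\<lambda>x. \<Sum>G\<in>B. c G * ae_rep G x)"
    unfolding ae_finite_dimensional_def by blast
  have "e \<in> span (T ` B)" for e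
  proof -
    obtain c where c: "Tinv e = ae_class \<eta> (\<lambda>x. \<Sum>G\<in>B. c G * ae_rep G x)" using B(3) Tinv_in by blast
    have "ae_rep G = rep (T G)" if "G \<in> B" for G using that B(2) Tinv_T by (auto simp: rep_def)
    then have "(\<lambda>x. \<Sum>G\<in>B. c G * ae_rep G x) = (\<lambda>x. \<Sum>G\<in>B. c G * rep (T G) x)"
      by (auto intro!: ext sum.cong)
    then have "Tinv e = Tinv (\<Sum>G\<in>B. c G *\<^sub>R T G)" unfolding c Tinv_sum[OF B(1)] by simp
    then have "e = (\<Sum>G\<in>B. c G *\<^sub>R T G)" by (metis T_Tinv)
    also have "\<dots> \<in> span (T ` B)" by (intro span_sum span_scale span_base imageI)
    finally show ?thesis .
  qed
  then show "\<exists>B :: 'e set. finite B \<and> span B = UNIV" using B(1) by (intro exI[of _ "T ` B"]) auto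
next
  assume "\<exists>B :: 'e set. finite B \<and> span B = UNIV"
  then obtain B :: "'e set" where B: "finite B" "span B = UNIV" by blast
  show "ae_finite_dimensional \<eta> P"
    unfolding ae_finite_dimensional_def
  proof (intro exI[of _ "Tinv ` B"] conjI ballI)
    show "finite (Tinv ` B)" "Tinv ` B \<subseteq> P" using B Tinv_in by auto
    fix F assume F: "F \<in> P"
    obtain c where c: "T F = (\<Sum>b\<in>B. c b *\<^sub>R b)" using B span_finite[OF B(1)] by auto
    have "F = ae_class \<eta> (\<lambda>x. \<Sum>b\<in>B. c b * rep b x)"
      using Tinv_sum[OF B(1), of c "\<lambda>b. b"] Tinv_T[OF F] c by simp
    also have "(\<lambda>x. \<Sum>b\<in>B. c b * rep b x) = (\<lambda>x. \<Sum>G\<in>Tinv ` B. c (T G) * ae_rep G x)"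
      by (subst sum.reindex) (auto simp: rep_def inj_on_def dest: arg_cong[of _ _ T])
    finally show "\<exists>c. F = ae_class \<eta> (\<lambda>x. \<Sum>G\<in>Tinv ` B. c G * ae_rep G x)"
      by (rule exI[of _ "\<lambda>G. c (T G)"])
  qed
qed

abbreviation pairing :: "'e \<Rightarrow> ('a \<Rightarrow> real) set \<Rightarrow> 'x" where
  "pairing e G \<equiv> vm_pairing M m (Tinv e) G"

lemma linear_pairing:
  assumes G: "G \<in> Lp_vm M m \<eta> p'"
  shows "linear (\<lambda>e. pairing e G)"
proof -
  note g = in_Lp_rep[OF G]
  have lc: "pairing (t *\<^sub>R e + u *\<^sub>R e') G = t *\<^sub>R pairing e G + u *\<^sub>R pairing e' G" for t u e e'
  proof -
    have "Tinv (t *\<^sub>R e + u *\<^sub>R e') = ae_add \<eta> (ae_scale \<eta> t (Tinv e)) (ae_scale \<eta> u (Tinv e'))"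
      by (simp add: Tinv_add Tinv_scale)
    also have "\<dots> = ae_class \<eta> (\<lambda>x. t * rep e x + u * rep e' x)"
      unfolding rep(2)[symmetric] by (simp add: ae_scale_class ae_add_class)
    finally show ?thesis
      using vm_pairing_lincomb[of "rep e" "rep e'" "ae_rep G" t u] g
      by (simp add: rep(2) in_Lp_measurable product_integrable[OF rep(1) g(1)])
  qed
  show ?thesis using lc[of 1 _ 1] lc[of _ _ 0 0] by (intro linearI) auto
qed

lemma zero_in_ball:
  assumes "Lp_subspace M m \<eta> p' Pm"
  shows "ae_zero \<eta> \<in> Lp_unit_ball M m \<eta> p' Pm"
proof -
  have "in_Lp p' (\<lambda>x. 0)" by (rule in_Lp_bounded[of _ 0]) auto
  then have "Lp_norm M m \<eta> p' (ae_zero \<eta>) \<le> 1"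
    unfolding ae_zero_def using Lp_norm_le_iff[OF _ p', of "\<lambda>x. 0" 1] by simp
  then show ?thesis using assms by (simp add: Lp_unit_ball_def Lp_subspace_def ae_subspace_def)
qed

text \<open>The norming condition speaks of a real supremum over the ball of \<open>Pm\<close>, so it bounds the
  individual pairings only once the supremum is known to be taken over a bounded set. Compactness
  of the ball supplies this, since the pairing with a fixed element of \<open>P\<close>, which is contained
  in \<open>Pmm\<close>, is continuous on it.\<close>

lemma dual_system_bounds:
  assumes sys: "m_dual_system M m \<eta> p p' P Pm Pmm"
    and compact: "compactin (tau_m M m \<eta> Pm Pmm) (Lp_unit_ball M m \<eta> p' Pm)"
  shows "continuous_map (tau_m M m \<eta> Pm Pmm) euclideanreal (\<lambda>G. norm (pairing e G))"
    and "\<exists>C. \<forall>e. \<forall>G\<in>Lp_unit_ball M m \<eta> p' Pm. norm (pairing e G) \<le> C * norm e"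
    and "e \<noteq> 0 \<Longrightarrow> \<exists>G\<in>Lp_unit_ball M m \<eta> p' Pm. pairing e G \<noteq> 0"
proof -
  let ?K = "Lp_unit_ball M m \<eta> p' Pm"
  have Pm: "Pm \<subseteq> Lp_vm M m \<eta> p'" and Pmm: "Pmm \<subseteq> Lp_vm M m \<eta> p" "P \<subseteq> Pmm"
    and Pms: "Lp_subspace M m \<eta> p' Pm" and nrm: "m_norming M m \<eta> p p' P Pm"
    using sys by (auto simp: m_dual_system_def Lp_subspace_def)
  have cont: "continuous_map (tau_m M m \<eta> Pm Pmm) euclideanreal (\<lambda>G. norm (pairing e G))" for e
    using continuous_map_tau_m[OF Pm Pmm(1) _ product_integrable', of "Tinv e"] Tinv_in Pmm(2)
    by (auto simp: vm_pairing_commute)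
  then show "continuous_map (tau_m M m \<eta> Pm Pmm) euclideanreal (\<lambda>G. norm (pairing e G))" .
  have bdd: "bdd_above ((\<lambda>G. norm (pairing e G)) ` ?K)" for e
  proof -
    have "compactin euclideanreal ((\<lambda>G. norm (pairing e G)) ` ?K)" by (rule image_compactin[OF compact cont])
    then show ?thesis by (simp add: compact_imp_bounded bounded_imp_bdd_above)
  qed
  define N where "N F = (SUP G\<in>?K. norm (vm_pairing M m F G))" for F
  have N: "is_norm_on \<eta> P N" "equivalent_on P N (Lp_norm M m \<eta> p)"
    using nrm unfolding m_norming_def Let_def N_def[abs_def] by auto
  have le: "norm (pairing e G) \<le> N (Tinv e)" if "G \<in> ?K" for e G
    unfolding N_def by (rule cSUP_upper[OF that bdd])
  obtain C1 where C1: "C1 > 0" "\<And>F. F \<in> P \<Longrightarrow> N F \<le> C1 * Lp_norm M m \<eta> p F"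
    using N(2) by (auto simp: equivalent_on_def)
  obtain C2 where C2: "\<And>e. Lp_norm M m \<eta> p (Tinv e) \<le> C2 * norm e"
    using Tinv_norm_bounds by blast
  have "norm (pairing e G) \<le> C1 * C2 * norm e" if "G \<in> ?K" for e G
  proof -
    have "norm (pairing e G) \<le> C1 * Lp_norm M m \<eta> p (Tinv e)"
      using le[OF that, of e] C1(2)[OF Tinv_in[of e]] by linarith
    also have "\<dots> \<le> C1 * (C2 * norm e)" using C1(1) C2 by (intro mult_left_mono) auto
    finally show ?thesis by simp
  qed
  then show "\<exists>C. \<forall>e. \<forall>G\<in>?K. norm (pairing e G) \<le> C * norm e" by blast
  show "\<exists>G\<in>?K. pairing e G \<noteq> 0" if "e \<noteq> 0"
  proof (rule ccontr)
    assume "\<not> ?thesis"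
    then have "N (Tinv e) = (SUP G\<in>?K. 0)" unfolding N_def by (intro SUP_cong) auto
    also have "\<dots> = 0" using zero_in_ball[OF Pms] by (intro cSUP_const) auto
    finally have "Tinv e = ae_zero \<eta>" using N(1) Tinv_in by (auto simp: is_norm_on_def)
    then show False using that Tinv_eq_zero by simp
  qed
qed

text \<open>A bounded sequence of \<open>E\<close> is moved to the unit ball of \<open>P\<close>, where a subsequence converges
  for \<open>\<tau>\<^sub>m(Pm)\<close>. By \<open>summing_imp_norm_null\<close>, applied to all subsequences, this convergence is
  convergence in norm.\<close>

lemma summing_dual_system_finite_dimensional:
  assumes sys: "m_dual_system M m \<eta> p p' P Pm Pmm"
    and seq: "seq_compactin (tau_m M m \<eta> P Pm) (Lp_unit_ball M m \<eta> p P)"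
    and compact: "compactin (tau_m M m \<eta> Pm Pmm) (Lp_unit_ball M m \<eta> p' Pm)"
    and q: "q > 0" and summing: "qR_summing M m \<eta> p' q Pm P T"
  shows "\<exists>B :: 'e set. finite B \<and> span B = UNIV"
proof -
  let ?K = "Lp_unit_ball M m \<eta> p' Pm"
  have Pm: "Pm \<subseteq> Lp_vm M m \<eta> p'" and Pms: "Lp_subspace M m \<eta> p' Pm"
    using sys by (auto simp: m_dual_system_def Lp_subspace_def)
  have KPm: "?K \<subseteq> Pm" by (auto simp: Lp_unit_ball_def)
  note bounds = dual_system_bounds[OF sys compact]
  obtain C where C: "\<And>e G. G \<in> ?K \<Longrightarrow> norm (pairing e G) \<le> C * norm e" using bounds(2) by blast
  obtain D where D: "\<And>n F. (\<And>i. i < n \<Longrightarrow> F i \<in> P) \<Longrightarrow>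
      (\<Sum>i<n. norm (T (F i)) powr q) powr (1 / q)
      \<le> D * (SUP G\<in>?K. (\<Sum>i<(n::nat). norm (vm_pairing M m (F i) G) powr q) powr (1 / q))"
    using summing unfolding qR_summing_def by blast
  have D: "(\<Sum>i<n. norm (e i) powr q) powr (1 / q)
      \<le> D * (SUP G\<in>?K. (\<Sum>i<(n::nat). norm (pairing (e i) G) powr q) powr (1 / q))" for n and e :: "nat \<Rightarrow> 'e"
    using D[of n "\<lambda>i. Tinv (e i)"] Tinv_in by simp
  have null: "d \<longlonglongrightarrow> 0" if d: "\<And>n. norm (d n) \<le> R" "\<And>G. G \<in> ?K \<Longrightarrow> (\<lambda>n. pairing (d n) G) \<longlonglongrightarrow> 0"
    for d :: "nat \<Rightarrow> 'e" and R
  proof (rule ccontr)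
    assume "\<not> d \<longlonglongrightarrow> 0"
    then obtain \<delta> where \<delta>: "\<delta> > 0" "\<And>N. \<exists>n\<ge>N. \<delta> \<le> norm (d n)"
      unfolding LIMSEQ_iff by (auto simp: not_less)
    then have "infinite {n. \<delta> \<le> norm (d n)}" by (auto simp: infinite_nat_iff_unbounded_le)
    then obtain s where s: "strict_mono (s :: nat \<Rightarrow> nat)" "\<And>n. s n \<in> {n. \<delta> \<le> norm (d n)}"
      using infinite_enumerate by blast
    have "\<exists>n. norm ((d \<circ> s) n) < \<delta>"
    proof (rule summing_imp_norm_null[OF compact _ _ _ C q D _ _ \<delta>(1)])
      show "?K \<noteq> {}" using zero_in_ball[OF Pms] by blast
      show "continuous_map (subtopology (tau_m M m \<eta> Pm Pmm) ?K) euclideanreal (\<lambda>G. norm (pairing e G))" for e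
        by (rule continuous_map_from_subtopology[OF bounds(1)])
      show "pairing (t *\<^sub>R e) G = t *\<^sub>R pairing e G" if "G \<in> ?K" for t e G
        using linear_scale[OF linear_pairing] that KPm Pm by blast
      show "norm ((d \<circ> s) n) \<le> R" for n using d(1) by simp
      show "(\<lambda>n. pairing ((d \<circ> s) n) G) \<longlonglongrightarrow> 0" if "G \<in> ?K" for G
        using LIMSEQ_subseq_LIMSEQ[OF d(2)[OF that] s(1)] by (simp add: o_def)
    qed
    then show False using s(2) by (auto simp: not_le[symmetric])
  qed
  obtain C2 where C2: "C2 > 0" "\<And>e. Lp_norm M m \<eta> p (Tinv e) \<le> C2 * norm e"
    using Tinv_norm_bounds by blast
  have "compact (cball (0 :: 'e) 1)"
    unfolding compact_eq_seq_compact_metric seq_compact_def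
  proof (intro allI impI)
    fix f :: "nat \<Rightarrow> 'e" assume f: "\<forall>n. f n \<in> cball 0 1"
    define \<sigma> where "\<sigma> n = Tinv ((1 / C2) *\<^sub>R f n)" for n
    have "Lp_norm M m \<eta> p (\<sigma> n) \<le> 1" for n
    proof -
      have "Lp_norm M m \<eta> p (\<sigma> n) \<le> C2 * norm ((1 / C2) *\<^sub>R f n)" unfolding \<sigma>_def by (rule C2(2))
      also have "\<dots> \<le> 1" using f C2(1) by simp
      finally show ?thesis .
    qed
    then have "range \<sigma> \<subseteq> Lp_unit_ball M m \<eta> p P" using Tinv_in by (auto simp: Lp_unit_ball_def \<sigma>_def)
    then obtain l s where l: "l \<in> Lp_unit_ball M m \<eta> p P" and s: "strict_mono s"
        and lim: "limitin (tau_m M m \<eta> P Pm) (\<sigma> \<circ> s) l sequentially"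
      using seq unfolding seq_compactin_def by blast
    have lP: "l \<in> P" using l by (simp add: Lp_unit_ball_def)
    define d where "d n = (1 / C2) *\<^sub>R f (s n) - T l" for n
    have dl: "ae_diff \<eta> ((\<sigma> \<circ> s) n) l = Tinv (d n)" for n
      using Tinv_diff[of "(1 / C2) *\<^sub>R f (s n)" "T l"] Tinv_T[OF lP] by (simp add: \<sigma>_def d_def)
    have "d \<longlonglongrightarrow> 0"
    proof (rule null)
      fix n
      have "norm ((1 / C2) *\<^sub>R f (s n)) \<le> 1 / C2" using f C2(1) by (simp add: field_simps)
      then show "norm (d n) \<le> 1 / C2 + norm (T l)"
        unfolding d_def using norm_triangle_ineq4[of "(1 / C2) *\<^sub>R f (s n)" "T l"] by linarith
    next
      fix G assume "G \<in> ?K"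
      then show "(\<lambda>n. pairing (d n) G) \<longlonglongrightarrow> 0"
        using limitin_tau_m[OF lim P_Lp Pm _ product_integrable] KPm unfolding dl by blast
    qed
    then have "(\<lambda>n. C2 *\<^sub>R (d n + T l)) \<longlonglongrightarrow> C2 *\<^sub>R (0 + T l)" by (intro tendsto_intros)
    moreover have "C2 *\<^sub>R (d n + T l) = f (s n)" for n using C2(1) by (simp add: d_def)
    ultimately have lim: "(f \<circ> s) \<longlonglongrightarrow> C2 *\<^sub>R T l" by (simp add: o_def)
    moreover have "C2 *\<^sub>R T l \<in> cball 0 1"
      using closed_sequentially[OF closed_cball _ lim, of 0 1] f by simp
    ultimately show "\<exists>l\<in>cball 0 1. \<exists>s. strict_mono s \<and> (f \<circ> s) \<longlonglongrightarrow> l" using s by blast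
  qed
  then show ?thesis by (rule Riesz_finite_dimension)
qed

lemma finite_dimensional_dual_system_summing:
  assumes sys: "m_dual_system M m \<eta> p p' P Pm Pmm"
    and compact: "compactin (tau_m M m \<eta> Pm Pmm) (Lp_unit_ball M m \<eta> p' Pm)"
    and B: "finite (B :: 'e set)" "span B = UNIV" and q: "q > 0"
  shows "qR_summing M m \<eta> p' q Pm P T"
proof -
  let ?K = "Lp_unit_ball M m \<eta> p' Pm"
  have Pm: "Pm \<subseteq> Lp_vm M m \<eta> p'" using sys by (auto simp: m_dual_system_def Lp_subspace_def)
  have KPm: "?K \<subseteq> Pm" by (auto simp: Lp_unit_ball_def)
  note bounds = dual_system_bounds[OF sys compact]
  obtain C where C: "\<And>e G. G \<in> ?K \<Longrightarrow> norm (pairing e G) \<le> C * norm e" using bounds(2) by blast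
  have "\<exists>D. \<forall>n e. (\<Sum>i<n. norm (e i :: 'e) powr q) powr (1 / q)
      \<le> D * (SUP G\<in>?K. (\<Sum>i<(n::nat). norm (pairing (e i) G) powr q) powr (1 / q))"
    by (rule finite_dimensional_summing[OF B linear_pairing C bounds(3) q]) (use KPm Pm in auto)
  then obtain D where D: "\<And>(n::nat) (e :: nat \<Rightarrow> 'e). (\<Sum>i<n. norm (e i) powr q) powr (1 / q)
      \<le> D * (SUP G\<in>?K. (\<Sum>i<(n::nat). norm (pairing (e i) G) powr q) powr (1 / q))" by blast
  show ?thesis
    unfolding qR_summing_def
  proof (intro exI allI impI)
    fix n :: nat and F :: "nat \<Rightarrow> ('a \<Rightarrow> real) set" assume F: "\<forall>i<n. F i \<in> P"
    have eq: "(\<Sum>i<n. norm (pairing (T (F i)) G) powr q) = (\<Sum>i<n. norm (vm_pairing M m (F i) G) powr q)" for G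
      using F by (intro sum.cong) (auto simp: Tinv_T)
    show "(\<Sum>i<n. norm (T (F i)) powr q) powr (1 / q)
        \<le> D * (SUP G\<in>?K. (\<Sum>i<n. norm (vm_pairing M m (F i) G) powr q) powr (1 / q))"
      using D[where n = n and e = "\<lambda>i. T (F i)"] unfolding eq .
  qed
qed

section \<open>A dual system for a finite-dimensional subspace\<close>

text \<open>The functional defining \<open>\<eta>\<close>, scaled into the dual unit ball. Its variation has the same null
  sets, and it takes part in the supremum that defines the norm of \<open>L\<^sup>p(m)\<close>.\<close>

lemma dominating_rybakov_functional:
  "\<exists>x'. norm x' \<le> 1 \<and> (\<forall>Q. (AE x in V x'. Q x) \<longrightarrow> (AE x in \<eta>. Q x))"
proof -
  obtain x0 where x0: "\<eta> = V x0" using ryb by (auto simp: rybakov_measure_def)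
  define k where "k = 1 / (1 + norm x0)"
  have k: "k > 0" by (simp add: k_def add_pos_nonneg)
  have "norm (k *\<^sub>R x0) \<le> 1" by (simp add: k_def add_pos_nonneg)
  moreover have "AE x in \<eta>. Q x" if "AE x in V (k *\<^sub>R x0). Q x" for Q
  proof -
    from that obtain N where N: "{x \<in> space (V (k *\<^sub>R x0)). \<not> Q x} \<subseteq> N" "emeasure (V (k *\<^sub>R x0)) N = 0"
        "N \<in> sets (V (k *\<^sub>R x0))" by (rule AE_E)
    have "scalar_measure m x0 B = 0" if "B \<in> sets M" "B \<subseteq> N" for B
    proof -
      have "scalar_measure m (k *\<^sub>R x0) B = 0"
        using N variation_null[OF vm_scalar, of N "k *\<^sub>R x0"] that by simp
      then show ?thesis using k by (simp add: scalar_measure_def blinfun.scaleR_left)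
    qed
    then have "emeasure (V x0) N = 0" using N variation_null[OF vm_scalar, of N x0] by simp
    then show ?thesis using N unfolding x0 by (intro AE_I[of _ _ N]) auto
  qed
  ultimately show ?thesis by blast
qed

text \<open>Each \<open>s e\<close> is a function representing \<open>Tinv e\<close> that depends linearly on \<open>e\<close> at every point,
  not only almost everywhere, and \<open>j e\<close> is its bounded counterpart \<open>\<sigma> s e / u\<close>. The dual is the
  range of the classes of \<open>j e\<close>, the bidual is \<open>P\<close>, and everything is read off from the
  symmetric form \<open>\<beta> e e' = \<integral> (s e) (j e') dm\<close> on \<open>E\<close>.\<close>

lemma finite_dimensional_dual_system_exists:
  assumes fin: "finite (B0 :: 'e set)" "span B0 = UNIV"
  shows "\<exists>Pm Pmm. m_dual_system M m \<eta> p p' P Pm Pmm \<and>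
    seq_compactin (tau_m M m \<eta> P Pm) (Lp_unit_ball M m \<eta> p P) \<and>
    compactin (tau_m M m \<eta> Pm Pmm) (Lp_unit_ball M m \<eta> p' Pm)"
proof -
  obtain B where B0: "B \<subseteq> B0" "independent B" "B0 \<subseteq> span B"
    using maximal_independent_subset[of B0] by blast
  have B: "finite B" "independent B" "span B = UNIV"
    using B0 fin finite_subset span_mono[OF B0(3)] by (auto simp: span_span)
  obtain C where C: "C \<ge> 0" "\<And>e b. \<bar>representation B e b\<bar> \<le> C * norm e"
    using finite_basis_coordinates_bounded[OF B] by blast
  let ?c = "representation B"
  have c_add: "?c (e + e') b = ?c e b + ?c e' b" and c_scale: "?c (t *\<^sub>R e) b = t * ?c e b" for e e' b t
    using representation_add[OF B(2), of e' e] representation_scale[OF B(2), of e t] B(3) by auto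
  have expand: "(\<Sum>b\<in>B. ?c e b *\<^sub>R b) = e" for e
    using sum_representation_eq[OF B(2) _ B(1) subset_refl, of e] B(3) by simp
  define s where "s e x = (\<Sum>b\<in>B. ?c e b * rep b x)" for e x
  have s_class: "ae_class \<eta> (s e) = Tinv e" for e
    using Tinv_sum[OF B(1), of "?c e" "\<lambda>b. b"] expand by (simp add: s_def[abs_def])
  have sm [measurable]: "s e \<in> borel_measurable M" for e unfolding s_def[abs_def] by measurable
  have s_mem: "in_Lp p (s e)" for e
    using in_Lp_of_class[of "s e" p] s_class[of e] Tinv_in[of e] P_Lp sm by auto
  have s_add: "s (e + e') x = s e x + s e' x" and s_scale: "s (t *\<^sub>R e) x = t * s e x" for e e' t x
    by (simp_all add: s_def c_add c_scale algebra_simps sum.distrib sum_distrib_left)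
  \<comment> \<open>Dominates every \<open>s e\<close> up to a constant; the summand 1 keeps the quotient defined.\<close>
  define u where "u x = 1 + (\<Sum>b\<in>B. \<bar>rep b x\<bar>)" for x
  have u: "u x \<ge> 1" for x by (simp add: u_def sum_nonneg)
  have um [measurable]: "u \<in> borel_measurable M" unfolding u_def[abs_def] by measurable
  have s_le: "\<bar>s e x\<bar> \<le> C * norm e * u x" for e x
  proof -
    have "\<bar>s e x\<bar> \<le> (\<Sum>b\<in>B. \<bar>?c e b\<bar> * \<bar>rep b x\<bar>)"
      unfolding s_def by (rule order_trans[OF sum_abs]) (simp add: abs_mult)
    also have "\<dots> \<le> (\<Sum>b\<in>B. C * norm e * \<bar>rep b x\<bar>)" by (intro sum_mono mult_right_mono C) simp
    also have "\<dots> = C * norm e * (\<Sum>b\<in>B. \<bar>rep b x\<bar>)" by (rule sum_distrib_left[symmetric])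
    also have "\<dots> \<le> C * norm e * u x" using C(1) by (intro mult_left_mono) (auto simp: u_def)
    finally show ?thesis .
  qed
  obtain x1 where x1: "norm x1 \<le> 1" "\<And>Q. AE x in V x1. Q x \<Longrightarrow> AE x in \<eta>. Q x"
    using dominating_rybakov_functional by blast
  interpret V1: finite_measure "V x1" by (rule finite_V)
  define j where "j e x = polar x1 x * s e x / u x" for e x
  have jm [measurable]: "j e \<in> borel_measurable M" for e unfolding j_def[abs_def] by measurable
  have j_add: "j (e + e') x = j e x + j e' x" and j_scale: "j (t *\<^sub>R e) x = t * j e x" for e e' t x
    by (simp_all add: j_def s_add s_scale field_simps add_divide_distrib)
  have abs_j: "\<bar>j e x\<bar> = \<bar>s e x\<bar> / u x" for e x
    using u[of x] by (simp add: j_def abs_mult)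
  have j_le: "\<bar>j e x\<bar> \<le> C * norm e" for e x
    unfolding abs_j using s_le[of e x] u[of x] by (simp add: field_simps)
  have j_mem: "in_Lp p' (j e)" for e by (rule in_Lp_bounded[of _ "C * norm e"]) (auto simp: j_le)
  have sj: "s e x * j e' x = s e' x * j e x" for e e' x by (simp add: j_def)
  define J where "J e = ae_class \<eta> (j e)" for e
  have i: "vm_integrable M m (\<lambda>x. s e x * j e' x)" for e e'
    by (rule product_integrable[OF s_mem j_mem])
  define \<beta> where "\<beta> e e' = vm_integral M m (\<lambda>x. s e x * j e' x)" for e e'
  have \<beta>_sym: "\<beta> e e' = \<beta> e' e" for e e' unfolding \<beta>_def by (simp only: sj[of e _ e'])
  have pair: "vm_pairing M m (Tinv e) (J e') = \<beta> e e'" for e e'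
    unfolding J_def s_class[symmetric] \<beta>_def by (rule vm_pairing_class[OF sm jm i])
  have pair': "vm_pairing M m (J e) (Tinv e') = \<beta> e e'" for e e'
    using pair[of e' e] \<beta>_sym by (simp add: vm_pairing_commute)
  have \<beta>_lin: "linear (\<lambda>e. \<beta> e e')" for e'
  proof -
    have lc: "\<beta> (t *\<^sub>R e + v *\<^sub>R e'') e' = t *\<^sub>R \<beta> e e' + v *\<^sub>R \<beta> e'' e'" for t v e e''
      using vm_integrable_lincomb(2)[OF i i, of t e e' v e'' e']
      by (simp add: \<beta>_def s_add s_scale algebra_simps)
    show ?thesis using lc[of 1 _ 1] lc[of _ _ 0 0] by (intro linearI) auto
  qed
  have \<beta>_lin': "linear (\<lambda>e'. \<beta> e e')" for e using \<beta>_lin[of e] by (simp add: \<beta>_sym[of e])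
  define C\<beta> where "C\<beta> = C * (\<Sum>b\<in>B. C * (\<Sum>b'\<in>B. norm (\<beta> b b'))) + 1"
  have C\<beta>: "C\<beta> > 0" unfolding C\<beta>_def using C(1) by (intro add_nonneg_pos mult_nonneg_nonneg sum_nonneg) auto
  have \<beta>_bdd: "norm (\<beta> e e') \<le> C\<beta> * norm e * norm e'" for e e'
  proof -
    have "norm (\<beta> e e') \<le> C * (\<Sum>b\<in>B. norm (\<beta> b e')) * norm e"
      by (rule finite_dimensional_linear_bounded[OF B \<beta>_lin C(2)])
    also have "\<dots> \<le> C * (\<Sum>b\<in>B. C * (\<Sum>b'\<in>B. norm (\<beta> b b')) * norm e') * norm e"
      using C(1) by (intro mult_right_mono mult_left_mono sum_mono
          finite_dimensional_linear_bounded[OF B \<beta>_lin' C(2)]) auto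
    also have "\<dots> = (C\<beta> - 1) * norm e * norm e'"
      unfolding sum_distrib_right[symmetric] C\<beta>_def by (simp only: add_diff_cancel_right' mult_ac)
    also have "\<dots> \<le> C\<beta> * norm e * norm e'" by (intro mult_right_mono) auto
    finally show ?thesis .
  qed
  interpret \<beta>: bounded_bilinear \<beta>
    using \<beta>_bdd
    by unfold_locales (auto simp: linear_add[OF \<beta>_lin] linear_scale[OF \<beta>_lin]
        linear_add[OF \<beta>_lin'] linear_scale[OF \<beta>_lin'] mult_ac intro!: exI[of _ C\<beta>])
  have nonzero: "e = 0" if "AE x in V x1. s e x = 0" for e
  proof -
    have "ae_class \<eta> (s e) = ae_class \<eta> (\<lambda>x. 0)" by (rule ae_class_eqI[OF _ _ x1(2)[OF that]]) auto
    then show ?thesis using s_class[of e] Tinv_eq_zero by (simp add: ae_zero_def)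
  qed
  have \<beta>_pos: "norm (\<beta> e e) > 0" if "e \<noteq> 0" for e
  proof -
    have eq: "polar x1 x * (s e x * j e x) = (s e x)\<^sup>2 / u x" for x
    proof -
      have "polar x1 x * (s e x * j e x) = (polar x1 x * polar x1 x) * (s e x)\<^sup>2 / u x"
        by (simp add: j_def power2_eq_square)
      then show ?thesis by simp
    qed
    have "blinfun_apply x1 (\<beta> e e) = (LINT x|V x1. (s e x)\<^sup>2 / u x)"
      unfolding \<beta>_def apply_vm_integral[OF i] eq ..
    moreover have "(LINT x|V x1. (s e x)\<^sup>2 / u x) \<noteq> 0"
    proof
      have nn: "(s e x)\<^sup>2 / u x \<ge> 0" for x using u[of x] by simp
      have int: "integrable (V x1) (\<lambda>x. (s e x)\<^sup>2 / u x)"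
        using i[of e e] unfolding eq[symmetric]
        by (intro polar_integrable) (auto simp: vm_integrable_iff scalarly_integrable_def)
      assume "(LINT x|V x1. (s e x)\<^sup>2 / u x) = 0"
      then have "AE x in V x1. (s e x)\<^sup>2 / u x = 0"
        using integral_nonneg_eq_0_iff_AE[OF int] nn by simp
      then have "AE x in V x1. s e x = 0"
      proof eventually_elim
        case (elim x) then show ?case using u[of x] by simp
      qed
      then show False using nonzero that by blast
    qed
    ultimately show ?thesis by (metis blinfun.zero_right zero_less_norm_iff)
  qed
  \<comment> \<open>Coercivity: a positive continuous function that is homogeneous of degree 2.\<close>
  have "\<exists>c>0. \<forall>e. c * norm e ^ 2 \<le> norm (\<beta> e e)"
  proof (rule homogeneous_lower_bound[OF B(1,3) _ \<beta>_pos])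
    show "continuous_on UNIV (\<lambda>e. norm (\<beta> e e))"
      by (intro continuous_on_norm \<beta>.continuous_on continuous_on_id)
    show "norm (\<beta> (t *\<^sub>R e) (t *\<^sub>R e)) = \<bar>t\<bar> ^ 2 * norm (\<beta> e e)" for t e
      by (simp add: \<beta>.scaleR_left \<beta>.scaleR_right power2_eq_square)
  qed simp_all
  then obtain c where c: "c > 0" "\<And>e. c * (norm e)\<^sup>2 \<le> norm (\<beta> e e)" by blast
  have ji: "integrable (V x1) (\<lambda>x. \<bar>j e x\<bar>)" for e
    by (rule V1.integrable_const_bound[of _ "C * norm e"]) (auto simp: j_le)
  \<comment> \<open>The norm of \<open>j e\<close> in \<open>L\<^sup>p\<^sup>'(m)\<close> is bounded below through its norm in \<open>L\<^sup>1\<close> for the variation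
    of \<open>\<langle>m,x1\<rangle>\<close>, where the triangle inequality and hence continuity are immediate.\<close>
  define \<psi> where "\<psi> e = (LINT x|V x1. \<bar>j e x\<bar>)" for e
  have "\<exists>c>0. \<forall>e. c * norm e ^ 1 \<le> \<psi> e"
  proof (rule homogeneous_lower_bound[OF B(1,3)])
    have lip: "\<psi> e - \<psi> e' \<le> C * measure (V x1) (space M) * norm (e - e')" for e e'
    proof -
      have "\<psi> e - \<psi> e' = (LINT x|V x1. \<bar>j e x\<bar> - \<bar>j e' x\<bar>)"
        unfolding \<psi>_def by (rule Bochner_Integration.integral_diff[OF ji ji, symmetric])
      also have "\<dots> \<le> (LINT x|V x1. C * norm (e - e'))"
      proof (rule integral_mono)
        fix x
        have "j e x = j (e - e') x + j e' x" using j_add[of "e - e'" e' x] by simp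
        then show "\<bar>j e x\<bar> - \<bar>j e' x\<bar> \<le> C * norm (e - e')" using j_le[of "e - e'" x] by linarith
      qed (auto intro!: Bochner_Integration.integrable_diff ji)
      also have "\<dots> = C * measure (V x1) (space M) * norm (e - e')" by simp
      finally show ?thesis .
    qed
    have "(C * measure (V x1) (space M))-lipschitz_on UNIV \<psi>"
    proof (rule lipschitz_onI)
      fix e e' :: 'e
      show "dist (\<psi> e) (\<psi> e') \<le> C * measure (V x1) (space M) * dist e e'"
        using lip[of e e'] lip[of e' e] by (simp add: dist_real_def dist_norm norm_minus_commute)
    qed (use C(1) in simp)
    then show "continuous_on UNIV \<psi>" by (rule lipschitz_on_continuous_on)
    show "\<psi> (t *\<^sub>R e) = \<bar>t\<bar> ^ 1 * \<psi> e" for t e by (simp add: \<psi>_def j_scale abs_mult)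
    show "\<psi> e > 0" if "e \<noteq> 0" for e
    proof (rule ccontr)
      assume "\<not> \<psi> e > 0"
      moreover have "\<psi> e \<ge> 0" by (simp add: \<psi>_def)
      ultimately have "\<psi> e = 0" by simp
      then have "AE x in V x1. \<bar>j e x\<bar> = 0"
        unfolding \<psi>_def using integral_nonneg_eq_0_iff_AE[OF ji] by simp
      then have "AE x in V x1. s e x = 0"
      proof eventually_elim
        case (elim x) then show ?case using u[of x] abs_j[of e x] by simp
      qed
      then show False using nonzero that by blast
    qed
  qed simp
  then obtain c\<psi> where c\<psi>: "c\<psi> > 0" "\<And>e. c\<psi> * norm e \<le> \<psi> e" by auto
  define v where "v = measure (V x1) (space M) + 1"
  have v: "v > 0" by (simp add: v_def add_nonneg_pos)
  have J_lower: "c\<psi> / v * norm e \<le> Lp_norm M m \<eta> p' (J e)" for e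
  proof -
    have "c\<psi> * norm e \<le> v * Lp_norm M m \<eta> p' (J e)"
      using c\<psi>(2)[of e] L1_le_Lp_norm[OF p' j_mem x1(1), of e] by (simp add: \<psi>_def J_def v_def)
    then show ?thesis using v by (simp add: field_simps)
  qed
  obtain K where K: "K \<ge> 0" "\<And>f c. f \<in> borel_measurable M \<Longrightarrow> 0 \<le> c \<Longrightarrow> (\<And>x. x \<in> space M \<Longrightarrow> \<bar>f x\<bar> \<le> c) \<Longrightarrow>
      Lp_norm M m \<eta> p' (ae_class \<eta> f) \<le> K * c"
    using Lp_norm_bounded[OF p'] by blast
  define CJ where "CJ = K * C + 1"
  have CJ: "CJ > 0" unfolding CJ_def using K(1) C(1) by (simp add: add_nonneg_pos)
  have J_upper: "Lp_norm M m \<eta> p' (J e) \<le> CJ * norm e" for e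
  proof -
    have "Lp_norm M m \<eta> p' (J e) \<le> K * (C * norm e)"
      unfolding J_def using C(1) j_le by (intro K(2)) auto
    also have "\<dots> \<le> CJ * norm e" by (simp add: CJ_def algebra_simps)
    finally show ?thesis .
  qed
  obtain cS CS where Tinv_bounds: "cS > 0" "CS > 0" "\<And>e. cS * norm e \<le> Lp_norm M m \<eta> p (Tinv e)"
      "\<And>e. Lp_norm M m \<eta> p (Tinv e) \<le> CS * norm e"
    using Tinv_norm_bounds by blast
  have cv: "c\<psi> / v > 0" using c\<psi>(1) v by simp
  have J_add: "ae_add \<eta> (J e) (J e') = J (e + e')" for e e'
    unfolding J_def by (subst ae_add_class[OF jm jm]) (simp add: j_add[abs_def])
  have J_scale: "ae_scale \<eta> t (J e) = J (t *\<^sub>R e)" for t e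
    unfolding J_def by (subst ae_scale_class[OF jm]) (simp add: j_scale[abs_def])
  have J_diff: "ae_diff \<eta> (J e) (J e') = J (e - e')" for e e'
  proof -
    have "j (e - e') = (\<lambda>x. j e x - j e' x)"
    proof
      fix x show "j (e - e') x = j e x - j e' x" using j_add[of "e - e'" e' x] by simp
    qed
    then show ?thesis unfolding J_def by (subst ae_diff_class[OF jm jm]) simp
  qed
  have J_zero: "J 0 = ae_zero \<eta>"
  proof -
    have "j 0 = (\<lambda>x. 0)" using j_scale[of 0 0] by (auto simp: fun_eq_iff)
    then show ?thesis by (simp add: J_def ae_zero_def)
  qed
  have J_eq_zero: "J e = ae_zero \<eta> \<longleftrightarrow> e = 0" for e
  proof
    assume "J e = ae_zero \<eta>"
    then have "Lp_norm M m \<eta> p' (J e) = Lp_norm M m \<eta> p' (J 0)" using J_zero by simp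
    also have "\<dots> \<le> 0" using J_upper[of 0] by simp
    finally have "c\<psi> / v * norm e \<le> 0" using J_lower[of e] by linarith
    then have "norm e \<le> 0" using cv by (meson mult_pos_pos not_le)
    then show "e = 0" by simp
  qed (simp add: J_zero)
  have J_sub: "Lp_subspace M m \<eta> p' (range J)"
    unfolding Lp_subspace_def ae_subspace_def
    using j_mem J_zero[symmetric] by (auto simp: Lp_vm_eq J_def[symmetric] J_add J_scale) (auto simp: J_def)
  have n1: "m_norming M m \<eta> p p' (range Tinv) (range J)"
    by (rule m_normingI[where A = Tinv and A' = J and \<beta> = \<beta>, OF Tinv_add Tinv_scale Tinv_eq_zero pair \<beta>_lin
          \<beta>.scaleR_right \<beta>_bdd C\<beta> c(2,1) J_lower J_upper cv CJ Tinv_bounds(3,4,1,2)])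
  have n2: "m_norming M m \<eta> p' p (range J) (range Tinv)"
    by (rule m_normingI[where A = J and A' = Tinv and \<beta> = \<beta>, OF J_add J_scale J_eq_zero pair' \<beta>_lin
          \<beta>.scaleR_right \<beta>_bdd C\<beta> c(2,1) Tinv_bounds(3,4,1,2) J_lower J_upper cv CJ])
  have sys: "m_dual_system M m \<eta> p p' P (range J) P"
    unfolding m_dual_system_def using P J_sub n1 n2 by (simp add: range_Tinv)
  have s_lim: "(\<lambda>n. s (f n) x) \<longlonglongrightarrow> s e x" if "f \<longlonglongrightarrow> e" for f :: "nat \<Rightarrow> 'e" and e x
  proof -
    have "bounded_linear (\<lambda>e. s e x)"
      by (rule bounded_linear_intro[of _ "C * u x"]) (use s_le[of _ x] in \<open>auto simp: s_add s_scale mult_ac\<close>)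
    then show ?thesis using that by (rule bounded_linear.tendsto)
  qed
  have j_lim: "(\<lambda>n. j (f n) x) \<longlonglongrightarrow> j e x" if "f \<longlonglongrightarrow> e" for f :: "nat \<Rightarrow> 'e" and e x
    unfolding j_def using u[of x] by (intro tendsto_intros s_lim[OF that]) auto
  have compact_Tinv: "compact {e. Lp_norm M m \<eta> p (Tinv e) \<le> 1}"
  proof (rule finite_span_compact[OF B(1,3)])
    show "closed {e. Lp_norm M m \<eta> p (Tinv e) \<le> 1}"
      unfolding closed_sequential_limits
      using Lp_norm_le_limit[OF p s_mem s_mem s_lim] by (auto simp: s_class)
    have "norm e \<le> 1 / cS" if "Lp_norm M m \<eta> p (Tinv e) \<le> 1" for e
      using Tinv_bounds(3)[of e] Tinv_bounds(1) that by (simp add: field_simps)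
    then show "bounded {e. Lp_norm M m \<eta> p (Tinv e) \<le> 1}" by (auto simp: bounded_iff)
  qed
  have compact_J: "compact {e. Lp_norm M m \<eta> p' (J e) \<le> 1}"
  proof (rule finite_span_compact[OF B(1,3)])
    show "closed {e. Lp_norm M m \<eta> p' (J e) \<le> 1}"
      unfolding closed_sequential_limits J_def
      using Lp_norm_le_limit[OF p' j_mem j_mem j_lim] by auto
    have "norm e \<le> 1 / (c\<psi> / v)" if "Lp_norm M m \<eta> p' (J e) \<le> 1" for e
    proof -
      have "c\<psi> / v * norm e \<le> 1" using J_lower[of e] that by linarith
      then have "norm e * (c\<psi> / v) \<le> 1" by (simp only: mult.commute)
      then show ?thesis using cv by (simp only: pos_le_divide_eq)
    qed
    then show "bounded {e. Lp_norm M m \<eta> p' (J e) \<le> 1}" by (auto simp: bounded_iff)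
  qed
  have cont_Tinv: "continuous_map euclidean (tau_m M m \<eta> (range Tinv) (range J)) Tinv"
    by (rule continuous_map_into_tau_m[OF Tinv_diff])
      (auto simp: pair intro!: \<beta>.continuous_on continuous_on_id continuous_on_const)
  have cont_J: "continuous_map euclidean (tau_m M m \<eta> (range J) (range Tinv)) J"
    by (rule continuous_map_into_tau_m[OF J_diff])
      (auto simp: pair' intro!: \<beta>.continuous_on continuous_on_id continuous_on_const)
  have "compactin (tau_m M m \<eta> (range J) P) (Lp_unit_ball M m \<eta> p' (range J))"
  proof -
    have "compactin (tau_m M m \<eta> (range J) (range Tinv)) (J ` {e. Lp_norm M m \<eta> p' (J e) \<le> 1})"
      using compact_J cont_J by (intro image_compactin[OF _ cont_J]) simp
    moreover have "J ` {e. Lp_norm M m \<eta> p' (J e) \<le> 1} = Lp_unit_ball M m \<eta> p' (range J)"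
      by (auto simp: Lp_unit_ball_def)
    ultimately show ?thesis by (simp add: range_Tinv)
  qed
  moreover have "seq_compactin (tau_m M m \<eta> P (range J)) (Lp_unit_ball M m \<eta> p P)"
    unfolding seq_compactin_def
  proof (intro conjI allI impI)
    show "Lp_unit_ball M m \<eta> p P \<subseteq> topspace (tau_m M m \<eta> P (range J))"
      by (auto simp: topspace_tau_m Lp_unit_ball_def)
    fix \<sigma> :: "nat \<Rightarrow> ('a \<Rightarrow> real) set" assume \<sigma>: "range \<sigma> \<subseteq> Lp_unit_ball M m \<eta> p P"
    then have \<sigma>P: "Tinv (T (\<sigma> n)) = \<sigma> n" and "Lp_norm M m \<eta> p (\<sigma> n) \<le> 1" for n
      by (auto simp: Lp_unit_ball_def Tinv_T subset_eq)
    then have "\<forall>n. T (\<sigma> n) \<in> {e. Lp_norm M m \<eta> p (Tinv e) \<le> 1}" by simp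
    then obtain l t where l: "l \<in> {e. Lp_norm M m \<eta> p (Tinv e) \<le> 1}" and t: "strict_mono t"
        and lim: "((\<lambda>n. T (\<sigma> n)) \<circ> t) \<longlonglongrightarrow> l"
      using compact_Tinv unfolding compact_eq_seq_compact_metric seq_compact_def by metis
    have "limitin (tau_m M m \<eta> P (range J)) (Tinv \<circ> ((\<lambda>n. T (\<sigma> n)) \<circ> t)) (Tinv l) sequentially"
      by (rule continuous_map_limit[OF cont_Tinv[unfolded range_Tinv]]) (use lim in \<open>simp add: limitin_canonical_iff\<close>)
    then have "limitin (tau_m M m \<eta> P (range J)) (\<sigma> \<circ> t) (Tinv l) sequentially"
      by (simp add: o_def \<sigma>P)
    then show "\<exists>l\<in>Lp_unit_ball M m \<eta> p P. \<exists>r. strict_mono r \<and>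
        limitin (tau_m M m \<eta> P (range J)) (\<sigma> \<circ> r) l sequentially"
      using l t Tinv_in by (intro bexI[of _ "Tinv l"] exI[of _ t]) (auto simp: Lp_unit_ball_def)
  qed
  ultimately show ?thesis using sys by blast
qed

end

theorem theorem9:
  fixes M :: "'a measure"
    and m :: "'a set \<Rightarrow> 'x::banach"
    and \<eta> :: "'a measure"
    and p p' :: ennreal
    and P :: "('a \<Rightarrow> real) set set"
    and T :: "('a \<Rightarrow> real) set \<Rightarrow> 'e::banach"
  assumes "vector_measure M m"
    and "rybakov_measure M m \<eta>"
    and "1 \<le> p" and "inverse p + inverse p' = 1"
    and "Lp_subspace M m \<eta> p P"
    and "Lp_isomorphism M m \<eta> p P T"
  shows "((\<exists>Pm Pmm. m_dual_system M m \<eta> p p' P Pm Pmm \<and>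
              seq_compactin (tau_m M m \<eta> P Pm) (Lp_unit_ball M m \<eta> p P) \<and>
              compactin (tau_m M m \<eta> Pm Pmm) (Lp_unit_ball M m \<eta> p' Pm) \<and>
              (\<exists>q\<ge>1. qR_summing M m \<eta> p' q Pm P T))
          \<longleftrightarrow> ae_finite_dimensional \<eta> P)
       \<and> (\<forall>Pm Pmm. m_dual_system M m \<eta> p p' P Pm Pmm \<and>
              seq_compactin (tau_m M m \<eta> P Pm) (Lp_unit_ball M m \<eta> p P) \<and>
              compactin (tau_m M m \<eta> Pm Pmm) (Lp_unit_ball M m \<eta> p' Pm) \<and>
              (\<exists>q\<ge>1. qR_summing M m \<eta> p' q Pm P T)
            \<longrightarrow> (\<forall>q\<ge>1. qR_summing M m \<eta> p' q Pm P T))"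
proof -
  interpret lp_operator M m \<eta> p p' P T
    by unfold_locales (fact assms)+
  have fin: "\<exists>B :: 'e set. finite B \<and> span B = UNIV"
    if "m_dual_system M m \<eta> p p' P Pm Pmm"
      "seq_compactin (tau_m M m \<eta> P Pm) (Lp_unit_ball M m \<eta> p P)"
      "compactin (tau_m M m \<eta> Pm Pmm) (Lp_unit_ball M m \<eta> p' Pm)"
      "q \<ge> 1" "qR_summing M m \<eta> p' q Pm P T" for Pm Pmm q
    using summing_dual_system_finite_dimensional[OF that(1-3) _ that(5)] that(4) by simp
  have all: "qR_summing M m \<eta> p' q Pm P T"
    if "m_dual_system M m \<eta> p p' P Pm Pmm"
      "compactin (tau_m M m \<eta> Pm Pmm) (Lp_unit_ball M m \<eta> p' Pm)"
      "\<exists>B :: 'e set. finite B \<and> span B = UNIV" "q \<ge> 1" for Pm Pmm q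
    using finite_dimensional_dual_system_summing[OF that(1,2), of _ q] that(3,4) by auto
  show ?thesis
  proof (intro conjI iffI allI impI; (elim exE conjE)?)
    fix Pm Pmm and q :: real
    assume "m_dual_system M m \<eta> p p' P Pm Pmm"
      "seq_compactin (tau_m M m \<eta> P Pm) (Lp_unit_ball M m \<eta> p P)"
      "compactin (tau_m M m \<eta> Pm Pmm) (Lp_unit_ball M m \<eta> p' Pm)"
      "1 \<le> q" "qR_summing M m \<eta> p' q Pm P T"
    then show "ae_finite_dimensional \<eta> P" using fin ae_finite_dimensional_iff by blast
  next
    assume "ae_finite_dimensional \<eta> P"
    then have "\<exists>B :: 'e set. finite B \<and> span B = UNIV" using ae_finite_dimensional_iff by blast
    moreover from this obtain Pm Pmm where "m_dual_system M m \<eta> p p' P Pm Pmm"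
        "seq_compactin (tau_m M m \<eta> P Pm) (Lp_unit_ball M m \<eta> p P)"
        "compactin (tau_m M m \<eta> Pm Pmm) (Lp_unit_ball M m \<eta> p' Pm)"
      using finite_dimensional_dual_system_exists by blast
    ultimately show "\<exists>Pm Pmm. m_dual_system M m \<eta> p p' P Pm Pmm \<and>
              seq_compactin (tau_m M m \<eta> P Pm) (Lp_unit_ball M m \<eta> p P) \<and>
              compactin (tau_m M m \<eta> Pm Pmm) (Lp_unit_ball M m \<eta> p' Pm) \<and>
              (\<exists>q\<ge>1. qR_summing M m \<eta> p' q Pm P T)"
      using all[of Pm Pmm 1] by (intro exI[of _ Pm] exI[of _ Pmm] conjI exI[of _ 1]) auto
  next
    fix Pm Pmm and q q' :: real
    assume "m_dual_system M m \<eta> p p' P Pm Pmm"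
      "seq_compactin (tau_m M m \<eta> P Pm) (Lp_unit_ball M m \<eta> p P)"
      "compactin (tau_m M m \<eta> Pm Pmm) (Lp_unit_ball M m \<eta> p' Pm)"
      "1 \<le> q'" "qR_summing M m \<eta> p' q' Pm P T" "1 \<le> q"
    then show "qR_summing M m \<eta> p' q Pm P T" using fin all by blast
  qed
qed

end
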